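(* For real $x>1/6$ let $$f_{14}(x)=\frac{(69x^2-40x+6)\,\Gamma(6x)\,\Gamma(x)^7}{18(6x-1)\,\Gamma(3x)^3\,\Gamma(2x)^2}.$$ Then the following series converge and $$\sum_{k=1}^\infty f_{14}'(k)=-12\zeta(3),\qquad \sum_{k=1}^\infty f_{14}''(k)=28\zeta(4),\qquad \sum_{k=1}^\infty f_{14}^{(3)}(k)=72\big(7\zeta(5)-4\zeta(2)\zeta(3)\big),$$ $$\sum_{k=1}^\infty f_{14}^{(4)}(k)=48\big(126\zeta(3)^2-181\zeta(6)\big),\qquad \sum_{k=1}^\infty f_{14}^{(5)}(k)=720\big(623\zeta(7)+56\zeta(2)\zeta(5)-554\zeta(3)\zeta(4)\big),$$ $$\frac{1}{24}\sum_{k=1}^\infty f_{14}^{(6)}(k)=121824\zeta(5,3)+503280\zeta(3)\zeta(5)+30240\zeta(2)\zeta(3)^2-701863\zeta(8),$$ $$\frac{1}{20160}\sum_{k=1}^\infty f_{14}^{(7)}(k)=22657\zeta(9)+3738\zeta(2)\zeta(7)+5817\zeta(4)\zeta(5)-27711\zeta(3)\zeta(6)-882\zeta(3)^3.$$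
   Context: $\Gamma$ is Euler's gamma function and $f^{(m)}$ (also $f',f''$) is the $m$-th derivative with respect to $x$. $\zeta(s)=\sum_{n\ge1}n^{-s}$ is the Riemann zeta function and $\zeta(5,3)=\sum_{k_1>k_2>0}\frac{1}{k_1^5k_2^3}$. *)

theory Defs
  imports "HOL-Analysis.Analysis"
begin

definition zeta :: "real \<Rightarrow> real" where
  "zeta s = (\<Sum>n. real (Suc n) powr (- s))"

definition double_zeta :: "nat \<Rightarrow> nat \<Rightarrow> real" where
  "double_zeta a b =
     (\<Sum>\<^sub>\<infinity>(k\<^sub>1, k\<^sub>2)\<in>{(k\<^sub>1 :: nat, k\<^sub>2). k\<^sub>1 > k\<^sub>2 \<and> k\<^sub>2 > 0}. 1 / (real k\<^sub>1 ^ a * real k\<^sub>2 ^ b))"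

text \<open>
  The function is meant for \<open>x > 1/6\<close>.  The formula is used on all of \<open>\<real>\<close>; its values for
  \<open>x \<le> 1/6\<close> do not affect any derivative at a positive integer.
\<close>

definition f14 :: "real \<Rightarrow> real" where
  "f14 x = (69 * x ^ 2 - 40 * x + 6) * Gamma (6 * x) * Gamma x ^ 7
             / (18 * (6 * x - 1) * Gamma (3 * x) ^ 3 * Gamma (2 * x) ^ 2)"

end

theory Submission
  imports Defs "HOL-Complex_Analysis.Complex_Analysis"
begin

text \<open>
  Let \<open>S(z)\<close> be the sum of \<open>f\<^sub>1\<^sub>4(n + z)\<close> over \<open>n \<ge> 1\<close>; the theorem asks for its Taylor coefficients at \<open>0\<close>.
  A WZ pair shows that \<open>sin\<^sup>2(\<pi>z)\<close> times \<open>S(z)\<close>, corrected by an explicit hypergeometric series in \<open>z\<close>, is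
  \<open>1\<close>-periodic; it grows more slowly than \<open>exp(4\<pi>\<bar>Im z\<bar>)\<close>, so as a function of \<open>q = exp(2\<pi>iz)\<close> it is
  a Laurent polynomial \<open>a/q + b + cq\<close> by Liouville's theorem.  Comparing the coefficients of \<open>1\<close>
  and \<open>z\<close> at the origin leaves one free constant and gives
  \<open>z\<^sup>2 S(z) = const z\<^sup>2 + 2 (\<Phi>(z) (1 - 12 z\<^sup>2 D(z)) - (\<pi>z / sin \<pi>z)\<^sup>2)\<close>, where
  \<open>\<Phi>(z) = \<Gamma>(1+6z) \<Gamma>(1+z)\<^sup>7 / (\<Gamma>(1+3z)\<^sup>3 \<Gamma>(1+2z)\<^sup>2)\<close> has Taylor coefficients in the zeta values, and
  the coefficient of \<open>z\<^sup>j\<close> in \<open>D\<close> is an integer combination of multiple zeta values of weight \<open>j + 2\<close>.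
  For weights up to \<open>9\<close> these are reduced to products of zeta values and \<open>\<zeta>(5,3)\<close> by explicit
  combinations of double shuffle relations, which are verified by rewriting.
\<close>

section \<open>Words, shuffle and stuffle products\<close>

text \<open>The factor sin^2(pi z) is forced by the boundary of the WZ sum: the mate at index 1
  contains the square of \<open>rGamma (1 - z)\<close>, which reflection turns into a sine. The
  growth rate decides how many constants remain unknown: all parts of the periodic function are of
  polynomial size times exp(2 pi |Im z|), and any rate below 4 pi already excludes the second powers
  of q and 1/q. Growth is measured on the strip 4 <= Re z <= 6, away from every pole, and
  periodicity carries the result to the origin. There the linear coefficient vanishes because
  Euler's constant cancels, 6 + 7 = 3 * 3 + 2 * 2. The remaining free constant affects only the
  coefficient belonging to S(0), so precisely the sums of derivatives of positive order are
  determined. Multiple zeta values arise because consecutive terms of the hypergeometric series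
  differ by rational factors in z/m; expanding their product over m < k in powers of z produces
  nested sums, and the sum over k closes them.\<close>

text \<open>Integer combinations of words, stored as binary tries so that the certificates can be checked by rewriting.
  The letters \<open>False\<close> and \<open>True\<close> stand for the forms \<open>dt/t\<close> and \<open>dt/(1-t)\<close>, so the index \<open>s\<close> becomes
  \<open>False\<^sup>s\<^sup>-\<^sup>1 True\<close>.\<close>

datatype wsum = Zero | Node int wsum wsum

fun eval_wsum :: "(bool list \<Rightarrow> 'a::comm_ring_1) \<Rightarrow> wsum \<Rightarrow> 'a" where
  "eval_wsum f Zero = 0"
| "eval_wsum f (Node c l r) =
     of_int c * f [] + eval_wsum (\<lambda>w. f (False # w)) l + eval_wsum (\<lambda>w. f (True # w)) r"

fun words_of :: "wsum \<Rightarrow> bool list set" where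
  "words_of Zero = {}"
| "words_of (Node c l r) =
     (if c = 0 then {} else {[]}) \<union> Cons False ` words_of l \<union> Cons True ` words_of r"

fun add_wsum :: "wsum \<Rightarrow> wsum \<Rightarrow> wsum" where
  "add_wsum Zero t = t"
| "add_wsum s Zero = s"
| "add_wsum (Node c l r) (Node d l' r') = Node (c + d) (add_wsum l l') (add_wsum r r')"

fun scale_wsum :: "int \<Rightarrow> wsum \<Rightarrow> wsum" where
  "scale_wsum a Zero = Zero"
| "scale_wsum a (Node c l r) = Node (a * c) (scale_wsum a l) (scale_wsum a r)"

fun null_wsum :: "wsum \<Rightarrow> bool" where
  "null_wsum Zero = True"
| "null_wsum (Node c l r) = (c = 0 \<and> null_wsum l \<and> null_wsum r)"

fun prefix_wsum :: "bool \<Rightarrow> wsum \<Rightarrow> wsum" where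
  "prefix_wsum True t = Node 0 Zero t"
| "prefix_wsum False t = Node 0 t Zero"

fun word_wsum :: "bool list \<Rightarrow> wsum" where
  "word_wsum [] = Node 1 Zero Zero"
| "word_wsum (a # w) = prefix_wsum a (word_wsum w)"

lemma eval_add_wsum: "eval_wsum f (add_wsum s t) = eval_wsum f s + eval_wsum f t"
  by (induction s t arbitrary: f rule: add_wsum.induct) (auto simp: algebra_simps)

lemma eval_scale_wsum: "eval_wsum f (scale_wsum a t) = of_int a * eval_wsum f t"
  by (induction t arbitrary: f) (auto simp: algebra_simps)

lemma eval_null_wsum: "null_wsum t \<Longrightarrow> eval_wsum f t = 0"
  by (induction t arbitrary: f) auto

lemma eval_prefix_wsum: "eval_wsum f (prefix_wsum a t) = eval_wsum (\<lambda>w. f (a # w)) t"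
  by (cases a) auto

lemma eval_word_wsum: "eval_wsum f (word_wsum w) = f w"
  by (induction w arbitrary: f) (auto simp: eval_prefix_wsum)

lemma words_of_add: "words_of (add_wsum s t) \<subseteq> words_of s \<union> words_of t"
  by (induction s t rule: add_wsum.induct) auto

lemma words_of_prefix: "words_of (prefix_wsum a t) = Cons a ` words_of t"
  by (cases a) auto

lemma words_of_word: "words_of (word_wsum w) = {w}"
  by (induction w) (auto simp: words_of_prefix)

lemma eval_wsum_cong: "(\<And>w. w \<in> words_of t \<Longrightarrow> f w = g w) \<Longrightarrow> eval_wsum f t = eval_wsum g t"
proof (induction t arbitrary: f g)
  case (Node c l r)
  have "eval_wsum (\<lambda>w. f (False # w)) l = eval_wsum (\<lambda>w. g (False # w)) l"
    by (rule Node.IH) (use Node.prems in auto)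
  moreover have "eval_wsum (\<lambda>w. f (True # w)) r = eval_wsum (\<lambda>w. g (True # w)) r"
    by (rule Node.IH) (use Node.prems in auto)
  ultimately show ?case using Node.prems[of "[]"] by (cases "c = 0") auto
qed auto

lemma eval_wsum_mult: "eval_wsum (\<lambda>w. k * f w) t = k * eval_wsum f t"
  by (induction t arbitrary: f) (auto simp: algebra_simps)

lemma eval_wsum_sum: "eval_wsum (\<lambda>w. \<Sum>i\<in>I. f i w) t = (\<Sum>i\<in>I. eval_wsum (f i) t)"
  by (induction t arbitrary: f) (auto simp: sum.distrib sum_distrib_left)

text \<open>Additivity and compatibility with integer scalars are all that is asked of
  \<open>h\<close>, so that coefficient extraction and the Euler operator
  \<open>fps_X * fps_deriv\<close> are both covered.\<close>

lemma eval_wsum_hom: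
  assumes "h 0 = 0" "\<And>x y. h (x + y) = h x + h y" "\<And>c x. h (of_int c * x) = of_int c * h x"
  shows "h (eval_wsum f t) = eval_wsum (\<lambda>w. h (f w)) t"
  by (induction t arbitrary: f) (auto simp: assms)

lemma eval_wsum_tendsto:
  fixes f :: "bool list \<Rightarrow> nat \<Rightarrow> real"
  assumes "\<And>w. w \<in> words_of t \<Longrightarrow> f w \<longlonglongrightarrow> l w"
  shows "(\<lambda>n. eval_wsum (\<lambda>w. f w n) t) \<longlonglongrightarrow> eval_wsum l t"
  using assms
proof (induction t arbitrary: f l)
  case (Node c u v)
  have 1: "(\<lambda>n. eval_wsum (\<lambda>w. f (False # w) n) u) \<longlonglongrightarrow> eval_wsum (\<lambda>w. l (False # w)) u"
    by (rule Node.IH) (use Node.prems in auto)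
  have 2: "(\<lambda>n. eval_wsum (\<lambda>w. f (True # w) n) v) \<longlonglongrightarrow> eval_wsum (\<lambda>w. l (True # w)) v"
    by (rule Node.IH) (use Node.prems in auto)
  have 3: "(\<lambda>n. of_int c * f [] n) \<longlonglongrightarrow> of_int c * l []"
    using Node.prems[of "[]"] by (cases "c = 0") (auto intro!: tendsto_intros)
  show ?case using tendsto_add[OF tendsto_add[OF 3 1] 2] by simp
qed auto

fun shuffle :: "bool list \<Rightarrow> bool list \<Rightarrow> wsum" where
  "shuffle [] v = word_wsum v"
| "shuffle u [] = word_wsum u"
| "shuffle (a # u) (b # v) =
     add_wsum (prefix_wsum a (shuffle u (b # v))) (prefix_wsum b (shuffle (a # u) v))"

text \<open>Index 0 has no letter and acts as the empty prefix; positivity of indices is imposed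
  separately wherever such words are evaluated.\<close>

fun prefix_letter :: "nat \<Rightarrow> wsum \<Rightarrow> wsum" where
  "prefix_letter 0 t = t"
| "prefix_letter (Suc 0) t = prefix_wsum True t"
| "prefix_letter (Suc (Suc s)) t = prefix_wsum False (prefix_letter (Suc s) t)"

fun letter :: "nat \<Rightarrow> bool list" where
  "letter 0 = []"
| "letter (Suc 0) = [True]"
| "letter (Suc (Suc s)) = False # letter (Suc s)"

fun word :: "nat list \<Rightarrow> bool list" where
  "word [] = []"
| "word (s # ss) = letter s @ word ss"

text \<open>The recursion runs on indices but the result is stored in letters, because the
  certificates compare it with shuffle products, which exist only on letters.\<close>

fun stuffle :: "nat list \<Rightarrow> nat list \<Rightarrow> wsum" where
  "stuffle [] v = word_wsum (word v)"
| "stuffle u [] = word_wsum (word u)"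
| "stuffle (a # u) (b # v) =
     add_wsum (prefix_letter a (stuffle u (b # v)))
       (add_wsum (prefix_letter b (stuffle (a # u) v)) (prefix_letter (a + b) (stuffle u v)))"

lemma eval_prefix_letter: "eval_wsum f (prefix_letter s t) = eval_wsum (\<lambda>w. f (letter s @ w)) t"
  by (induction s t arbitrary: f rule: prefix_letter.induct) (auto simp: eval_prefix_wsum)

lemma words_of_prefix_letter: "words_of (prefix_letter s t) = (@) (letter s) ` words_of t"
  by (induction s t rule: prefix_letter.induct) (auto simp: words_of_prefix)

text \<open>Taylor coefficients in t of the polylogarithm attached to the word: prefixing
  \<open>False\<close> integrates against dt/t, prefixing \<open>True\<close> against dt/(1-t).
  Division by 0 makes the coefficient at 0 vanish for every nonempty word, so the nested sums
  effectively start at 1.\<close>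

fun mzv_coeff :: "bool list \<Rightarrow> nat \<Rightarrow> real" where
  "mzv_coeff [] n = (if n = 0 then 1 else 0)"
| "mzv_coeff (False # w) n = mzv_coeff w n / real n"
| "mzv_coeff (True # w) n = (\<Sum>m<n. mzv_coeff w m) / real n"

definition mzv_trunc :: "bool list \<Rightarrow> nat \<Rightarrow> real" where
  "mzv_trunc w n = (\<Sum>m<n. mzv_coeff w m)"

definition mzv :: "bool list \<Rightarrow> real" where
  "mzv w = (\<Sum>n. mzv_coeff w n)"

definition admissible :: "bool list \<Rightarrow> bool" where
  "admissible w \<longleftrightarrow> w \<noteq> [] \<and> \<not> hd w \<and> last w"

section \<open>Truncated sums and the stuffle product\<close>

lemma mzv_coeff_nonneg: "mzv_coeff w n \<ge> 0"
  by (induction w n rule: mzv_coeff.induct) (auto intro!: sum_nonneg divide_nonneg_nonneg)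

lemma mzv_coeff_0: "w \<noteq> [] \<Longrightarrow> mzv_coeff w 0 = 0"
  by (cases w; cases "hd w") auto

lemma mzv_coeff_letter:
  "s > 0 \<Longrightarrow> mzv_coeff (letter s @ w) n = mzv_trunc w n / real n ^ s"
  by (induction s rule: letter.induct) (auto simp: mzv_trunc_def field_simps)

lemma mzv_trunc_Suc: "mzv_trunc w (Suc n) = mzv_trunc w n + mzv_coeff w n"
  by (simp add: mzv_trunc_def)

lemma mzv_trunc_letter_Suc:
  "s > 0 \<Longrightarrow> mzv_trunc (letter s @ w) (Suc n) = mzv_trunc (letter s @ w) n + mzv_trunc w n / real n ^ s"
  by (simp add: mzv_trunc_Suc mzv_coeff_letter)

lemma mzv_trunc_0 [simp]: "mzv_trunc w 0 = 0"
  by (simp add: mzv_trunc_def)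

lemma mzv_trunc_Nil: "n > 0 \<Longrightarrow> mzv_trunc [] n = 1"
  by (simp add: mzv_trunc_def)

lemma mzv_trunc_1: "w \<noteq> [] \<Longrightarrow> mzv_trunc w (Suc 0) = 0"
  by (simp add: mzv_trunc_def mzv_coeff_0)

lemma letter_nonempty: "s > 0 \<Longrightarrow> letter s \<noteq> []"
  by (induction s rule: letter.induct) auto

text \<open>The stuffle rule is exact for truncated sums. Raising the bound from n to n + 1 turns
  the product AB into (A + A'/n^a)(B + B'/n^b), and the three new terms are the three branches of
  the recursion. Hence an induction on the bound inside the induction on the words.\<close>

lemma stuffle_trunc:
  assumes "0 \<notin> set u" "0 \<notin> set v" "n > 0"
  shows "eval_wsum (\<lambda>w. mzv_trunc w n) (stuffle u v) = mzv_trunc (word u) n * mzv_trunc (word v) n"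
  using assms
proof (induction u v arbitrary: n rule: stuffle.induct)
  case (3 a u b v)
  have pos: "a > 0" "b > 0" using "3.prems" by auto
  show ?case
    using \<open>n > 0\<close>
  proof (induction n rule: nat_induct_non_zero)
    case 1
    have "mzv_trunc (letter a @ word u) 1 = 0" using pos mzv_trunc_1[of "letter a @ word u"]
      by (simp add: letter_nonempty)
    moreover have "eval_wsum (\<lambda>w. mzv_trunc w 1) (stuffle (a # u) (b # v)) = 0"
      using pos mzv_trunc_1
      by (simp add: eval_add_wsum eval_prefix_letter letter_nonempty eval_wsum_mult[of 0, simplified])
    ultimately show ?case by simp
  next
    case (Suc n)
    let ?e = "\<lambda>t. eval_wsum (\<lambda>w. mzv_trunc w n) t"
    have step: "eval_wsum (\<lambda>w. mzv_trunc w (Suc n)) (prefix_letter s t) =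
        eval_wsum (\<lambda>w. mzv_trunc w n) (prefix_letter s t) + ?e t / real n ^ s" if "s > 0" for s t
    proof -
      have "eval_wsum (\<lambda>w. mzv_trunc w (Suc n)) (prefix_letter s t) =
          eval_wsum (\<lambda>w. \<Sum>i\<in>{0,1::nat}. if i = 0 then mzv_trunc (letter s @ w) n
             else inverse (real n ^ s) * mzv_trunc w n) t"
        unfolding eval_prefix_letter
        by (rule eval_wsum_cong) (simp add: mzv_trunc_letter_Suc that divide_inverse)
      also have "\<dots> = eval_wsum (\<lambda>w. mzv_trunc w n) (prefix_letter s t) + ?e t / real n ^ s"
        unfolding eval_wsum_sum by (simp add: eval_wsum_mult eval_prefix_letter divide_inverse)
      finally show ?thesis .
    qed
    have IH: "?e (stuffle (a # u) (b # v)) = mzv_trunc (word (a # u)) n * mzv_trunc (word (b # v)) n"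
      using Suc.IH .
    have IH1: "?e (stuffle u (b # v)) = mzv_trunc (word u) n * mzv_trunc (word (b # v)) n"
      and IH2: "?e (stuffle (a # u) v) = mzv_trunc (word (a # u)) n * mzv_trunc (word v) n"
      and IH3: "?e (stuffle u v) = mzv_trunc (word u) n * mzv_trunc (word v) n"
      using "3.IH" "3.prems" Suc.hyps by auto
    have "eval_wsum (\<lambda>w. mzv_trunc w (Suc n)) (stuffle (a # u) (b # v)) =
        ?e (stuffle (a # u) (b # v)) + ?e (stuffle u (b # v)) / real n ^ a
        + ?e (stuffle (a # u) v) / real n ^ b + ?e (stuffle u v) / real n ^ (a + b)"
      using pos by (simp add: eval_add_wsum step)
    also have "\<dots> = mzv_trunc (word (a # u)) (Suc n) * mzv_trunc (word (b # v)) (Suc n)"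
      unfolding IH IH1 IH2 IH3 using pos
      by (simp add: mzv_trunc_letter_Suc power_add algebra_simps)
    finally show ?case .
  qed
qed (auto simp: eval_word_wsum mzv_trunc_Nil)


section \<open>Growth of truncated sums and convergence\<close>

lemma sum_inverse_sqrt_le: "(\<Sum>m<n. 1 / sqrt (real m)) \<le> 3 * sqrt (real n)"
proof (induction n)
  case (Suc n)
  have "1 / sqrt (real n) \<le> 3 * (sqrt (real (Suc n)) - sqrt (real n))"
  proof (cases "n = 0")
    case False
    let ?a = "sqrt (real n)" and ?b = "sqrt (real (Suc n))"
    have "?a > 0" "?b > 0" using False by auto
    have "?b \<le> sqrt (4 * real n)" using False by (intro real_sqrt_le_mono) auto
    hence b: "?b \<le> 2 * ?a" by (simp add: real_sqrt_mult)
    have "1 = (?b - ?a) * (?b + ?a)" by (simp add: algebra_simps)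
    also have "\<dots> \<le> (?b - ?a) * (3 * ?a)" using b by (intro mult_left_mono) auto
    finally show ?thesis using \<open>?a > 0\<close> by (simp add: field_simps)
  qed auto
  with Suc.IH show ?case by simp
qed auto

text \<open>The true growth is a power of log n; sqrt n is a convenient majorant because it
  reproduces itself under the summation of sqrt(m)/m, so one shape of bound survives every
  letter.\<close>

lemma mzv_trunc_bound: "\<exists>C\<ge>0. \<forall>n. mzv_trunc w n \<le> C * sqrt (real n)"
proof (induction w)
  case Nil
  have "mzv_trunc [] n \<le> 1 * sqrt (real n)" for n
    by (cases "n = 0") (auto simp: mzv_trunc_Nil)
  thus ?case by (intro exI[of _ 1]) simp
next
  case (Cons a w)
  then obtain C where C: "C \<ge> 0" "\<And>n. mzv_trunc w n \<le> C * sqrt (real n)" by blast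
  show ?case
  proof (cases a)
    case True
    have "mzv_trunc (True # w) n \<le> (3 * C) * sqrt (real n)" for n
    proof -
      have "mzv_trunc (True # w) n = (\<Sum>m<n. mzv_trunc w m / real m)"
        by (simp add: mzv_trunc_def)
      also have "\<dots> \<le> (\<Sum>m<n. C * (1 / sqrt (real m)))"
      proof (rule sum_mono)
        fix m
        have "mzv_trunc w m / real m \<le> C * sqrt (real m) / real m"
          using C(2)[of m] by (rule divide_right_mono) auto
        also have "sqrt (real m) / real m = 1 / sqrt (real m)"
          by (cases "m = 0") (auto simp: field_simps)
        hence "C * sqrt (real m) / real m = C * (1 / sqrt (real m))" by (metis times_divide_eq_right)
        finally show "mzv_trunc w m / real m \<le> C * (1 / sqrt (real m))" .
      qed
      also have "\<dots> = C * (\<Sum>m<n. 1 / sqrt (real m))" by (simp add: sum_distrib_left)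
      also have "\<dots> \<le> C * (3 * sqrt (real n))"
        using sum_inverse_sqrt_le C(1) by (intro mult_left_mono)
      finally show ?thesis by simp
    qed
    thus ?thesis using C(1) True by (intro exI[of _ "3 * C"]) auto
  next
    case False
    have "mzv_trunc (False # w) n \<le> C * sqrt (real n)" for n
    proof -
      have "mzv_trunc (False # w) n \<le> mzv_trunc w n"
        unfolding mzv_trunc_def
      proof (rule sum_mono)
        fix m
        show "mzv_coeff (False # w) m \<le> mzv_coeff w m"
          using mzv_coeff_nonneg[of w m] mult_right_mono[of 1 "real m" "mzv_coeff w m"]
          by (cases "m = 0") (auto simp: field_simps)
      qed
      thus ?thesis using C(2)[of n] by linarith
    qed
    thus ?thesis using C(1) False by auto
  qed
qed

lemma ends_in_letter: "w \<noteq> [] \<Longrightarrow> last w \<Longrightarrow> \<exists>s w'. s > 0 \<and> w = letter s @ w'"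
proof (induction w)
  case (Cons a w)
  show ?case
  proof (cases a)
    case True
    thus ?thesis by (intro exI[of _ "Suc 0"]) auto
  next
    case False
    with Cons obtain s w' where "s > 0" "w = letter s @ w'" by (auto split: if_splits)
    then obtain s0 where "s = Suc s0" "w = letter s @ w'" by (cases s) auto
    thus ?thesis using False by (intro exI[of _ "Suc s"] exI[of _ w']) auto
  qed
qed auto

lemma admissible_letter:
  assumes "admissible w"
  shows "\<exists>s w'. s \<ge> 2 \<and> w = letter s @ w'"
proof -
  obtain s w' where "s > 0" "w = letter s @ w'"
    using assms ends_in_letter unfolding admissible_def by blast
  moreover have "s \<noteq> 1" using assms calculation by (auto simp: admissible_def)
  ultimately show ?thesis by (intro exI[of _ s] exI[of _ w']) auto
qed

text \<open>An admissible word starts with an index of at least 2, so the coefficient is at most a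
  multiple of sqrt(n)/n^2.\<close>

lemma mzv_coeff_bound:
  assumes "admissible w"
  shows "\<exists>C\<ge>0. \<forall>n. mzv_coeff w n \<le> C * real n powr (- (3/2))"
proof -
  obtain s w' where s: "s \<ge> 2" "w = letter s @ w'" using admissible_letter[OF assms] by blast
  obtain C where C: "C \<ge> 0" "\<And>n. mzv_trunc w' n \<le> C * sqrt (real n)"
    using mzv_trunc_bound by blast
  have "mzv_coeff w n \<le> C * real n powr (- (3/2))" for n
  proof (cases "n = 0")
    case True
    thus ?thesis using assms by (auto simp: mzv_coeff_0 admissible_def)
  next
    case False
    have "mzv_coeff w n = mzv_trunc w' n / real n ^ s" using s by (simp add: mzv_coeff_letter)
    also have "\<dots> \<le> C * sqrt (real n) / real n ^ s" using C(2) by (intro divide_right_mono) auto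
    also have "\<dots> \<le> C * sqrt (real n) / real n ^ 2"
      using s False C(1) by (intro divide_left_mono power_increasing mult_nonneg_nonneg mult_pos_pos) auto
    also have "\<dots> = C * (real n powr (1/2) / real n powr 2)"
      using False by (simp add: powr_half_sqrt)
    also have "real n powr (1/2) / real n powr 2 = real n powr (- (3/2))"
      using powr_diff[of "real n" "1/2" 2] by simp
    finally show ?thesis .
  qed
  thus ?thesis using C(1) by blast
qed

lemma summable_mzv_coeff: "admissible w \<Longrightarrow> summable (mzv_coeff w)"
proof -
  assume "admissible w"
  then obtain C where C: "C \<ge> 0" "\<And>n. mzv_coeff w n \<le> C * real n powr (- (3/2))"
    using mzv_coeff_bound by blast
  show ?thesis
    by (rule summable_comparison_test'[of "\<lambda>n. C * real n powr (- (3/2))" 0])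
      (auto simp: summable_real_powr_iff mzv_coeff_nonneg C)
qed

lemma mzv_trunc_tendsto: "admissible w \<Longrightarrow> mzv_trunc w \<longlonglongrightarrow> mzv w"
  using summable_LIMSEQ[OF summable_mzv_coeff] by (simp add: mzv_trunc_def[abs_def] mzv_def)

section \<open>Generating series and the shuffle product\<close>

definition mzv_fps :: "bool list \<Rightarrow> real fps" where
  "mzv_fps w = Abs_fps (mzv_coeff w)"

text \<open>The two differential forms multiplied by t/dt, namely t/(1-t) and 1, so that they pair
  with the Euler operator \<open>fps_X * fps_deriv\<close> instead of the plain derivative.\<close>

definition kernel_fps :: "bool \<Rightarrow> real fps" where
  "kernel_fps a = (if a then fps_X * Abs_fps (\<lambda>_. 1) else 1)"

lemma mzv_fps_Nil: "mzv_fps [] = 1"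
  by (rule fps_ext) (simp add: mzv_fps_def)

text \<open>The excluded word is the single letter \<open>False\<close>: the primitive of dt/t is a
  logarithm and has no power series at 0.\<close>

lemma mzv_fps_deriv:
  assumes "a \<or> w \<noteq> []"
  shows "fps_X * fps_deriv (mzv_fps (a # w)) = kernel_fps a * mzv_fps w"
proof (rule fps_ext)
  fix n
  show "(fps_X * fps_deriv (mzv_fps (a # w))) $ n = (kernel_fps a * mzv_fps w) $ n"
  proof (cases n)
    case 0
    thus ?thesis using assms by (cases a) (auto simp: kernel_fps_def mzv_fps_def mzv_coeff_0)
  next
    case (Suc m)
    show ?thesis
    proof (cases a)
      case True
      have "(\<Sum>i = 0..m. mzv_coeff w (m - i)) = (\<Sum>i<n. mzv_coeff w i)"
        using Suc by (subst sum.atLeastAtMost_rev) (auto simp: atLeast0AtMost lessThan_Suc_atMost)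
      thus ?thesis using Suc True
        by (simp add: kernel_fps_def mzv_fps_def mult.assoc fps_mult_nth[of "Abs_fps _"])
    qed (use Suc in \<open>simp add: kernel_fps_def mzv_fps_def\<close>)
  qed
qed

lemma fps_deriv_of_int_mult: "fps_deriv (of_int c * f) = of_int c * fps_deriv (f :: real fps)"
  by (simp add: fps_deriv_mult fps_deriv_of_int)

lemma fps_nth_of_int_mult: "fps_nth (of_int c * f) n = of_int c * fps_nth (f :: real fps) n"
  unfolding fps_of_int[symmetric] by (rule fps_mult_left_const_nth)

lemma fps_nth_eval_wsum: "fps_nth (eval_wsum f t) n = eval_wsum (\<lambda>w. fps_nth (f w) n) t"
  by (rule eval_wsum_hom) (simp_all add: fps_nth_of_int_mult)

lemma words_of_shuffle_last:
  assumes "u = [] \<or> last u" "v = [] \<or> last v" "w \<in> words_of (shuffle u v)"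
  shows "length w = length u + length v \<and> (w = [] \<or> last w)"
  using assms
proof (induction u v arbitrary: w rule: shuffle.induct)
  case (3 a u b v)
  from "3.prems"(3) consider x where "w = a # x" "x \<in> words_of (shuffle u (b # v))"
    | x where "w = b # x" "x \<in> words_of (shuffle (a # u) v)"
    using words_of_add[of "prefix_wsum a (shuffle u (b # v))" "prefix_wsum b (shuffle (a # u) v)"]
    unfolding shuffle.simps words_of_prefix by blast
  thus ?case
  proof cases
    case 1
    thus ?thesis using "3.IH"(1)[of x] "3.prems" by (auto split: if_splits)
  next
    case 2
    thus ?thesis using "3.IH"(2)[of x] "3.prems" by (auto split: if_splits)
  qed
qed (auto simp: words_of_prefix words_of_word)

text \<open>The shuffle recursion is the Leibniz rule for the Euler operator. Both sides have the
  same image under it by induction, and both constant terms vanish because all words involved are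
  nonempty, so the two formal series coincide.\<close>

lemma shuffle_fps:
  assumes "u = [] \<or> last u" "v = [] \<or> last v"
  shows "eval_wsum mzv_fps (shuffle u v) = mzv_fps u * mzv_fps v"
  using assms
proof (induction u v rule: shuffle.induct)
  case (3 a u b v)
  let ?D = "\<lambda>f::real fps. fps_X * fps_deriv f"
  have theta: "?D (eval_wsum mzv_fps (prefix_wsum c (shuffle x y))) =
      kernel_fps c * eval_wsum mzv_fps (shuffle x y)"
    if "x = [] \<or> last x" "y = [] \<or> last y" "x \<noteq> [] \<or> y \<noteq> []" for c x y
  proof -
    have "?D (eval_wsum mzv_fps (prefix_wsum c (shuffle x y))) =
        eval_wsum (\<lambda>w. ?D (mzv_fps (c # w))) (shuffle x y)"
      unfolding eval_prefix_wsum
      by (rule eval_wsum_hom) (simp_all add: ring_distribs mult.left_commute fps_deriv_of_int_mult)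
    also have "\<dots> = eval_wsum (\<lambda>w. kernel_fps c * mzv_fps w) (shuffle x y)"
    proof (rule eval_wsum_cong)
      fix w assume "w \<in> words_of (shuffle x y)"
      with that have "w \<noteq> []" using words_of_shuffle_last[of x y w] by auto
      thus "?D (mzv_fps (c # w)) = kernel_fps c * mzv_fps w" by (intro mzv_fps_deriv) auto
    qed
    finally show ?thesis by (simp add: eval_wsum_mult)
  qed
  let ?E = "eval_wsum mzv_fps (shuffle (a # u) (b # v))"
  have IH1: "eval_wsum mzv_fps (shuffle u (b # v)) = mzv_fps u * mzv_fps (b # v)"
    using "3.IH"(1) "3.prems" by (auto split: if_splits)
  have IH2: "eval_wsum mzv_fps (shuffle (a # u) v) = mzv_fps (a # u) * mzv_fps v"
    using "3.IH"(2) "3.prems" by (auto split: if_splits)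
  have da: "?D (mzv_fps (a # u)) = kernel_fps a * mzv_fps u"
    using "3.prems" by (intro mzv_fps_deriv) (auto split: if_splits)
  have db: "?D (mzv_fps (b # v)) = kernel_fps b * mzv_fps v"
    using "3.prems" by (intro mzv_fps_deriv) (auto split: if_splits)
  have "?D ?E = kernel_fps a * mzv_fps u * mzv_fps (b # v) + kernel_fps b * mzv_fps (a # u) * mzv_fps v"
  proof -
    have "?D (eval_wsum mzv_fps (prefix_wsum a (shuffle u (b # v)))) =
        kernel_fps a * (mzv_fps u * mzv_fps (b # v))"
      unfolding IH1[symmetric] using "3.prems" by (intro theta) (auto split: if_splits)
    moreover have "?D (eval_wsum mzv_fps (prefix_wsum b (shuffle (a # u) v))) =
        kernel_fps b * (mzv_fps (a # u) * mzv_fps v)"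
      unfolding IH2[symmetric] using "3.prems" by (intro theta) (auto split: if_splits)
    moreover have "?D ?E = ?D (eval_wsum mzv_fps (prefix_wsum a (shuffle u (b # v))))
        + ?D (eval_wsum mzv_fps (prefix_wsum b (shuffle (a # u) v)))"
      by (simp add: eval_add_wsum ring_distribs)
    ultimately show ?thesis by (simp only: mult.assoc)
  qed
  also have "\<dots> = ?D (mzv_fps (a # u)) * mzv_fps (b # v) + mzv_fps (a # u) * ?D (mzv_fps (b # v))"
    unfolding da db by (simp add: algebra_simps)
  also have "\<dots> = ?D (mzv_fps (a # u) * mzv_fps (b # v))"
    by (simp add: algebra_simps)
  finally have D: "fps_deriv ?E = fps_deriv (mzv_fps (a # u) * mzv_fps (b # v))"
    by (simp only: mult_cancel_left fps_X_neq_zero simp_thms)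
  have "?E $ 0 = eval_wsum (\<lambda>w. mzv_coeff w 0) (shuffle (a # u) (b # v))"
    by (simp add: fps_nth_eval_wsum mzv_fps_def)
  also have "\<dots> = eval_wsum (\<lambda>w. 0 * 0) (shuffle (a # u) (b # v))"
  proof (rule eval_wsum_cong)
    fix w assume "w \<in> words_of (shuffle (a # u) (b # v))"
    hence "length w = length (a # u) + length (b # v)" using words_of_shuffle_last[OF "3.prems"] by blast
    hence "w \<noteq> []" by auto
    thus "mzv_coeff w 0 = 0 * 0" by (simp add: mzv_coeff_0)
  qed
  also have "\<dots> = 0" by (subst eval_wsum_mult) simp
  also have "\<dots> = (mzv_fps (a # u) * mzv_fps (b # v)) $ 0"
    by (simp add: mzv_fps_def mzv_coeff_0 fps_mult_nth)
  finally have "?E $ 0 - (mzv_fps (a # u) * mzv_fps (b # v)) $ 0 = 0" by (simp only: diff_self)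
  thus ?case using D unfolding fps_deriv_eq_iff by (simp del: shuffle.simps)
qed (auto simp: eval_word_wsum eval_prefix_wsum mzv_fps_Nil)

section \<open>The certificates\<close>

definition index_ok :: "nat list \<Rightarrow> bool" where
  "index_ok u \<longleftrightarrow> u \<noteq> [] \<and> hd u \<ge> 2 \<and> list_all (\<lambda>s. s > 0) u"

text \<open>Taylor coefficients of \<open>(1-3y)(1+y)\<^sup>2/((1+3y)(1-y)\<^sup>2)\<close> and of \<open>1/((1+3y)(1-y)\<^sup>2)\<close>.\<close>

definition qcoeff :: "nat \<Rightarrow> int" where
  "qcoeff n = (if n = 0 then 1 else ((-3) ^ n + 3 - 4 * int n) div 2)"

definition q0coeff :: "nat \<Rightarrow> int" where
  "q0coeff n = (9 * (-3) ^ n + 7 + 4 * int n) div 16"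

fun wsum_list :: "wsum list \<Rightarrow> wsum" where
  "wsum_list [] = Zero"
| "wsum_list (t # ts) = add_wsum t (wsum_list ts)"

text \<open>Words for the coefficient of z^n in the product of Q(z/m) over m below a bound, where Q
  has the coefficients \<open>qcoeff\<close>. The largest m contributing a nonconstant term supplies
  \<open>qcoeff (Suc i)\<close> / m^(i+1); the smaller m share the remaining degree. Leaving the
  bound open makes this a formal sum of words.\<close>

function prod_wsum :: "nat \<Rightarrow> wsum" where
  "prod_wsum n = (if n = 0 then Node 1 Zero Zero else
     wsum_list (map (\<lambda>i. scale_wsum (qcoeff (Suc i)) (prefix_letter (Suc i) (prod_wsum (n - Suc i)))) [0..<n]))"
  by auto
termination by (relation "Wellfounded.measure id") auto

declare prod_wsum.simps [simp del]

text \<open>The outermost index k carries 1/k^2 times the factor with coefficients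
  \<open>q0coeff\<close>, hence the letter \<open>i + 2\<close>; the product over m < k supplies the
  remaining degree.\<close>

definition D_wsum :: "nat \<Rightarrow> wsum" where
  "D_wsum n = wsum_list (map (\<lambda>i. scale_wsum (q0coeff i) (prefix_letter (i + 2) (prod_wsum (n - i)))) [0..<Suc n])"

type_synonym cert = "(int \<times> nat list \<times> nat list) list"

text \<open>In a list of products the index \<open>[]\<close> stands for the factor \<open>1\<close>; in a list of relations each entry
  contributes the difference of shuffle and stuffle product, where \<open>[1]\<close> is allowed as the first
  factor by Hoffman's relation.\<close>

definition prods_wsum :: "cert \<Rightarrow> wsum" where
  "prods_wsum l = wsum_list (map (\<lambda>(c, u, v). scale_wsum c (stuffle u v)) l)"

definition rels_wsum :: "cert \<Rightarrow> wsum" where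
  "rels_wsum l = wsum_list (map (\<lambda>(c, u, v). scale_wsum c
     (add_wsum (shuffle (word u) (word v)) (scale_wsum (-1) (stuffle u v)))) l)"

definition prods_ok :: "cert \<Rightarrow> bool" where
  "prods_ok l \<longleftrightarrow> list_all (\<lambda>(c, u, v). (u = [] \<or> index_ok u) \<and> index_ok v) l"

definition rels_ok :: "cert \<Rightarrow> bool" where
  "rels_ok l \<longleftrightarrow> list_all (\<lambda>(c, u, v). (u = [1] \<or> index_ok u) \<and> index_ok v) l"

text \<open>The target and the products add up to zero modulo relations, so the products carry the
  opposite sign of the evaluation that they certify. The test is cancellation of formal sums of
  words, before any numerical value is assigned.\<close>

definition cert_ok :: "wsum \<Rightarrow> cert \<Rightarrow> cert \<Rightarrow> bool" where
  "cert_ok t p r \<longleftrightarrow> prods_ok p \<and> rels_ok r \<and>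
     null_wsum (add_wsum t (add_wsum (prods_wsum p) (rels_wsum r)))"

section \<open>Soundness of the certificates\<close>

lemma letter_ge2: "s \<ge> 2 \<Longrightarrow> \<exists>w. letter s = False # w"
  by (cases s rule: letter.cases) auto

lemma last_letter: "s > 0 \<Longrightarrow> last (letter s)"
  by (induction s rule: letter.induct) (auto simp: letter_nonempty)

lemma last_letter_append: "s > 0 \<Longrightarrow> w = [] \<or> last w \<Longrightarrow> last (letter s @ w)"
  by (auto simp: last_letter letter_nonempty last_append)

lemma last_word: "0 \<notin> set u \<Longrightarrow> word u = [] \<or> last (word u)"
  by (induction u) (auto intro: last_letter_append)

lemma admissible_letter_append: "s \<ge> 2 \<Longrightarrow> w = [] \<or> last w \<Longrightarrow> admissible (letter s @ w)"
  using letter_ge2[of s] last_letter_append[of s w] by (auto simp: admissible_def)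

lemma index_ok_cases:
  assumes "index_ok u"
  obtains s ss where "u = s # ss" "s \<ge> 2" "0 \<notin> set u"
  using assms by (cases u) (auto simp: index_ok_def list_all_iff)

lemma admissible_word: "index_ok u \<Longrightarrow> admissible (word u)"
  by (erule index_ok_cases) (auto intro!: admissible_letter_append last_word)

lemma words_of_stuffle_last:
  assumes "0 \<notin> set u" "0 \<notin> set v" "w \<in> words_of (stuffle u v)"
  shows "w = [] \<or> last w"
  using assms
proof (induction u v arbitrary: w rule: stuffle.induct)
  case (3 a u b v)
  from "3.prems"(3) have "w \<in> words_of (prefix_letter a (stuffle u (b # v))) \<union>
      (words_of (prefix_letter b (stuffle (a # u) v)) \<union> words_of (prefix_letter (a + b) (stuffle u v)))"
    unfolding stuffle.simps using words_of_add by blast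
  then consider x where "w = letter a @ x" "x \<in> words_of (stuffle u (b # v))"
    | x where "w = letter b @ x" "x \<in> words_of (stuffle (a # u) v)"
    | x where "w = letter (a + b) @ x" "x \<in> words_of (stuffle u v)"
    unfolding words_of_prefix_letter by blast
  thus ?case
  proof cases
    case 1
    hence "x = [] \<or> last x" using "3.IH"(1) "3.prems" by auto
    thus ?thesis unfolding 1(1)
      by (intro disjI2) (rule last_letter_append, use "3.prems" in auto)
  next
    case 2
    hence "x = [] \<or> last x" using "3.IH"(2) "3.prems" by auto
    thus ?thesis unfolding 2(1)
      by (intro disjI2) (rule last_letter_append, use "3.prems" in auto)
  next
    case 3
    hence "x = [] \<or> last x" using "3.IH"(3) "3.prems" by auto
    thus ?thesis unfolding 3(1)
      by (intro disjI2) (rule last_letter_append, use "3.prems" in auto)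
  qed
qed (use last_word in \<open>auto simp: words_of_word words_of_prefix simp del: word.simps\<close>)

lemma admissible_stuffle:
  assumes "index_ok u" "index_ok v" "w \<in> words_of (stuffle u v)"
  shows "admissible w"
proof -
  obtain a u' where u: "u = a # u'" "a \<ge> 2" "0 \<notin> set u" using assms(1) by (rule index_ok_cases)
  obtain b v' where v: "v = b # v'" "b \<ge> 2" "0 \<notin> set v" using assms(2) by (rule index_ok_cases)
  note uv = u v
  have "w \<in> words_of (prefix_letter a (stuffle u' (b # v'))) \<union>
      (words_of (prefix_letter b (stuffle (a # u') v')) \<union> words_of (prefix_letter (a + b) (stuffle u' v')))"
    using assms(3) unfolding u(1) v(1) stuffle.simps using words_of_add by blast
  then consider x where "w = letter a @ x" "x \<in> words_of (stuffle u' (b # v'))"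
    | x where "w = letter b @ x" "x \<in> words_of (stuffle (a # u') v')"
    | x where "w = letter (a + b) @ x" "x \<in> words_of (stuffle u' v')"
    unfolding words_of_prefix_letter by blast
  thus ?thesis
  proof cases
    case 1
    thus ?thesis using uv words_of_stuffle_last[of u' "b # v'" x]
      by (auto intro!: admissible_letter_append)
  next
    case 2
    thus ?thesis using uv words_of_stuffle_last[of "a # u'" v' x]
      by (auto intro!: admissible_letter_append)
  next
    case 3
    thus ?thesis using uv words_of_stuffle_last[of u' v' x]
      by (auto intro!: admissible_letter_append)
  qed
qed

lemma eval_trunc_tendsto:
  assumes "\<And>w. w \<in> words_of t \<Longrightarrow> admissible w"
  shows "(\<lambda>n. eval_wsum (\<lambda>w. mzv_trunc w n) t) \<longlonglongrightarrow> eval_wsum mzv t"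
  using assms mzv_trunc_tendsto by (intro eval_wsum_tendsto) auto

lemma eval_coeff_sums:
  assumes "\<And>w. w \<in> words_of t \<Longrightarrow> admissible w"
  shows "(\<lambda>n. eval_wsum (\<lambda>w. mzv_coeff w n) t) sums eval_wsum mzv t"
  using eval_trunc_tendsto[OF assms]
  by (simp add: sums_def mzv_trunc_def eval_wsum_sum)

lemma stuffle_mzv:
  assumes "index_ok u" "index_ok v"
  shows "eval_wsum mzv (stuffle u v) = mzv (word u) * mzv (word v)"
proof (rule LIMSEQ_unique)
  show "(\<lambda>n. eval_wsum (\<lambda>w. mzv_trunc w n) (stuffle u v)) \<longlonglongrightarrow> eval_wsum mzv (stuffle u v)"
    using assms by (intro eval_trunc_tendsto admissible_stuffle)
  have "(\<lambda>n. mzv_trunc (word u) n * mzv_trunc (word v) n) \<longlonglongrightarrow> mzv (word u) * mzv (word v)"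
    by (intro tendsto_mult mzv_trunc_tendsto admissible_word assms)
  moreover have "\<forall>\<^sub>F n in sequentially. mzv_trunc (word u) n * mzv_trunc (word v) n =
      eval_wsum (\<lambda>w. mzv_trunc w n) (stuffle u v)"
    using eventually_gt_at_top[of 0]
  proof eventually_elim
    case (elim n)
    have "0 \<notin> set u" "0 \<notin> set v" using assms by (auto simp: index_ok_def list_all_iff)
    thus ?case using elim by (simp add: stuffle_trunc)
  qed
  ultimately show "(\<lambda>n. eval_wsum (\<lambda>w. mzv_trunc w n) (stuffle u v)) \<longlonglongrightarrow> mzv (word u) * mzv (word v)"
    by (rule Lim_transform_eventually)
qed

lemma admissible_shuffle:
  assumes "admissible u" "admissible v" "w \<in> words_of (shuffle u v)"
  shows "admissible w"
proof -
  obtain u' v' where uv: "u = False # u'" "v = False # v'"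
    using assms by (cases u; cases v) (auto simp: admissible_def)
  have "w \<in> words_of (prefix_wsum False (shuffle u' v)) \<union> words_of (prefix_wsum False (shuffle u v'))"
    using assms(3) unfolding uv shuffle.simps using words_of_add by blast
  hence "w \<noteq> []" "\<not> hd w" unfolding words_of_prefix by auto
  moreover have "w = [] \<or> last w"
    using words_of_shuffle_last[OF _ _ assms(3)] assms by (auto simp: admissible_def)
  ultimately show ?thesis by (auto simp: admissible_def)
qed

lemma mzv_fps_nth: "fps_nth (mzv_fps w) n = mzv_coeff w n"
  by (simp add: mzv_fps_def)

lemma eval_coeff_shuffle:
  assumes "u = [] \<or> last u" "v = [] \<or> last v"
  shows "eval_wsum (\<lambda>w. mzv_coeff w n) (shuffle u v) = (\<Sum>i\<le>n. mzv_coeff u i * mzv_coeff v (n - i))"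
  using fps_nth_eval_wsum[of mzv_fps "shuffle u v" n]
  unfolding shuffle_fps[OF assms] fps_mult_nth mzv_fps_nth atLeast0AtMost by (rule sym)

text \<open>The power series identity is evaluated at t = 1: coefficientwise it is a Cauchy product,
  and nonnegative summable coefficients converge absolutely.\<close>

lemma shuffle_mzv:
  assumes "admissible u" "admissible v"
  shows "eval_wsum mzv (shuffle u v) = mzv u * mzv v"
proof (rule sums_unique2)
  show "(\<lambda>n. eval_wsum (\<lambda>w. mzv_coeff w n) (shuffle u v)) sums eval_wsum mzv (shuffle u v)"
    by (rule eval_coeff_sums) (rule admissible_shuffle[OF assms])
  have abs: "norm (mzv_coeff w n) = mzv_coeff w n" for w n
    using mzv_coeff_nonneg[of w n] by simp
  have ends: "u = [] \<or> last u" "v = [] \<or> last v"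
    using assms by (simp_all add: admissible_def)
  show "(\<lambda>n. eval_wsum (\<lambda>w. mzv_coeff w n) (shuffle u v)) sums (mzv u * mzv v)"
    unfolding mzv_def eval_coeff_shuffle[OF ends]
    by (rule Cauchy_product_sums; unfold abs; rule summable_mzv_coeff; fact assms)
qed

section \<open>Hoffman's relation\<close>

lemma harm_trunc: "mzv_trunc [True] n = (\<Sum>j<n. 1 / real j)"
  unfolding mzv_trunc_def
proof (rule sum.cong)
  fix j
  show "mzv_coeff [True] j = 1 / real j" by (cases j) auto
qed auto

lemma harm_trunc_diff:
  assumes "i < n"
  shows "mzv_trunc [True] n - mzv_trunc [True] (n - i) = (\<Sum>l<i. 1 / real (n - i + l))"
proof -
  have "{..<n} = {..<n - i} \<union> {n - i..<n}" using assms by auto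
  hence "mzv_trunc [True] n - mzv_trunc [True] (n - i) = (\<Sum>j=n-i..<n. 1 / real j)"
    unfolding harm_trunc by (simp add: sum.union_disjoint ivl_disj_int)
  also have "\<dots> = (\<Sum>l<i. 1 / real (n - i + l))"
    using assms by (intro sum.reindex_bij_witness[of _ "\<lambda>l. n - i + l" "\<lambda>j. j - (n - i)"]) auto
  finally show ?thesis .
qed

text \<open>Both regularisations of the divergent product \<open>\<zeta>(1) \<zeta>(w)\<close> converge to
  \<open>\<Sum>n. mzv_coeff w n * (\<Sum>j\<le>n. 1 / j)\<close>.\<close>

lemma hoffman_relation:
  assumes "index_ok v"
  shows "eval_wsum mzv (shuffle [True] (word v)) = eval_wsum mzv (stuffle [1] v)"
proof -
  obtain s ss where v: "v = s # ss" "s \<ge> 2" "0 \<notin> set v" using assms by (rule index_ok_cases)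
  obtain l where l: "letter s = False # l" using letter_ge2 v by blast
  define w where "w = word v"
  have w: "w = False # (l @ word ss)" using v l by (simp add: w_def)
  have adm: "admissible w" unfolding w_def by (rule admissible_word[OF assms])
  define w' where "w' = l @ word ss"
  define a where "a = mzv_coeff w"
  define H where "H = mzv_trunc [True]"
  have last_w': "w' = [] \<or> last w'"
    using adm w by (auto simp: admissible_def w'_def split: if_splits)
  \<comment> \<open>The divergent word \<open>True # w\<close> occurs exactly once in each of the
    two products; \<open>sh\<close> and \<open>st\<close> are the convergent remainders to be
    compared.\<close>
  define sh where "sh = prefix_wsum False (shuffle [True] w')"
  define st where "st = add_wsum (prefix_letter s (stuffle [1] ss)) (prefix_letter (1 + s) (stuffle [] ss))"
  have sh: "eval_wsum f (shuffle [True] w) = f (True # w) + eval_wsum f sh" for f :: "bool list \<Rightarrow> real"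
    by (simp add: w w'_def[symmetric] sh_def eval_add_wsum eval_word_wsum)
  have st: "eval_wsum f (stuffle [1] v) = f (True # w) + eval_wsum f st" for f :: "bool list \<Rightarrow> real"
    by (simp add: v st_def w_def eval_add_wsum eval_word_wsum eval_prefix_wsum)

  have adm_sh: "admissible x" if x_in: "x \<in> words_of sh" for x
  proof -
    obtain y where y: "x = False # y" "y \<in> words_of (shuffle [True] w')"
      using x_in unfolding sh_def words_of_prefix by auto
    have "length y = length [True] + length w' \<and> (y = [] \<or> last y)"
      by (rule words_of_shuffle_last[OF _ last_w' y(2)]) auto
    thus ?thesis using y by (auto simp: admissible_def)
  qed
  have adm_st: "admissible x" if "x \<in> words_of st" for x
  proof -
    have "x \<in> words_of (prefix_letter s (stuffle [1] ss)) \<union> words_of (prefix_letter (1 + s) (stuffle [] ss))"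
      using that unfolding st_def using words_of_add by blast
    thus ?thesis
      using v words_of_stuffle_last[of "[1]" ss] words_of_stuffle_last[of "[]" ss]
      unfolding words_of_prefix_letter by (auto intro!: admissible_letter_append)
  qed

  have H_Suc: "H (Suc n) = H n + 1 / real n" for n
    by (simp add: H_def harm_trunc)
  \<comment> \<open>Summation by parts; the index \<open>Suc n\<close> in \<open>H\<close> records
    that the harmonic sum includes 1/n itself.\<close>
  have part: "H N * mzv_trunc w N - mzv_trunc (True # w) N = (\<Sum>n<N. a n * H (Suc n))" for N
  proof (induction N)
    case (Suc N)
    have "mzv_coeff (True # w) N = mzv_trunc w N / real N" by (simp add: mzv_trunc_def)
    thus ?case using Suc
      by (simp add: mzv_trunc_Suc H_Suc a_def algebra_simps del: mzv_coeff.simps)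
  qed auto
  have "(\<lambda>N. eval_wsum (\<lambda>x. mzv_trunc x N) st) \<longlonglongrightarrow> eval_wsum mzv st"
    using adm_st by (rule eval_trunc_tendsto)
  moreover have "\<forall>\<^sub>F N in sequentially. eval_wsum (\<lambda>x. mzv_trunc x N) st = (\<Sum>n<N. a n * H (Suc n))"
    using eventually_gt_at_top[of 0]
  proof eventually_elim
    case (elim N)
    have "eval_wsum (\<lambda>x. mzv_trunc x N) (stuffle [1] v) = H N * mzv_trunc w N"
      using v elim by (subst stuffle_trunc) (auto simp: H_def w_def)
    thus ?case using st[of "\<lambda>x. mzv_trunc x N"] part[of N] by simp
  qed
  ultimately have aH: "(\<lambda>n. a n * H (Suc n)) sums eval_wsum mzv st"
    unfolding sums_def by (rule Lim_transform_eventually)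

  \<comment> \<open>The partial sums of the two regularisations differ by a triangular correction,
    the sum of these terms over i < N. Extending by 0 makes it a series over all i, to which
    Tannery's theorem applies.\<close>
  define f where "f = (\<lambda>i N. if i < N then a i * (H N - H (N - i)) else 0)"
  have H_diff: "0 \<le> H N - H (N - i)" "H N - H (N - i) \<le> real i * (1 / real (N - i))"
    "H N - H (N - i) \<le> H (Suc i)" if iN: "i < N" for i N
  proof -
    have eq: "H N - H (N - i) = (\<Sum>l<i. 1 / real (N - i + l))"
      unfolding H_def by (rule harm_trunc_diff[OF iN])
    show "0 \<le> H N - H (N - i)" unfolding eq by (intro sum_nonneg divide_nonneg_nonneg) (auto simp del: of_nat_add)
    have "(\<Sum>l<i. 1 / real (N - i + l)) \<le> (\<Sum>l<i. 1 / real (N - i))"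
      using iN by (intro sum_mono frac_le) auto
    thus "H N - H (N - i) \<le> real i * (1 / real (N - i))" unfolding eq by simp
    have "(\<Sum>l<i. 1 / real (N - i + l)) \<le> (\<Sum>l<i. 1 / real (Suc l))"
      using iN by (intro sum_mono frac_le) (auto simp del: of_nat_add of_nat_Suc)
    also have "\<dots> = H (Suc i)" unfolding H_def harm_trunc by (subst sum.lessThan_Suc_shift) simp
    finally show "H N - H (N - i) \<le> H (Suc i)" unfolding eq .
  qed
  have a_nonneg: "a i \<ge> 0" for i unfolding a_def by (rule mzv_coeff_nonneg)
  have f_nonneg: "0 \<le> f i N" for i N
    using H_diff(1)[of i N] a_nonneg[of i] by (simp add: f_def)
  have f_lim: "(\<lambda>N. f i N) \<longlonglongrightarrow> 0" for i
  proof (rule tendsto_sandwich)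
    show "\<forall>\<^sub>F N in sequentially. 0 \<le> f i N" using f_nonneg by simp
    show "\<forall>\<^sub>F N in sequentially. f i N \<le> a i * (real i * (1 / real (N - i)))"
      using eventually_gt_at_top[of i]
    proof eventually_elim
      case (elim N)
      thus ?case using mult_left_mono[OF H_diff(2)[OF elim] a_nonneg[of i]] by (simp only: f_def if_True)
    qed
    have "(\<lambda>N. 1 / real (N - i)) \<longlonglongrightarrow> 0"
      by (rule LIMSEQ_offset[of _ i]) (use lim_1_over_n in simp)
    from tendsto_mult_left[OF tendsto_mult_left[OF this, of "real i"], of "a i"]
    show "(\<lambda>N. a i * (real i * (1 / real (N - i)))) \<longlonglongrightarrow> 0" by simp
  qed auto
  have f_bound: "norm (f i N) \<le> a i * H (Suc i)" for i N
  proof (cases "i < N")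
    case True
    thus ?thesis using f_nonneg[of i N] mult_left_mono[OF H_diff(3)[OF True] a_nonneg[of i]]
      by (simp only: real_norm_def abs_of_nonneg) (simp only: f_def if_True)
  next
    case False
    have "H (Suc i) \<ge> 0" unfolding H_def harm_trunc by (intro sum_nonneg) auto
    thus ?thesis using False a_nonneg[of i] by (simp add: f_def)
  qed
  \<comment> \<open>Each term tends to 0 for fixed i and is dominated by a(i) H(i+1) uniformly in N.
    The dominating series converges because it was just identified with the stuffle side.\<close>
  have "(\<lambda>N. suminf (\<lambda>i. f i N)) \<longlonglongrightarrow> suminf (\<lambda>i. 0)"
  proof -
    have "summable (\<lambda>i. a i * H (Suc i))" using aH by (simp add: sums_iff)
    thus ?thesis
      using tannerys_theorem[where a = f and b = "\<lambda>_. 0" and F = sequentially, OF f_lim _ \<open>summable _\<close>]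
        f_bound by (simp add: always_eventually)
  qed
  moreover have "suminf (\<lambda>i. f i N) = (\<Sum>i<N. a i * (H N - H (N - i)))" for N
    by (subst suminf_finite[of "{..<N}"]) (auto simp: f_def)
  ultimately have rest: "(\<lambda>N. \<Sum>i<N. a i * (H N - H (N - i))) \<longlonglongrightarrow> 0" by simp

  have c: "eval_wsum (\<lambda>x. mzv_coeff x n) sh =
      (\<Sum>i\<le>n. mzv_coeff [True] i * a (n - i)) - mzv_coeff (True # w) n" for n
    using sh[of "\<lambda>x. mzv_coeff x n"] eval_coeff_shuffle[of "[True]" w n] adm
    by (simp add: admissible_def a_def del: mzv_coeff.simps)
  have "(\<Sum>n<N. eval_wsum (\<lambda>x. mzv_coeff x n) sh) =
      (\<Sum>n<N. a n * H (Suc n)) - (\<Sum>i<N. a i * (H N - H (N - i)))" for N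
  proof -
    have "(\<Sum>n<N. eval_wsum (\<lambda>x. mzv_coeff x n) sh) =
        (\<Sum>n<N. \<Sum>i\<le>n. mzv_coeff [True] i * a (n - i)) - mzv_trunc (True # w) N"
      by (simp only: c sum_subtractf mzv_trunc_def)
    also have "(\<Sum>n<N. \<Sum>i\<le>n. mzv_coeff [True] i * a (n - i)) = (\<Sum>i<N. a i * H (N - i))"
    proof -
      have set_eq: "{(i, j). i + j < N} = Sigma {..<N} (\<lambda>i. {..<N - i})" by auto
      have "(\<Sum>n<N. \<Sum>i\<le>n. mzv_coeff [True] i * a (n - i)) =
          (\<Sum>n<N. \<Sum>i\<le>n. a i * mzv_coeff [True] (n - i))"
      proof (rule sum.cong[OF refl])
        fix n
        show "(\<Sum>i\<le>n. mzv_coeff [True] i * a (n - i)) = (\<Sum>i\<le>n. a i * mzv_coeff [True] (n - i))"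
          by (rule sum.reindex_bij_witness[of _ "\<lambda>i. n - i" "\<lambda>i. n - i"]) auto
      qed
      also have "\<dots> = (\<Sum>(i, j)\<in>{(i, j). i + j < N}. a i * mzv_coeff [True] j)"
        by (rule sum.triangle_reindex[symmetric])
      also have "\<dots> = (\<Sum>i<N. \<Sum>j<N - i. a i * mzv_coeff [True] j)"
        unfolding set_eq by (rule sum.Sigma[symmetric]) auto
      finally show ?thesis by (simp add: H_def mzv_trunc_def sum_distrib_left del: mzv_coeff.simps)
    qed
    also have "mzv_trunc (True # w) N = H N * mzv_trunc w N - (\<Sum>n<N. a n * H (Suc n))"
      using part[of N] by simp
    also have "(\<Sum>i<N. a i * H (N - i)) = H N * mzv_trunc w N - (\<Sum>i<N. a i * (H N - H (N - i)))"
      by (simp add: right_diff_distrib sum_subtractf mzv_trunc_def a_def sum_distrib_left mult.commute)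
    finally show ?thesis by simp
  qed
  moreover have "(\<lambda>N. (\<Sum>n<N. a n * H (Suc n)) - (\<Sum>i<N. a i * (H N - H (N - i))))
      \<longlonglongrightarrow> eval_wsum mzv st - 0"
    using aH rest unfolding sums_def by (intro tendsto_diff)
  ultimately have "(\<lambda>n. eval_wsum (\<lambda>x. mzv_coeff x n) sh) sums eval_wsum mzv st"
    unfolding sums_def by simp
  moreover have "(\<lambda>n. eval_wsum (\<lambda>x. mzv_coeff x n) sh) sums eval_wsum mzv sh"
    using adm_sh by (rule eval_coeff_sums)
  ultimately have "eval_wsum mzv sh = eval_wsum mzv st" by (metis sums_unique2)
  thus ?thesis using sh[of mzv] st[of mzv] by (simp add: w_def)
qed

section \<open>From a formal certificate to an identity of values\<close>

lemma eval_wsum_list: "eval_wsum f (wsum_list ts) = (\<Sum>t\<leftarrow>ts. eval_wsum f t)"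
  by (induction ts) (auto simp: eval_add_wsum)

lemma eval_prods_wsum:
  assumes "prods_ok l"
  shows "eval_wsum mzv (prods_wsum l) =
    (\<Sum>(c, u, v)\<leftarrow>l. of_int c * ((if u = [] then 1 else mzv (word u)) * mzv (word v)))"
  using assms
proof (induction l)
  case (Cons x l)
  obtain c u v where x: "x = (c, u, v)" by (cases x)
  with Cons have "(u = [] \<or> index_ok u) \<and> index_ok v" "prods_ok l" by (auto simp: prods_ok_def)
  thus ?case using Cons.IH
    by (auto simp: x prods_wsum_def eval_add_wsum eval_scale_wsum eval_word_wsum stuffle_mzv)
qed (auto simp: prods_wsum_def)

lemma eval_rels_wsum:
  assumes "rels_ok l"
  shows "eval_wsum mzv (rels_wsum l) = 0"
  using assms
proof (induction l)
  case (Cons x l)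
  obtain c u v where x: "x = (c, u, v)" by (cases x)
  with Cons have *: "u = [1] \<or> index_ok u" "index_ok v" "rels_ok l" by (auto simp: rels_ok_def)
  have "eval_wsum mzv (shuffle (word u) (word v)) = eval_wsum mzv (stuffle u v)"
    using * hoffman_relation[of v] by (auto simp: shuffle_mzv stuffle_mzv admissible_word)
  thus ?case using Cons.IH *
    by (auto simp: x rels_wsum_def eval_add_wsum eval_scale_wsum)
qed (auto simp: rels_wsum_def)

lemma cert_sound:
  assumes "cert_ok t p r"
  shows "eval_wsum mzv t +
    (\<Sum>(c, u, v)\<leftarrow>p. of_int c * ((if u = [] then 1 else mzv (word u)) * mzv (word v))) = 0"
proof -
  have ok: "prods_ok p" "rels_ok r" "null_wsum (add_wsum t (add_wsum (prods_wsum p) (rels_wsum r)))"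
    using assms by (simp_all add: cert_ok_def)
  show ?thesis
    using eval_null_wsum[OF ok(3), of mzv] unfolding eval_add_wsum eval_rels_wsum[OF ok(2)]
      eval_prods_wsum[OF ok(1)] by simp
qed

section \<open>Certificates for the Taylor coefficients\<close>

text \<open>The coefficients were found by rational linear algebra on the double shuffle relations of each weight.\<close>

lemma cert_3:
  "cert_ok (scale_wsum 1 (D_wsum 1))
    [(3, [], [3])]
    [(2, [1], [2])]"
  by code_simp

lemma cert_4:
  "cert_ok (scale_wsum 1 (D_wsum 2))
    [(- 12, [], [4])]
    [(- 4, [1], [2, 1]), (- 6, [1], [3])]"
  by code_simp

text \<open>The factor in front of \<open>D_wsum\<close> clears denominators: the relation
  coefficients of the rational solution are not integers, although the resulting combination of zeta
  values is divisible by 5.\<close>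

lemma cert_5:
  "cert_ok (scale_wsum 5 (D_wsum 3))
    [(600, [], [5]), (- 210, [2], [3])]
    [(- 52, [2], [3]), (40, [1], [2, 1, 1]), (60, [1], [2, 2]), (- 12, [1], [3, 1]), (372, [1],
    [4]), (12, [2], [2, 1])]"
  by code_simp

lemma cert_6:
  "cert_ok (scale_wsum 12 (D_wsum 4))
    [(- 2583, [], [6]), (756, [3], [3])]
    [(- 288, [1], [3, 1, 1]), (803, [3], [3]), (- 192, [1], [2, 1, 1, 1]), (384, [2, 1], [3]), (-
    974, [2], [4]), (- 592, [2], [3, 1]), (- 1092, [1], [5]), (- 348, [2], [2, 2]), (- 288, [1], [2,
    1, 2]), (1296, [1], [4, 1]), (- 720, [1], [2, 3])]"
  by code_simp

lemma cert_7:
  "cert_ok (scale_wsum 3128 (D_wsum 5))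
    [(10657878, [], [7]), (- 4372944, [2], [5]), (- 1576512, [4], [3])]
    [(37825, [3], [4]), (438146, [2], [4, 1]), (- 818947, [2], [5]), (100096, [1], [2, 1, 1, 1, 1]),
    (150144, [1], [2, 1, 1, 2]), (- 18768, [1], [2, 1, 2, 1]), (394128, [1], [2, 1, 3]), (131376,
    [1], [2, 2, 1, 1]), (- 237728, [1], [2, 2, 2]), (156400, [1], [2, 3, 1]), (525504, [1], [2, 4]),
    (- 37536, [1], [3, 1, 1, 1]), (625600, [1], [3, 1, 2]), (70720, [1], [3, 2, 1]), (457824, [1],
    [3, 3]), (643824, [1], [4, 1, 1]), (- 503328, [1], [4, 2]), (- 2725920, [1], [5, 1]), (5067264,
    [1], [6]), (- 729776, [2], [3, 1, 1]), (273670, [2], [3, 2]), (- 147152, [2], [2, 2, 1]),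
    (416920, [2], [2, 3]), (489508, [3], [3, 1]), (18768, [2], [2, 1, 1, 1]), (- 81328, [2], [2, 1,
    2]), (206728, [3], [2, 2]), (458048, [2, 1], [3, 1]), (- 861472, [2, 1], [4])]"
  by code_simp

text \<open>The index \<open>[5, 3]\<close> stays in the list of products as the one double value
  that is not expressed by single zeta values; \<open>[3, 3]\<close> is only a shorthand and is
  removed later by a stuffle product.\<close>

lemma cert_8:
  "cert_ok (scale_wsum 22441650 (D_wsum 6))
    [(- 120614144035, [], [8]), (- 39587070600, [2], [3, 3]), (- 19793535300, [2], [6]),
    (113105916000, [3], [5]), (3797127180, [], [5, 3])]
    [(66963922529, [3], [5]), (- 151364708880, [1], [4, 1, 2]), (- 9823030800, [1], [2, 1, 4]),
    (76230641520, [2], [3, 2, 1]), (- 2154398400, [1], [2, 1, 1, 1, 2]), (6411900000, [1], [3, 1, 1,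
    2]), (- 7982758080, [1], [2, 4, 1]), (- 2154398400, [1], [2, 1, 2, 1, 1]), (7694280000, [1], [2,
    1, 3, 1]), (- 145444772040, [1], [4, 3]), (- 12458570520, [1], [2, 5]), (15374013600, [1], [3,
    2, 1, 1]), (20358835200, [1], [4, 1, 1, 1]), (- 12162928800, [1], [4, 2, 1]), (72495279120, [1],
    [3, 3, 1]), (- 29393451120, [1], [3, 2, 2]), (40141071520, [2], [3, 1, 2]), (26566406437, [4],
    [4]), (- 6155424000, [1], [2, 2, 1, 2]), (- 22268690400, [1], [5, 1, 1]), (- 131826274960, [1],
    [3, 4]), (2441498400, [1], [2, 2, 3]), (159433029560, [1], [5, 2]), (85120139722, [2], [4, 2]),
    (- 7058066400, [1], [2, 2, 2, 1]), (- 2632132800, [2], [2, 2, 1, 1]), (- 87765407288, [3], [4,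
    1]), (- 173791164162, [3], [3, 2]), (102210189250, [1], [7]), (10990494240, [1], [2, 3, 2]), (-
    39619463184, [2], [5, 1]), (- 213796321751, [2], [6]), (- 2154398400, [1], [3, 1, 1, 1, 1]),
    (6433336800, [1], [2, 3, 1, 1]), (- 1644508800, [2], [3, 1, 1, 1]), (27763127040, [3, 1], [3,
    1]), (- 21430139280, [1], [3, 1, 3]), (2872531200, [1], [2, 1, 2, 2]), (571882257120, [1], [6,
    1]), (- 5385996000, [1], [2, 1, 1, 3]), (358021522320, [2], [4, 1, 1]), (- 1436265600, [1], [2,
    1, 1, 1, 1, 1]), (11771791020, [2, 2], [2, 2]), (22255992000, [1], [3, 1, 2, 1]), (- 3252268800,
    [2], [2, 1, 2, 1]), (69129815290, [2], [3, 3]), (27373720880, [2], [2, 3, 1]), (- 61865456400,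
    [3], [3, 1, 1]), (3199289280, [2], [2, 1, 3]), (10869257520, [2], [2, 2, 2]), (97781488730, [2,
    2], [4]), (- 99187652330, [3], [2, 3]), (- 65564388270, [2], [2, 4]), (- 216857351040, [2, 1],
    [4, 1]), (- 1384970400, [2], [2, 1, 1, 2]), (169790120440, [2, 1], [5]), (- 747225600, [2, 1],
    [2, 2, 1])]"
  by code_simp

lemma cert_9:
  "cert_ok (scale_wsum 70899866496154080000 (D_wsum 7))
    [(6844105912606745650560000, [], [9]), (- 2766370990946939893440000, [2], [7]), (-
    1189416160339480846080000, [4], [5]), (- 640970243058480960240000, [6], [3]),
    (125067364499215797120000, [3], [3, 3]), (62533682249607898560000, [3], [6])]
    [(- 389536121445794082763048, [4], [5]), (596574869742703335836489, [3], [6]), (-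
    209496788960993281639265, [2], [7]), (- 230710777318561107456000, [1], [2, 1, 4, 1]),
    (1413223131884088567571200, [1], [4, 1, 3]), (- 18376174584658097307322752, [1], [3, 4, 1]), (-
    542818971888650674560000, [1], [3, 1, 2, 2]), (9075182911507722240000, [1], [2, 1, 1, 1, 1, 1,
    1]), (- 7679058111732546167937408, [1], [7, 1]), (- 940527593787255189408000, [1], [3, 3, 1,
    1]), (9276716674349116892442088, [2], [6, 1]), (- 5264637828003548525167424, [3], [5, 1]),
    (4491640031090182333129152, [1], [4, 4]), (- 261760110996416713632000, [1], [2, 3, 1, 2]),
    (53685686784706135488000, [1], [2, 2, 4]), (- 676980708385698066672000, [1], [3, 2, 2, 1]),
    (48263472756654704640000, [1], [2, 1, 1, 4]), (272295501640933704192000, [1], [3, 1, 2, 1, 1]),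
    (- 639431414957679047424000, [1], [2, 4, 1, 1]), (- 1473642201984065172864000, [1], [4, 1, 2,
    1]), (- 10347502879029141887480960, [1], [6, 2]), (13612774367261583360000, [1], [2, 1, 1, 1, 1,
    2]), (- 42830827289746255872000, [1], [2, 2, 1, 2, 1]), (316941996600119826835200, [1], [3, 1,
    4]), (10690063804309656292973504, [2], [3, 3, 1]), (3228530108003113197960832, [1], [3, 5]), (-
    20625415707972096000000, [1], [2, 1, 1, 2, 2]), (175013626343569671168000, [1], [2, 1, 3, 1,
    1]), (- 48625579875115289088000, [1], [2, 1, 2, 3]), (144209345407284842496000, [1], [2, 3, 1,
    1, 1]), (- 12333646853640170962718592, [2], [5, 1, 1]), (- 1377392910451075871136000, [1], [4,
    2, 1, 1]), (262679944231569209184000, [2], [3, 2, 1, 1]), (459026728907556184704000, [2], [4, 1,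
    1, 1]), (- 3870658476060028927142400, [1], [2, 5, 1]), (12375249424783257600000, [1], [2, 1, 1,
    2, 1, 1]), (2734874231976679316590464, [1], [5, 3]), (553107348252589818345888, [2], [4, 2, 1]),
    (- 2475049884956651520000, [1], [2, 1, 2, 1, 1, 1]), (- 3712574827434977280000, [1], [3, 1, 1,
    1, 1, 1]), (10312707853986048000000, [1], [2, 1, 1, 3, 1]), (55172987018825356800000, [1], [2,
    1, 2, 1, 2]), (- 1279367990151756208704000, [1], [5, 1, 1, 1]), (- 29184963226780515840000, [1],
    [2, 2, 1, 1, 2]), (- 370992290251028641776000, [1], [2, 3, 2, 1]), (11137724482304931840000,
    [1], [2, 2, 1, 1, 1, 1]), (- 1237524942478325760000, [1], [2, 1, 1, 1, 2, 1]),
    (5263585584660650520391906, [2], [5, 2]), (- 496573736455813125312000, [1], [3, 2, 1, 2]), (-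
    765285852716706918240000, [1], [4, 1, 1, 2]), (- 336255304570727835888000, [1], [2, 2, 3, 1]),
    (- 129492125604034808832000, [1], [3, 1, 1, 3]), (126762617866911151104000, [1], [3, 2, 1, 1,
    1]), (2225275205118258667685824, [1], [8]), (- 25665163270869781836877824, [1], [5, 2, 1]),
    (5429247501574648674503808, [2], [3, 2, 2]), (14440746423243389558400, [1], [2, 3, 3]), (-
    6020353250092455016575520, [3], [4, 2]), (- 37344729594783064500983040, [1], [6, 1, 1]),
    (6415072682868980209917024, [2], [4, 1, 2]), (- 25665377629098454431423360, [1], [4, 3, 1]),
    (1063216755751638410296532, [2], [4, 3]), (452681726163029932060800, [1], [2, 6]),
    (216908776118478179836800, [1], [3, 2, 3]), (80634267794500826112000, [1], [2, 2, 1, 3]), (-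
    16694269221041720425115904, [1], [5, 1, 2]), (- 5848612094397588831793664, [1], [3, 3, 2]),
    (116269577177368059648000, [1], [2, 1, 5]), (- 709987704191559408384000, [1], [3, 1, 3, 1]),
    (150073343992632678912000, [1], [3, 1, 1, 2, 1]), (28098938639970100224000, [1], [4, 1, 1, 1,
    1]), (216669187064667983184000, [1], [2, 2, 2, 2]), (75076513177018429440000, [1], [3, 1, 1, 1,
    2]), (- 73703562843152987136000, [1], [2, 2, 2, 1, 1]), (1139696446548735707270735, [2], [3,
    4]), (- 2205889394745540194006400, [1], [2, 4, 2]), (61516464692597849088000, [1], [2, 1, 2, 2,
    1]), (- 116933699311552521216000, [1], [2, 1, 3, 2]), (- 11396034810370642198108032, [1], [4, 2,
    2]), (35269460860632284160000, [1], [2, 1, 1, 1, 3]), (- 6574185789323542007093566, [3], [3,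
    3]), (- 1310736216542024998211536, [2], [2, 5]), (163837390987976883408000, [2], [3, 1, 2, 1]),
    (- 942289675425842688000, [2], [3, 1, 1, 1, 1]), (219665488237812652896000, [2], [2, 3, 1, 1]),
    (7536784388463609924362976, [2], [2, 4, 1]), (- 544811017020723401020800, [2], [3, 1, 3]),
    (689493963046453875198036, [4], [4, 1]), (1820554267340717008045472, [2], [2, 3, 2]),
    (200462196363373661472000, [2], [2, 2, 1, 2]), (317467587461035874688000, [2], [2, 2, 2, 1]), (-
    414568838930867092382400, [2], [2, 2, 3]), (- 14913999812623969213020096, [3], [4, 1, 1]), (-
    37505166892805058048000, [2], [2, 1, 2, 1, 1]), (1237524942478325760000, [2], [2, 1, 1, 1, 1,
    1]), (87078303346219589376000, [2], [3, 1, 1, 2]), (- 2875588533405471744000, [2], [2, 2, 1, 1,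
    1]), (145724637090381655824000, [2], [2, 1, 2, 2]), (3081091386755639465328493, [4], [3, 2]), (-
    4286836120528294724650176, [3], [3, 2, 1]), (- 3021611822066802632010239, [3], [2, 4]),
    (99153582899319239760000, [2], [2, 1, 3, 1]), (- 60017366277869471251200, [2], [2, 1, 4]), (-
    25215733046566960128000, [2], [2, 1, 1, 2, 1]), (850697348101003794231936, [3], [2, 3, 1]), (-
    6290751790931489280000, [2], [2, 1, 1, 1, 2]), (4639263415548336459428479, [4], [2, 3]),
    (3907391443845935966468032, [3], [2, 2, 2]), (31138173842713233408000, [2], [2, 1, 1, 3]),
    (15147830037101799627431232, [3, 1], [4, 1]), (- 1921249280210751341147712, [3], [3, 1, 2]),
    (5344177607574933617735872, [3, 1], [3, 2]), (- 3158118359050217683269088, [2, 2], [3, 2]),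
    (53343384910056051552000, [3, 1], [3, 1, 1]), (- 1379108141275966399501680, [2, 2], [5]), (-
    58654233409413440736000, [3], [3, 1, 1, 1]), (- 989396095942605502986240, [2, 1], [5, 1]), (-
    28392001651049656032000, [3], [2, 2, 1, 1]), (- 5349412364160010041750240, [2, 2], [4, 1]),
    (346232409784254255024000, [3], [2, 1, 3]), (- 232477611531516114624000, [2, 1], [4, 1, 1]),
    (14950352146676168880000, [3], [2, 1, 2, 1]), (- 5537899386876229632000, [2, 1], [2, 2, 1, 1])]"
  by code_simp

text \<open>Pure relations with target zero. They make zeta(2) the only generator of even weight
  among the single zeta values in use, so that the final comparison becomes one of polynomials in
  zeta(2), the odd zeta values and zeta(5,3).\<close>

lemma cert_even_4:
  "cert_ok Zero [(2, [2], [2]), (- 5, [], [4])] [(1, [2], [2]), (- 4, [1], [3])]"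
  by code_simp

lemma cert_even_6:
  "cert_ok Zero [(4, [2], [4]), (- 7, [], [6])] [(- 1, [3], [3]), (2, [2], [4]), (- 4, [1], [5])]"
  by code_simp

lemma cert_even_8:
  "cert_ok Zero [(6, [2], [6]), (- 10, [], [8])] [(- 1, [3], [5]), (3, [2], [6]), (- 6, [1], [7])]"
  by code_simp

section \<open>The WZ pair\<close>

definition quotT :: "complex \<Rightarrow> complex" where
  "quotT z = Gamma (6 * z) * Gamma z ^ 7 / (Gamma (3 * z) ^ 3 * Gamma (2 * z) ^ 2)"

definition f14c :: "complex \<Rightarrow> complex" where
  "f14c z = (69 * z ^ 2 - 40 * z + 6) * quotT z / (18 * (6 * z - 1))"

text \<open>A factor independent of the summation index. Together with the Gamma prefactor of
  \<open>wz_term\<close> near the origin it combines to \<open>wz_Phi z * recip_sin z ^ 2\<close>,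
  up to elementary factors, which makes the final expansion simple.\<close>

definition wz_pre :: "complex \<Rightarrow> complex" where
  "wz_pre z = Gamma (1 + 6 * z) * Gamma (1 + z) ^ 3 * rGamma (1 + 3 * z) * rGamma (1 + 2 * z) ^ 2"

text \<open>\<open>wz_term\<close> and \<open>wz_mate\<close> form a WZ pair up to the factor \<open>8\<pi>z wz_pre z\<close>; \<open>wz_poly\<close> comes out of Gosper's
  algorithm.  Writing reciprocal Gamma factors as \<open>rGamma\<close> makes the terms entire where the quotient has poles.\<close>

definition wz_term :: "complex \<Rightarrow> nat \<Rightarrow> complex" where
  "wz_term z k = (-1) ^ Suc k * of_real pi * of_nat k * rGamma (3 * z + 1 - of_nat k) *
     Gamma (of_nat k + z) ^ 2 * rGamma (1 + of_nat k + 3 * z) * rGamma (1 + of_nat k - z) ^ 2"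

definition wz_poly :: "complex \<Rightarrow> complex \<Rightarrow> complex" where
  "wz_poly z t = t * (136 + 1459 * z + 5800 * z ^ 2 + 10872 * z ^ 3 + 9696 * z ^ 4 + 3312 * z ^ 5
     - (40 + 306 * z + 568 * z ^ 2 + 312 * z ^ 3) * t ^ 2 - z * t ^ 4)"

definition wz_mate :: "complex \<Rightarrow> nat \<Rightarrow> complex" where
  "wz_mate z k = - 8 * of_real pi ^ 2 * wz_pre z * (-1) ^ Suc k * rGamma (3 * z + 4 - of_nat k) *
     Gamma (of_nat k + z) ^ 2 * rGamma (3 + of_nat k + 3 * z) * rGamma (of_nat k - z) ^ 2 *
     wz_poly z (2 * of_nat k - 1) / (32 * (2 * z + 1))"

text \<open>The WZ equation with all common Gamma factors divided out. \<open>wz_poly\<close> is odd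
  in t, so k -> -k exchanges the two terms on the right up to sign; the left side is odd in k as
  well.\<close>

lemma wz_poly_identity:
  fixes z k :: complex
  shows "32 * (z * k * ((3*z+1-k) * (3*z+2-k) * (3*z+3-k)) * ((1+k+3*z) * (2+k+3*z) * (3+k+3*z)) * (2*z+1)
       - 6 * (z+1)^2 * (6*z+1) * (6*z+5) * k * (k+z)^2 * (k-z)^2)
     = (3*z+3-k) * (k+z)^2 * wz_poly z (2*k+1) + (3+k+3*z) * (k-z)^2 * wz_poly z (2*k-1)"
  unfolding wz_poly_def by algebra

lemma rGamma_shift3:
  "rGamma (w :: complex) = w * (w + 1) * (w + 2) * rGamma (w + 3)"
  using rGamma_plus1[of w] rGamma_plus1[of "w + 1"] rGamma_plus1[of "w + 2"]
  by (simp add: add.assoc mult.assoc)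

lemma rGamma_shift2:
  "rGamma (w :: complex) = w * (w + 1) * rGamma (w + 2)"
  using rGamma_plus1[of w] rGamma_plus1[of "w + 1"]
  by (simp add: add.assoc mult.assoc)

lemma Gamma_Suc: "Re w > 0 \<Longrightarrow> Gamma (1 + w) = w * Gamma (w :: complex)"
proof -
  assume "Re w > 0"
  hence "w \<notin> \<int>\<^sub>\<le>\<^sub>0" by (auto elim!: nonpos_Ints_cases)
  thus ?thesis using Gamma_plus1[of w] by (simp add: add.commute)
qed

lemma wz_pre_step:
  assumes "Re z > -1/6"
  shows "(z + 1) * wz_pre (z + 1) * (2 * z + 1) = 6 * (z+1)^2 * (6*z+1) * (6*z+5) * wz_pre z"
proof -
  have G6: "Gamma (1 + 6 * (z + 1)) = (6*z+1)*(6*z+2)*(6*z+3)*(6*z+4)*(6*z+5)*(6*z+6) * Gamma (1 + 6 * z)"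
    using assms Gamma_Suc[of "6*z+1"] Gamma_Suc[of "6*z+2"] Gamma_Suc[of "6*z+3"] Gamma_Suc[of "6*z+4"]
      Gamma_Suc[of "6*z+5"] Gamma_Suc[of "6*z+6"] by (simp add: algebra_simps)
  have G1: "Gamma (1 + (z + 1)) = (z + 1) * Gamma (1 + z)"
    using assms Gamma_Suc[of "z+1"] by (simp add: algebra_simps)
  have r3: "rGamma (1 + 3 * z) = (3*z+1)*(3*z+2)*(3*z+3) * rGamma (1 + 3 * (z + 1))"
    using rGamma_shift3[of "1+3*z"] by (simp add: algebra_simps)
  have r2: "rGamma (1 + 2 * z) = (2*z+1)*(2*z+2) * rGamma (1 + 2 * (z + 1))"
    using rGamma_shift2[of "1+2*z"] by (simp add: algebra_simps)
  show ?thesis unfolding wz_pre_def G6 G1 r3 r2 by algebra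
qed

lemma wz_pair_quotient: "X * (32 * Y) / (32 * D) = X * Y / (D :: complex)"
  by (metis mult.left_commute mult_divide_mult_cancel_left_if zero_neq_numeral)

text \<open>The letters stand for p = pi, A = \<open>wz_pre z\<close>, K = k, X and Y the two triple
  products, M and N the squares of K + z and K - z, D = 2z + 1, and b the common Gamma product. With
  these abstracted only field arithmetic is left.\<close>

lemma wz_pair_regroup:
  fixes D :: complex
  assumes "D \<noteq> 0"
  shows "8 * p * z * A * (p * K * X * Y * b) - 8 * p * (6 * B * C * E * A / D) * (p * K * M * N * b)
    = 8 * p^2 * A * b * (32 * (z * K * X * Y * D - 6 * B * C * E * K * M * N)) / (32 * D)"
proof -
  define U where "U = X * Y"
  define V where "V = B * C * E * M * N"
  define q where "q = 8 * p^2 * A * b * K"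
  have "8 * p^2 * A * b * (z * K * X * Y * D - 6 * B * C * E * K * M * N) / D = q * (z * U * D - 6 * V) / D"
    by (simp add: q_def U_def V_def algebra_simps)
  also have "\<dots> = q * (z * U) - q * (6 * V) / D"
    using assms by (simp add: field_simps)
  also have "q * (z * U) = 8 * p * z * A * (p * K * X * Y * b)"
    by (simp add: q_def U_def power2_eq_square mult_ac)
  also have "q * (6 * V) / D = 8 * p * (6 * B * C * E * A / D) * (p * K * M * N * b)"
    by (simp add: q_def V_def power2_eq_square mult_ac)
  finally show ?thesis unfolding wz_pair_quotient by (rule sym)
qed

lemma wz_pair_split:
  fixes D :: complex
  shows "8 * p * A * b * (X * Y * W + X' * Y' * W') / D
    = 8 * p * A * (X * Y * W) * b / D - - 8 * p * A * (X' * Y' * W') * b / D"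
proof -
  have "8 * p * A * b * (X * Y * W + X' * Y' * W') =
      8 * p * A * (X * Y * W) * b - - 8 * p * A * (X' * Y' * W') * b"
    by (simp add: algebra_simps)
  thus ?thesis by (simp only: diff_divide_distrib)
qed

lemma wz_term_regroup:
  "s * p * K * (X * r) * g ^ 2 * (Y * q) * t ^ 2 = p * K * X * Y * (s * r * g ^ 2 * q * t ^ 2)"
  for s :: complex
  by (simp only: mult_ac)

lemma wz_term_shift_regroup:
  "s * p * K * r * (x * g) ^ 2 * q * (y * t) ^ 2 = p * K * x ^ 2 * y ^ 2 * (s * r * g ^ 2 * q * t ^ 2)"
  for s :: complex
  by (simp only: mult_ac power_mult_distrib)

lemma wz_mate_regroup:
  "- 8 * P * A * s * r * g ^ 2 * (x * q) * (y * t) ^ 2 * w / D =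
   - 8 * P * A * (x * y ^ 2 * w) * (s * r * g ^ 2 * q * t ^ 2) / D" for s :: complex
  by (simp only: mult_ac power_mult_distrib)

lemma wz_mate_shift_regroup:
  "- 8 * P * A * - s * (x * r) * (y * g) ^ 2 * q * t ^ 2 * w / D =
   8 * P * A * (x * y ^ 2 * w) * (s * r * g ^ 2 * q * t ^ 2) / D" for s :: complex
proof -
  have "- 8 * P * A * - s * (x * r) * (y * g) ^ 2 * q * t ^ 2 * w =
    8 * P * A * (x * y ^ 2 * w) * (s * r * g ^ 2 * q * t ^ 2)"
    by (simp add: power_mult_distrib mult_ac)
  thus ?thesis by simp
qed

text \<open>All four terms are rational multiples of one Gamma product, and the multiples satisfy
  \<open>wz_poly_identity\<close>.\<close>

lemma wz_pair:
  assumes z: "Re z > -1/6" and k: "k > 0"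
  shows "8 * of_real pi * z * wz_pre z * wz_term z k
       - 8 * of_real pi * (z + 1) * wz_pre (z + 1) * wz_term (z + 1) k = wz_mate z (Suc k) - wz_mate z k"
proof -
  define K :: complex where "K = of_nat k"
  define p :: complex where "p = of_real pi"
  define s :: complex where "s = (-1) ^ Suc k"
  define r where "r = rGamma (3 * z + 4 - K)"
  define q where "q = rGamma (4 + K + 3 * z)"
  define t where "t = rGamma (1 + K - z)"
  define g where "g = Gamma (K + z)"
  define A where "A = wz_pre z"
  \<comment> \<open>The arguments are chosen extremal: the largest one that occurs in each
    \<open>rGamma\<close> and the smallest one in \<open>Gamma\<close>. The functional equations
    then express every other factor as a polynomial times these.\<close>
  define b where "b = s * r * g ^ 2 * q * t ^ 2"
  have z2: "2 * z + 1 \<noteq> 0"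
  proof
    assume "2 * z + 1 = 0"
    hence "Re (2 * z + 1) = 0" by simp
    thus False using z by simp
  qed
  have r1: "rGamma (3 * z + 1 - K) = (3*z+1-K) * (3*z+2-K) * (3*z+3-K) * r"
    using rGamma_shift3[of "3 * z + 1 - K"] by (simp add: r_def algebra_simps)
  have r2: "rGamma (1 + K + 3 * z) = (1+K+3*z) * (2+K+3*z) * (3+K+3*z) * q"
    using rGamma_shift3[of "1 + K + 3 * z"] by (simp add: q_def algebra_simps)
  have r2': "rGamma (3 + K + 3 * z) = (3+K+3*z) * q"
    using rGamma_plus1[of "3 + K + 3 * z"] by (simp add: q_def algebra_simps)
  have r3: "rGamma (K - z) = (K - z) * t"
    using rGamma_plus1[of "K - z"] by (simp add: t_def algebra_simps)
  have r1': "rGamma (3 * z + 3 - K) = (3*z+3-K) * r"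
    using rGamma_plus1[of "3 * z + 3 - K"] by (simp add: r_def algebra_simps)
  have "Re (K + z) > 0" using z k by (simp add: K_def)
  hence g1: "Gamma (1 + (K + z)) = (K + z) * g" unfolding g_def by (rule Gamma_Suc)
  have v: "wz_term z k = p * K * ((3*z+1-K) * (3*z+2-K) * (3*z+3-K)) * ((1+K+3*z) * (2+K+3*z) * (3+K+3*z)) * b"
    unfolding wz_term_def K_def[symmetric] p_def[symmetric] s_def[symmetric] r1 r2
      g_def[symmetric] t_def[symmetric] b_def by (rule wz_term_regroup)
  have v1: "wz_term (z + 1) k = p * K * (K + z)^2 * (K - z)^2 * b"
  proof -
    have e: "3 * (z + 1) + 1 - K = 3 * z + 4 - K" "K + (z + 1) = 1 + (K + z)"
      "1 + K + 3 * (z + 1) = 4 + K + 3 * z" "1 + K - (z + 1) = K - z"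
      by (simp_all add: algebra_simps)
    show ?thesis
      unfolding wz_term_def K_def[symmetric] p_def[symmetric] s_def[symmetric] e g1 r3
        r_def[symmetric] q_def[symmetric] b_def by (rule wz_term_shift_regroup)
  qed
  have m0: "wz_mate z k = - 8 * p^2 * A * ((3+K+3*z) * (K-z)^2 * wz_poly z (2*K-1)) * b / (32 * (2 * z + 1))"
    unfolding wz_mate_def K_def[symmetric] p_def[symmetric] s_def[symmetric] r2' r3
      r_def[symmetric] g_def[symmetric] A_def[symmetric] b_def
    by (rule wz_mate_regroup)
  have m1: "wz_mate z (Suc k) = 8 * p^2 * A * ((3*z+3-K) * (K+z)^2 * wz_poly z (2*K+1)) * b / (32 * (2 * z + 1))"
  proof -
    have e: "3 * z + 4 - (1 + K) = 3 * z + 3 - K" "(1 + K) + z = 1 + (K + z)"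
      "3 + (1 + K) + 3 * z = 4 + K + 3 * z" "2 * (1 + K) - 1 = 2 * K + 1"
      "(-1 :: complex) ^ Suc (Suc k) = - s" "of_nat (Suc k) = 1 + K"
      by (simp_all add: algebra_simps s_def K_def)
    show ?thesis
      unfolding wz_mate_def e p_def[symmetric] g1 r1' q_def[symmetric] t_def[symmetric] A_def[symmetric] b_def
      by (rule wz_mate_shift_regroup)
  qed
  have A1: "(z + 1) * wz_pre (z + 1) = 6 * (z+1)^2 * (6*z+1) * (6*z+5) * A / (2 * z + 1)"
    unfolding A_def nonzero_eq_divide_eq[OF z2] by (rule wz_pre_step[OF z])
  have "8 * p * z * A * wz_term z k - 8 * p * ((z + 1) * wz_pre (z + 1)) * wz_term (z + 1) k =
     8 * p^2 * A * b * (32 * (z * K * ((3*z+1-K) * (3*z+2-K) * (3*z+3-K)) * ((1+K+3*z) * (2+K+3*z) * (3+K+3*z)) * (2*z+1)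
       - 6 * (z+1)^2 * (6*z+1) * (6*z+5) * K * (K+z)^2 * (K-z)^2)) / (32 * (2 * z + 1))"
    unfolding v v1 A1 using z2 by (rule wz_pair_regroup)
  also have "\<dots> = wz_mate z (Suc k) - wz_mate z k"
    unfolding wz_poly_identity m0 m1 by (rule wz_pair_split)
  finally show ?thesis unfolding p_def[symmetric] A_def[symmetric] by (simp only: mult.assoc)
qed

section \<open>The boundary term at index 1\<close>

lemma Gamma_nonzero_Re: "Re w > 0 \<Longrightarrow> Gamma (w :: complex) \<noteq> 0"
  by (auto simp: Gamma_eq_zero_iff elim!: nonpos_Ints_cases)

lemma Gamma_shift1:
  assumes "Re w > -1" "w \<noteq> 0"
  shows "Gamma (1 + w) = w * Gamma (w :: complex)" "Gamma w \<noteq> 0"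
proof -
  have "w \<notin> \<int>\<^sub>\<le>\<^sub>0" using assms by (auto elim!: nonpos_Ints_cases)
  thus "Gamma (1 + w) = w * Gamma w" "Gamma w \<noteq> 0"
    using Gamma_plus1[of w] by (auto simp: add.commute Gamma_eq_zero_iff)
qed

lemma wz_mate_1_regroup:
  fixes z :: complex
  assumes "z \<noteq> 0" "g2 \<noteq> 0" "g3 \<noteq> 0" "a1 \<noteq> 0" "a2 \<noteq> 0" "a3 \<noteq> 0" "D \<noteq> 0" "p \<noteq> 0"
  shows "- 8 * p^2 * ((6*z*g6) * (z*g)^3 * inverse (3*z*g3) * inverse (2*z*g2)^2) * 1 *
     inverse (a2 * a1 * (3*z*g3)) * (z*g)^2 * inverse (a3 * (a2 * a1 * (3*z*g3))) * (sn * g / p)^2 * P / (32 * D)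
    = - (4/9) * sn^2 * (g6 * g^7 / (g3^3 * g2^2)) * z * P / (a1^2 * a2^2 * a3 * (32 * D))"
  using assms by (simp add: field_simps eval_nat_numeral)

lemma quotT_step_regroup:
  fixes z :: complex
  assumes "z \<noteq> 0" "g2 \<noteq> 0" "g3 \<noteq> 0" "a1 \<noteq> 0" "a2 \<noteq> 0" "D \<noteq> 0"
  shows "(c5 * (2 * a2) * (3 * D) * (2 * a1) * c1 * (6 * z * g6)) * (z * g)^7 /
      ((a2 * a1 * (3 * z * g3))^3 * (D * (2 * z * g2))^2)
    = (2/3) * z^3 * c1 * c5 / (a1^2 * a2^2 * D) * (g6 * g^7 / (g3^3 * g2^2))"
  using assms by (simp add: field_simps eval_nat_numeral)

lemma wz_boundary_scalar:
  fixes z :: complex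
  assumes "M \<noteq> 0" "y \<noteq> 0" "c5 \<noteq> 0" "N * z^3 * c1 + 2 * y * z^3 * c1 * c5 - 3 * z * M = - z * P"
  shows "N / (18 * c5) * ((2/3) * z^3 * c1 * c5 / M) - z / 9 + y / 9 * ((2/3) * z^3 * c1 * c5 / M)
    = - (4/9) * z * (8 * y * P) / (M * (3 * y) * 32)"
proof -
  have "N / (18 * c5) * ((2/3) * z^3 * c1 * c5 / M) - z / 9 + y / 9 * ((2/3) * z^3 * c1 * c5 / M)
     = (N * z^3 * c1 + 2 * y * z^3 * c1 * c5 - 3 * z * M) / (27 * M)"
    using assms(1-3) by (simp add: field_simps)
  also have "\<dots> = - z * P / (27 * M)" using assms(4) by simp
  also have "\<dots> = - (4/9) * z * (8 * y * P) / (M * (3 * y) * 32)"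
    using assms(1-3) by (simp add: field_simps)
  finally show ?thesis .
qed

lemma wz_boundary_scale:
  fixes X :: complex
  assumes "u * t - z / 9 + y / 9 * t = - (4/9) * z * P / Q"
  shows "u * (t * X) - z * X / 9 + y * (t * X) / 9 = - (4/9) * X * z * P / Q"
proof -
  have "u * (t * X) - z * X / 9 + y * (t * X) / 9 = (u * t - z / 9 + y / 9 * t) * X"
    by (simp add: algebra_simps)
  thus ?thesis unfolding assms by simp
qed

text \<open>The linear factors 6z+2, 6z+3, 6z+4 cancel against the denominator. The remaining ratio
  tends to 4/27 at infinity, the source of the geometric convergence below.\<close>

lemma quotT_step:
  assumes z: "Re z > -1/6" "z \<noteq> 0"
  shows "quotT (z + 1) = (2/3) * z^3 * (6*z+1) * (6*z+5) / ((3*z+1)^2 * (3*z+2)^2 * (2*z+1)) * quotT z"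
proof -
  define g where "g = Gamma z"
  define g2 where "g2 = Gamma (2 * z)"
  define g3 where "g3 = Gamma (3 * z)"
  define g6 where "g6 = Gamma (6 * z)"
  have nz: "g2 \<noteq> 0" "g3 \<noteq> 0" using z Gamma_shift1(2) by (auto simp: g2_def g3_def)
  have nzp: "2 * z + 1 \<noteq> 0" "3 * z + 1 \<noteq> 0" "3 * z + 2 \<noteq> 0" "z + 1 \<noteq> 0" "6 * z + 5 \<noteq> 0" "6*z+1 \<noteq> 0"
    using z by (auto simp: complex_eq_iff add_eq_0_iff)
  have s6: "Gamma (1 + 6 * z) = 6 * z * g6" and s1: "Gamma (1 + z) = z * g"
    and s3: "Gamma (1 + 3 * z) = 3 * z * g3" and s2: "Gamma (1 + 2 * z) = 2 * z * g2"
    using z Gamma_shift1(1)[of "6 * z"] Gamma_shift1(1)[of z] Gamma_shift1(1)[of "3 * z"] Gamma_shift1(1)[of "2 * z"]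
    by (simp_all add: g_def g2_def g3_def g6_def)
  have Re: "Re (3*z+1) > 0" "Re (3*z+2) > 0" "Re (3*z+3) > 0" "Re (2*z+1) > 0"
     "Re (6*z+1) > 0" "Re (6*z+2) > 0" "Re (6*z+3) > 0" "Re (6*z+4) > 0" "Re (6*z+5) > 0" using z by auto
  have t3: "Gamma (3 * z + 3) = (3*z+2) * (3*z+1) * (3 * z * g3)"
    using Gamma_Suc[OF Re(1)] Gamma_Suc[OF Re(2)] s3 by (simp add: algebra_simps)
  have T1: "quotT (z + 1) = ((6*z+5)*(6*z+4)*(6*z+3)*(6*z+2)*(6*z+1)*(6*z*g6)) * (z * g)^7 /
     (((3*z+2) * (3*z+1) * (3 * z * g3))^3 * ((2*z+1) * (2*z*g2))^2)"
  proof -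
    have "Gamma (6 * (z + 1)) = (6*z+5)*(6*z+4)*(6*z+3)*(6*z+2)*(6*z+1)*(6*z*g6)"
      using Gamma_Suc[OF Re(5)] Gamma_Suc[OF Re(6)] Gamma_Suc[OF Re(7)] Gamma_Suc[OF Re(8)] Gamma_Suc[OF Re(9)] s6
      by (simp add: algebra_simps)
    moreover have "Gamma (3 * (z + 1)) = (3*z+2) * (3*z+1) * (3 * z * g3)" using t3 by (simp add: algebra_simps)
    moreover have "Gamma (2 * (z + 1)) = (2*z+1) * (2*z*g2)"
      using Gamma_Suc[OF Re(4)] s2 by (simp add: algebra_simps)
    ultimately show ?thesis unfolding quotT_def using s1 by (simp add: add.commute)
  qed
  have T0: "quotT z = g6 * g^7 / (g3^3 * g2^2)"
    by (simp add: quotT_def g_def g2_def g3_def g6_def)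
  have e: "6*z+4 = 2 * (3*z+2)" "6*z+3 = 3 * (2*z+1)" "6*z+2 = 2 * (3*z+1)" by simp_all
  show ?thesis unfolding T1 T0 e using nz nzp z(2) by (intro quotT_step_regroup)
qed

text \<open>The reflection formula turns the squared \<open>rGamma (1 - z)\<close> of the mate into
  sin^2(pi z). What is left is a rational multiple of \<open>quotT z\<close>; it misses
  \<open>f14c (z + 1)\<close> by a difference of z \<open>quotT z\<close> / 9 under the unit shift,
  whence that correction in the periodic function.\<close>

lemma wz_boundary:
  assumes z: "Re z > -1/6" "z \<noteq> 0"
  shows "sin (of_real pi * z)^2 * (f14c (z + 1) - z * quotT z / 9 + (z + 1) * quotT (z + 1) / 9) = wz_mate z 1"
proof -
  define g where "g = Gamma z"
  define g2 where "g2 = Gamma (2 * z)"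
  define g3 where "g3 = Gamma (3 * z)"
  define g6 where "g6 = Gamma (6 * z)"
  have nz: "g2 \<noteq> 0" "g3 \<noteq> 0" using z Gamma_shift1(2) by (auto simp: g2_def g3_def)
  have nzp: "2 * z + 1 \<noteq> 0" "3 * z + 1 \<noteq> 0" "3 * z + 2 \<noteq> 0" "z + 1 \<noteq> 0" "6 * z + 5 \<noteq> 0" "6*z+1 \<noteq> 0"
    using z by (auto simp: complex_eq_iff add_eq_0_iff)
  have s6: "Gamma (1 + 6 * z) = 6 * z * g6" and s1: "Gamma (1 + z) = z * g"
    and s3: "Gamma (1 + 3 * z) = 3 * z * g3" and s2: "Gamma (1 + 2 * z) = 2 * z * g2"
    using z Gamma_shift1(1)[of "6 * z"] Gamma_shift1(1)[of z] Gamma_shift1(1)[of "3 * z"] Gamma_shift1(1)[of "2 * z"]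
    by (simp_all add: g_def g2_def g3_def g6_def)
  have Re: "Re (3*z+1) > 0" "Re (3*z+2) > 0" "Re (3*z+3) > 0" "Re (2*z+1) > 0"
     "Re (6*z+1) > 0" "Re (6*z+2) > 0" "Re (6*z+3) > 0" "Re (6*z+4) > 0" "Re (6*z+5) > 0" using z by auto
  have t3: "Gamma (3 * z + 3) = (3*z+2) * (3*z+1) * (3 * z * g3)"
    using Gamma_Suc[OF Re(1)] Gamma_Suc[OF Re(2)] s3 by (simp add: algebra_simps)
  have t3': "Gamma (4 + 3 * z) = (3*z+3) * ((3*z+2) * (3*z+1) * (3 * z * g3))"
    using Gamma_Suc[OF Re(3)] t3 by (simp add: algebra_simps)
  have T0: "quotT z = g6 * g^7 / (g3^3 * g2^2)"
    by (simp add: quotT_def g_def g2_def g3_def g6_def)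
  have rG: "rGamma (1 - z) = sin (of_real pi * z) * g / of_real pi"
  proof -
    have "rGamma z * rGamma (1 - z) = sin (of_real pi * z) / of_real pi" by (rule rGamma_reflection_complex)
    moreover have "g \<noteq> 0" using z Gamma_shift1(2)[of z] by (simp add: g_def)
    ultimately show ?thesis unfolding g_def rGamma_inverse_Gamma[of z] by (simp add: field_simps)
  qed
  define sn where "sn = sin (of_real pi * z)"
  define P where "P = wz_poly z 1"
  have mate: "wz_mate z 1 = - (4/9) * sn^2 * (g6 * g^7 / (g3^3 * g2^2)) * z * P /
      ((3*z+1)^2 * (3*z+2)^2 * (3*z+3) * (32 * (2*z+1)))"
  proof -
    have e: "3 * z + 4 - of_nat 1 = 3 * z + 3" "of_nat 1 + z = 1 + z" "3 + of_nat 1 + 3 * z = 4 + 3 * z"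
      "of_nat 1 - z = 1 - z" "2 * of_nat 1 - 1 = (1::complex)" "(-1::complex)^Suc 1 = 1" by simp_all
    have z3: "3 * z + 3 \<noteq> 0" using nzp(4) by (metis mult_eq_0_iff distrib_left mult.right_neutral zero_neq_numeral)
    show ?thesis
      unfolding wz_mate_def wz_pre_def e rGamma_inverse_Gamma[of "1 + _ * z"] rGamma_inverse_Gamma[of "3 * z + 3"]
        rGamma_inverse_Gamma[of "4 + 3 * z"] s6 s1 s3 s2 t3 t3' rG sn_def[symmetric] P_def[symmetric]
      using nz nzp z3 z(2) by (intro wz_mate_1_regroup) auto
  qed
  have "f14c (z + 1) - z * quotT z / 9 + (z + 1) * quotT (z + 1) / 9 =
     - (4/9) * (g6 * g^7 / (g3^3 * g2^2)) * z * P / ((3*z+1)^2 * (3*z+2)^2 * (3*z+3) * (32 * (2*z+1)))"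
  proof -
    define X where "X = g6 * g^7 / (g3^3 * g2^2)"
    have T1': "quotT (z + 1) = (2/3) * z^3 * (6*z+1) * (6*z+5) / ((3*z+1)^2 * (3*z+2)^2 * (2*z+1)) * X"
      unfolding quotT_step[OF z] T0 X_def ..
    have f1: "f14c (z + 1) = (69 * (z+1)^2 - 40 * (z+1) + 6) / (18 * (6*z+5)) * quotT (z + 1)"
      by (simp add: f14c_def algebra_simps)
    define M where "M = (3*z+1)^2 * (3*z+2)^2 * (2*z+1)"
    \<comment> \<open>The mate has the denominator 3z + 3, absent on the other side; it cancels
      against the factor z + 1 of the polynomial at t = 1.\<close>
    define P' where "P' = 12 + 132 * z + 522 * z ^ 2 + 798 * z ^ 3 + 414 * z ^ 4"
    have P: "P = 8 * (z + 1) * P'"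
      unfolding P_def P'_def wz_poly_def by (simp add: algebra_simps eval_nat_numeral)
    have "M \<noteq> 0" using nzp by (simp add: M_def)
    have "(69 * (z+1)^2 - 40 * (z+1) + 6) / (18 * (6*z+5)) * ((2/3) * z^3 * (6*z+1) * (6*z+5) / M)
       - z / 9 + (z + 1) / 9 * ((2/3) * z^3 * (6*z+1) * (6*z+5) / M)
       = - (4/9) * z * (8 * (z + 1) * P') / (M * (3 * (z + 1)) * 32)"
    proof (rule wz_boundary_scalar)
      show "(69 * (z+1)^2 - 40 * (z+1) + 6) * z^3 * (6*z+1) + 2 * (z+1) * z^3 * (6*z+1) * (6*z+5) - 3 * z * M
        = - z * P'" unfolding M_def P'_def by algebra
    qed fact+
    also have "M * (3 * (z + 1)) * 32 = (3*z+1)^2 * (3*z+2)^2 * (3*z+3) * (32 * (2*z+1))"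
      unfolding M_def by algebra
    finally have "(69 * (z+1)^2 - 40 * (z+1) + 6) / (18 * (6*z+5)) * ((2/3) * z^3 * (6*z+1) * (6*z+5) / M)
       - z / 9 + (z + 1) / 9 * ((2/3) * z^3 * (6*z+1) * (6*z+5) / M)
       = - (4/9) * z * P / ((3*z+1)^2 * (3*z+2)^2 * (3*z+3) * (32 * (2*z+1)))" unfolding P .
    thus ?thesis
      unfolding f1 T1' T0 X_def[symmetric] M_def[symmetric] by (intro wz_boundary_scale)
  qed
  thus ?thesis unfolding mate sn_def[symmetric] by (simp only: mult_ac times_divide_eq_right)
qed

section \<open>Convergence of the WZ sums\<close>

text \<open>|Gamma(x + it)| / Gamma(x) increases with x. In Gauss's product each factor
  (a+i)/|a+i+it| is at most the corresponding one for b, and the powers n^(it) have modulus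
  1.\<close>

lemma norm_Gamma_ratio_le:
  assumes "0 < a" "a \<le> b"
  shows "norm (Gamma (Complex a t)) \<le> Gamma a / Gamma b * norm (Gamma (Complex b t))"
proof -
  have pos: "Complex a t \<notin> \<int>\<^sub>\<le>\<^sub>0" "Complex b t \<notin> \<int>\<^sub>\<le>\<^sub>0" "a \<notin> \<int>\<^sub>\<le>\<^sub>0" "b \<notin> \<int>\<^sub>\<le>\<^sub>0"
    using assms by (auto elim!: nonpos_Ints_cases simp: complex_eq_iff)
  have Gb: "Gamma b > 0" "Gamma a > 0" using assms by auto
  have le: "norm (Gamma_series (Complex a t) n) * Gamma_series b n \<le> Gamma_series a n * norm (Gamma_series (Complex b t) n)"
    if n: "n > 0" for n
  proof -
    have ge0: "Gamma_series a n \<ge> 0" "Gamma_series b n \<ge> 0"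
      using assms by (auto simp: Gamma_series_def intro!: divide_nonneg_nonneg mult_nonneg_nonneg pochhammer_nonneg)
    have nrm: "norm (Gamma_series (Complex c t) n) = fact n * exp (c * ln n) / norm (pochhammer (Complex c t) (n + 1))" for c
    proof -
      have "ln (of_nat n) = complex_of_real (ln (real n))" using n Ln_of_real[of "real n"] by simp
      thus ?thesis unfolding Gamma_series_def by (simp add: norm_divide norm_mult norm_exp_eq_Re)
    qed
    have prod: "pochhammer a (n + 1) * norm (pochhammer (Complex b t) (n + 1)) \<le>
        norm (pochhammer (Complex a t) (n + 1)) * pochhammer b (n + 1)"
    proof -
      have "(\<Prod>i<n + 1. (a + real i) * norm (Complex b t + of_nat i)) \<le>
          (\<Prod>i<n + 1. norm (Complex a t + of_nat i) * (b + real i))"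
      proof (intro prod_mono conjI)
        fix i
        let ?A = "a + real i" and ?B = "b + real i"
        have ab: "0 < ?A" "?A \<le> ?B" using assms by auto
        have "(?A * norm (Complex b t + of_nat i))\<^sup>2 \<le> (norm (Complex a t + of_nat i) * ?B)\<^sup>2"
        proof -
          have nrm: "(norm (Complex c t + of_nat i))\<^sup>2 = (c + real i)\<^sup>2 + t\<^sup>2" for c
            by (simp add: cmod_power2)
          have "?A\<^sup>2 * t\<^sup>2 \<le> ?B\<^sup>2 * t\<^sup>2" using ab by (intro mult_right_mono power_mono) auto
          hence "?A\<^sup>2 * (?B\<^sup>2 + t\<^sup>2) \<le> (?A\<^sup>2 + t\<^sup>2) * ?B\<^sup>2" by (simp only: ring_distribs mult.commute)
          thus ?thesis by (simp only: power_mult_distrib nrm)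
        qed
        thus "?A * norm (Complex b t + of_nat i) \<le> norm (Complex a t + of_nat i) * ?B"
          by (rule power2_le_imp_le) (use ab in auto)
        show "0 \<le> ?A * norm (Complex b t + of_nat i)" using ab by simp
      qed
      thus ?thesis unfolding pochhammer_prod prod_norm[symmetric] prod.distrib
        by (simp add: atLeast0LessThan)
    qed
    have pp: "pochhammer a (n+1) > 0" "pochhammer b (n+1) > 0" using assms by (auto intro!: pochhammer_pos)
    have np: "norm (pochhammer (Complex a t) (n + 1)) > 0" "norm (pochhammer (Complex b t) (n + 1)) > 0"
      using pos by (auto simp: pochhammer_eq_0_iff)
    have "norm (Gamma_series (Complex a t) n) * Gamma_series b n =
      (fact n * exp (a * ln n) * fact n * exp (b * ln n)) / (norm (pochhammer (Complex a t) (n + 1)) * pochhammer b (n + 1))"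
      unfolding nrm by (simp add: Gamma_series_def)
    also have "\<dots> \<le> (fact n * exp (a * ln n) * fact n * exp (b * ln n)) / (pochhammer a (n + 1) * norm (pochhammer (Complex b t) (n + 1)))"
      using prod pp np by (intro divide_left_mono mult_pos_pos) auto
    also have "\<dots> = Gamma_series a n * norm (Gamma_series (Complex b t) n)"
      unfolding nrm by (simp add: Gamma_series_def)
    finally show ?thesis .
  qed
  have "norm (Gamma (Complex a t)) * Gamma b \<le> Gamma a * norm (Gamma (Complex b t))"
  proof (rule tendsto_le)
    show "(\<lambda>n. norm (Gamma_series (Complex a t) n) * Gamma_series b n) \<longlonglongrightarrow> norm (Gamma (Complex a t)) * Gamma b"
      by (intro tendsto_intros)
    show "(\<lambda>n. Gamma_series a n * norm (Gamma_series (Complex b t) n)) \<longlonglongrightarrow> Gamma a * norm (Gamma (Complex b t))"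
      by (intro tendsto_intros)
    show "\<forall>\<^sub>F n in sequentially. norm (Gamma_series (Complex a t) n) * Gamma_series b n
        \<le> Gamma_series a n * norm (Gamma_series (Complex b t) n)"
      using eventually_gt_at_top[of 0] by eventually_elim (rule le)
  qed auto
  thus ?thesis using Gb by (simp add: field_simps)
qed

text \<open>Gauss's limit read backwards: the Pochhammer symbol in its denominator is
  Gamma(a+n+1)/Gamma(a).\<close>

lemma norm_Gamma_asymp:
  assumes "Re a > 0"
  shows "(\<lambda>n. norm (Gamma (a + of_nat n + 1)) / (fact n * real n powr Re a)) \<longlonglongrightarrow> 1"
proof -
  have a: "a \<notin> \<int>\<^sub>\<le>\<^sub>0" using assms by (auto elim!: nonpos_Ints_cases)
  have Ga: "Gamma a \<noteq> 0" using a by (simp add: Gamma_eq_zero_iff)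
  have "(\<lambda>n. norm (Gamma a) / norm (Gamma_series a n)) \<longlonglongrightarrow> norm (Gamma a) / norm (Gamma a)"
    using Ga by (intro tendsto_intros) auto
  moreover have "\<forall>\<^sub>F n in sequentially. norm (Gamma a) / norm (Gamma_series a n) =
      norm (Gamma (a + of_nat n + 1)) / (fact n * real n powr Re a)"
    using eventually_gt_at_top[of 0]
  proof eventually_elim
    case (elim n)
    have "ln (of_nat n) = complex_of_real (ln (real n))" using elim Ln_of_real[of "real n"] by simp
    hence nrm: "norm (Gamma_series a n) = fact n * real n powr Re a / norm (pochhammer a (n + 1))"
      using elim unfolding Gamma_series_def by (simp add: norm_divide norm_mult norm_exp_eq_Re powr_def)
    have "pochhammer a (n + 1) = Gamma (a + of_nat (n + 1)) / Gamma a"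
      using pochhammer_Gamma[OF a] .
    thus ?case unfolding nrm using Ga by (simp add: norm_divide add_ac)
  qed
  ultimately show ?thesis using Ga by (simp add: Lim_transform_eventually)
qed

text \<open>Numerator and denominator contain three Gamma values each, so the factorials cancel and
  a power of n remains; the factor 2 absorbs a ratio whose limit is 1.\<close>

lemma Gamma_product_bound:
  assumes "Re a > 0" "Re b > 0" "Re c > 0" "Re d > 0"
  shows "\<forall>\<^sub>F n in sequentially. norm (Gamma (a + of_nat n + 1) * Gamma (b + of_nat n + 1) ^ 2 *
      rGamma (c + of_nat n + 1) * rGamma (d + of_nat n + 1) ^ 2)
    \<le> 2 * real n powr (Re a + 2 * Re b - Re c - 2 * Re d)"
proof -
  define q where "q = (\<lambda>(a::complex) n. norm (Gamma (a + of_nat n + 1)) / (fact n * real n powr Re a))"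
  have "(\<lambda>n. q a n * q b n ^ 2 / (q c n * q d n ^ 2)) \<longlonglongrightarrow> 1 * 1 ^ 2 / (1 * 1 ^ 2)"
    using assms unfolding q_def by (intro tendsto_intros norm_Gamma_asymp) auto
  hence "\<forall>\<^sub>F n in sequentially. q a n * q b n ^ 2 / (q c n * q d n ^ 2) < 2"
    by (rule order_tendstoD) auto
  thus ?thesis using eventually_gt_at_top[of 0]
  proof eventually_elim
    case (elim n)
    let ?N = "norm (Gamma (a + of_nat n + 1) * Gamma (b + of_nat n + 1) ^ 2 *
      rGamma (c + of_nat n + 1) * rGamma (d + of_nat n + 1) ^ 2)"
    have n: "real n > 0" using elim by simp
    have "q a n * q b n ^ 2 / (q c n * q d n ^ 2) = ?N / (real n powr Re a * (real n powr Re b)^2 / (real n powr Re c * (real n powr Re d)^2))"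
      by (simp add: q_def norm_mult norm_power rGamma_inverse_Gamma norm_inverse norm_divide power_divide divide_simps power_mult_distrib)
    also have "real n powr Re a * (real n powr Re b)^2 / (real n powr Re c * (real n powr Re d)^2)
      = real n powr (Re a + 2 * Re b - Re c - 2 * Re d)"
    proof -
      have sq: "real n powr (2 * x) = (real n powr x)^2" for x
        by (simp only: mult_2 powr_add power2_eq_square)
      show ?thesis using n by (simp only: powr_add powr_diff sq) simp
    qed
    finally show ?case using elim(1) n by (simp add: divide_less_eq)
  qed
qed

text \<open>For large k the reciprocal Gamma factor of the WZ terms is taken deep in the left half
  plane. Reflection moves it to the right, and the sign from the integer shift of the sine cancels
  the alternating sign.\<close>

lemma rGamma_reflect_nat:
  fixes c :: complex
  assumes "Gamma (of_nat k - c) \<noteq> 0"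
  shows "(-1) ^ Suc k * rGamma (1 - (of_nat k - c)) = sin (of_real pi * c) / of_real pi * Gamma (of_nat k - c)"
proof -
  let ?w = "of_nat k - c"
  have "sin (of_real pi * ?w) = sin (of_nat k * of_real pi - of_real pi * c)"
    by (simp add: algebra_simps)
  also have "\<dots> = (-1) ^ Suc k * sin (of_real pi * c)"
  proof -
    have e: "of_nat k * of_real pi = (of_real (real k * pi) :: complex)" by simp
    have "sin (of_nat k * of_real pi :: complex) = of_real (sin (real k * pi))"
      "cos (of_nat k * of_real pi :: complex) = of_real (cos (real k * pi))"
      unfolding e by (rule sin_of_real cos_of_real)+
    thus ?thesis by (simp add: sin_diff sin_npi cos_npi)
  qed
  finally have s: "sin (of_real pi * ?w) = (-1) ^ Suc k * sin (of_real pi * c)" .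
  have "rGamma ?w * rGamma (1 - ?w) = (-1) ^ Suc k * sin (of_real pi * c) / of_real pi"
    unfolding rGamma_reflection_complex s ..
  hence "rGamma (1 - ?w) = (-1) ^ Suc k * sin (of_real pi * c) / of_real pi * Gamma ?w"
    using assms unfolding rGamma_inverse_Gamma[of ?w] by (simp add: field_simps)
  hence "(-1) ^ Suc k * rGamma (1 - ?w) =
      ((-1) ^ Suc k * (-1) ^ Suc k) * (sin (of_real pi * c) / of_real pi * Gamma ?w)"
    by (simp only: mult_ac times_divide_eq_right times_divide_eq_left)
  moreover have "(-1) ^ Suc k * (-1) ^ Suc k = (1 :: complex)"
    by (simp flip: power_mult_distrib)
  ultimately show ?thesis by (simp only: mult_1)
qed

lemma wz_term_reflect:
  assumes "Gamma (of_nat k - 3 * z) \<noteq> 0"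
  shows "wz_term z k = sin (of_real pi * (3 * z)) * of_nat k * (Gamma (of_nat k - 3 * z) *
     Gamma (of_nat k + z) ^ 2 * rGamma (1 + of_nat k + 3 * z) * rGamma (1 + of_nat k - z) ^ 2)"
proof -
  have e: "3 * z + 1 - of_nat k = 1 - (of_nat k - 3 * z)" by simp
  have "wz_term z k = ((-1) ^ Suc k * rGamma (1 - (of_nat k - 3 * z))) * of_real pi * of_nat k *
     (Gamma (of_nat k + z) ^ 2 * rGamma (1 + of_nat k + 3 * z) * rGamma (1 + of_nat k - z) ^ 2)"
    unfolding wz_term_def e by (simp only: mult_ac)
  thus ?thesis unfolding rGamma_reflect_nat[OF assms] by simp
qed

text \<open>The offset m brings all four Gamma arguments into the right half plane. The Gamma
  quotient contributes the exponent -3 - 2 Re z, the factor k raises it by 1, so convergence follows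
  for Re z > -1/2.\<close>

lemma wz_term_bound:
  "\<exists>C m. \<forall>\<^sub>F n in sequentially. norm (wz_term z (n + m)) \<le> C * real n powr (- 2 - 2 * Re z)"
proof -
  obtain m :: nat where m: "real m > 1 + 3 * norm z" using reals_Archimedean2 by blast
  have Rez: "\<bar>Re z\<bar> \<le> norm z" by (rule abs_Re_le_cmod)
  define a b c d where "a = of_nat m - 3 * z" "b = of_nat m + z" "c = 1 + of_nat m + 3 * z" "d = 1 + of_nat m - z"
  note abcd = this
  have Re: "Re a > 0" "Re b > 0" "Re c > 0" "Re d > 0"
    using m Rez by (auto simp: abcd)
  define C where "C = norm (sin (of_real pi * (3 * z))) * (real m + 2) * 2"
  have "\<forall>\<^sub>F n in sequentially. norm (wz_term z (n + (m + 1))) \<le> C * real n powr (- 2 - 2 * Re z)"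
    using Gamma_product_bound[OF Re] eventually_gt_at_top[of 0]
  proof eventually_elim
    case (elim n)
    have k: "Re (of_nat (n + (m + 1)) - 3 * z) > 0" using m Rez by auto
    have e: "of_nat (n + (m + 1)) - 3 * z = a + of_nat n + 1" "of_nat (n + (m + 1)) + z = b + of_nat n + 1"
      "1 + of_nat (n + (m + 1)) + 3 * z = c + of_nat n + 1" "1 + of_nat (n + (m + 1)) - z = d + of_nat n + 1"
      by (simp_all add: abcd algebra_simps)
    have ex: "Re a + 2 * Re b - Re c - 2 * Re d = - 3 - 2 * Re z" by (simp add: abcd)
    have n1: "real n \<ge> 1" using elim by simp
    have "norm (wz_term z (n + (m + 1))) \<le> norm (sin (of_real pi * (3 * z))) * real (n + (m + 1)) * (2 * real n powr (- 3 - 2 * Re z))"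
    proof -
      have nm: "norm (s * of_nat K * g) = norm s * real K * norm g" for s g :: complex and K
        by (simp only: norm_mult norm_of_nat)
      show ?thesis
        using elim(1) unfolding wz_term_reflect[OF Gamma_nonzero_Re[OF k]] nm e ex by (intro mult_left_mono) auto
    qed
    also have "\<dots> \<le> norm (sin (of_real pi * (3 * z))) * ((real m + 2) * real n) * (2 * real n powr (- 3 - 2 * Re z))"
    proof (intro mult_right_mono mult_left_mono)
      have "real m + 1 \<le> (real m + 1) * real n" using n1 by (simp add: mult_le_cancel_left1)
      thus "real (n + (m + 1)) \<le> (real m + 2) * real n" by (simp add: algebra_simps)
    qed auto
    also have "\<dots> = C * (real n powr 1 * real n powr (- 3 - 2 * Re z))"
      using n1 by (simp add: C_def)
    also have "real n powr 1 * real n powr (- 3 - 2 * Re z) = real n powr (- 2 - 2 * Re z)"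
      by (simp only: powr_add[symmetric]) (simp add: algebra_simps)
    finally show ?case .
  qed
  thus ?thesis by blast
qed

lemma summable_wz_term:
  assumes "Re z > -1/2"
  shows "summable (\<lambda>n. wz_term z (Suc n))"
proof -
  obtain C m where C: "\<forall>\<^sub>F n in sequentially. norm (wz_term z (n + m)) \<le> C * real n powr (- 2 - 2 * Re z)"
    using wz_term_bound by blast
  have "summable (\<lambda>n. wz_term z (n + m))"
    by (rule summable_comparison_test_ev[OF C]) (use assms in \<open>auto simp: summable_real_powr_iff\<close>)
  hence "summable (wz_term z)" by (simp add: summable_iff_shift)
  thus ?thesis by (simp add: summable_Suc_iff)
qed

text \<open>After reflection the Gamma quotient has order n^(-6 - 2 Re z), while
  \<open>wz_poly\<close> has degree 5 in k; the product has a negative exponent for Re z >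
  -1/2.\<close>

lemma wz_mate_tendsto:
  assumes "Re z > -1/2"
  shows "(\<lambda>k. wz_mate z k) \<longlonglongrightarrow> 0"
proof -
  obtain m :: nat where m: "real m > 4 + 3 * norm z" using reals_Archimedean2 by blast
  have Rez: "\<bar>Re z\<bar> \<le> norm z" by (rule abs_Re_le_cmod)
  define a b c d where "a = of_nat m - (3 * z + 3)" "b = of_nat m + z" "c = 3 + of_nat m + 3 * z" "d = of_nat m - z"
  note abcd = this
  have Re: "Re a > 0" "Re b > 0" "Re c > 0" "Re d > 0"
    using m Rez by (auto simp: abcd)
  define E where "E = norm (- 8 * of_real pi ^ 2 * wz_pre z * (sin (of_real pi * (3 * z + 3)) / of_real pi) / (32 * (2 * z + 1)))"
  define A where "A = norm (136 + 1459 * z + 5800 * z ^ 2 + 10872 * z ^ 3 + 9696 * z ^ 4 + 3312 * z ^ 5)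
     + norm (40 + 306 * z + 568 * z ^ 2 + 312 * z ^ 3) + norm z"
  have poly: "norm (wz_poly z (of_real t)) \<le> A * t ^ 5" if "t \<ge> 1" for t :: real
  proof -
    have "norm (wz_poly z (of_real t)) \<le> t * (norm (136 + 1459 * z + 5800 * z ^ 2 + 10872 * z ^ 3 + 9696 * z ^ 4 + 3312 * z ^ 5) * 1
       + norm (40 + 306 * z + 568 * z ^ 2 + 312 * z ^ 3) * t ^ 2 + norm z * t ^ 4)"
      using that unfolding wz_poly_def norm_mult norm_of_real
      by (auto intro!: mult_mono order.trans[OF norm_triangle_ineq4] add_mono simp: norm_mult norm_power)
    also have "\<dots> \<le> t * (norm (136 + 1459 * z + 5800 * z ^ 2 + 10872 * z ^ 3 + 9696 * z ^ 4 + 3312 * z ^ 5) * t ^ 4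
       + norm (40 + 306 * z + 568 * z ^ 2 + 312 * z ^ 3) * t ^ 4 + norm z * t ^ 4)"
      using that by (intro mult_left_mono add_mono power_increasing order.refl) (auto intro: one_le_power)
    also have "\<dots> = A * t ^ 5" by (simp add: A_def algebra_simps eval_nat_numeral)
    finally show ?thesis .
  qed
  define C where "C = E * 2 * (A * (2 * (real m + 2)) ^ 5)"
  have "\<forall>\<^sub>F n in sequentially. norm (wz_mate z (n + (m + 1))) \<le> C * real n powr (- 1 - 2 * Re z)"
    using Gamma_product_bound[OF Re] eventually_gt_at_top[of 0]
  proof eventually_elim
    case (elim n)
    let ?k = "n + (m + 1)"
    have k: "Re (of_nat ?k - (3 * z + 3)) > 0" using m Rez by auto
    have e: "of_nat ?k - (3 * z + 3) = a + of_nat n + 1" "of_nat ?k + z = b + of_nat n + 1"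
      "3 + of_nat ?k + 3 * z = c + of_nat n + 1" "of_nat ?k - z = d + of_nat n + 1"
      by (simp_all add: abcd algebra_simps)
    have ex: "Re a + 2 * Re b - Re c - 2 * Re d = - 6 - 2 * Re z" by (simp add: abcd)
    have n1: "real n \<ge> 1" using elim by simp
    have e0: "3 * z + 4 - of_nat ?k = 1 - (of_nat ?k - (3 * z + 3))" by simp
    have t: "2 * of_nat ?k - 1 = (of_real (2 * real ?k - 1) :: complex)" by simp
    let ?G = "Gamma (a + of_nat n + 1) * Gamma (b + of_nat n + 1) ^ 2 *
      rGamma (c + of_nat n + 1) * rGamma (d + of_nat n + 1) ^ 2"
    have "wz_mate z ?k = - 8 * of_real pi ^ 2 * wz_pre z * ((-1) ^ Suc ?k * rGamma (1 - (of_nat ?k - (3 * z + 3)))) *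
      Gamma (of_nat ?k + z) ^ 2 * rGamma (3 + of_nat ?k + 3 * z) * rGamma (of_nat ?k - z) ^ 2 *
     wz_poly z (2 * of_nat ?k - 1) / (32 * (2 * z + 1))"
      unfolding wz_mate_def e0 by (simp only: mult.assoc)
    also have "\<dots> = (- 8 * of_real pi ^ 2 * wz_pre z * (sin (of_real pi * (3 * z + 3)) / of_real pi) / (32 * (2 * z + 1))) *
       ?G * wz_poly z (of_real (2 * real ?k - 1))"
      unfolding rGamma_reflect_nat[OF Gamma_nonzero_Re[OF k]] unfolding e t
      by (simp only: mult_ac times_divide_eq_right times_divide_eq_left)
    finally have "norm (wz_mate z ?k) = E * norm ?G * norm (wz_poly z (of_real (2 * real ?k - 1)))"
      unfolding E_def by (simp only: norm_mult)
    also have "\<dots> \<le> E * (2 * real n powr (- 6 - 2 * Re z)) * (A * (2 * real ?k - 1) ^ 5)"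
      using elim(1) n1 unfolding ex by (intro mult_mono poly mult_nonneg_nonneg) (auto simp: E_def)
    also have "\<dots> \<le> E * (2 * real n powr (- 6 - 2 * Re z)) * (A * (2 * (real m + 2) * real n) ^ 5)"
    proof (intro mult_left_mono power_mono)
      have "real m + 1 \<le> (real m + 1) * real n" using n1 by (simp add: mult_le_cancel_left1)
      thus "2 * real ?k - 1 \<le> 2 * (real m + 2) * real n" by (simp add: algebra_simps)
    qed (use n1 in \<open>auto simp: A_def E_def\<close>)
    also have "\<dots> = C * (real n powr (- 6 - 2 * Re z) * real n powr 5)"
      using n1 by (simp add: C_def power_mult_distrib)
    also have "real n powr (- 6 - 2 * Re z) * real n powr 5 = real n powr (- 1 - 2 * Re z)"
      by (simp only: powr_add[symmetric]) (simp add: algebra_simps)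
    finally show ?case .
  qed
  moreover have "(\<lambda>n. C * real n powr (- 1 - 2 * Re z)) \<longlonglongrightarrow> 0"
  proof -
    have "(\<lambda>n. real n powr (- 1 - 2 * Re z)) \<longlonglongrightarrow> 0"
      using assms by (intro tendsto_neg_powr filterlim_real_sequentially) auto
    from tendsto_mult_left[OF this, of C] show ?thesis by simp
  qed
  ultimately have "(\<lambda>n. wz_mate z (n + (m + 1))) \<longlonglongrightarrow> 0"
    by (rule Lim_null_comparison)
  thus ?thesis by (rule LIMSEQ_offset)
qed

section \<open>The periodic function\<close>

lemma norm_lin_mono:
  assumes "Re z \<ge> 0" "0 \<le> a" "a \<le> a'" "0 \<le> b" "b \<le> b'"
  shows "norm (of_real a * z + of_real b) \<le> norm (of_real a' * z + of_real b')"
proof -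
  have "(a * Re z + b)\<^sup>2 + (a * Im z)\<^sup>2 \<le> (a' * Re z + b')\<^sup>2 + (a' * Im z)\<^sup>2"
  proof (intro add_mono)
    show "(a * Re z + b)\<^sup>2 \<le> (a' * Re z + b')\<^sup>2"
      using assms by (intro power_mono add_mono mult_right_mono) auto
    show "(a * Im z)\<^sup>2 \<le> (a' * Im z)\<^sup>2"
      unfolding power_mult_distrib using assms by (intro mult_right_mono power_mono) auto
  qed
  thus ?thesis by (simp add: cmod_def)
qed

text \<open>Comparing each linear factor with one in the denominator gives 5/27 < 1/5. A ratio below
  1/2 is what is used afterwards, since the quadratic factor of \<open>f14c\<close> will be paid for
  by 2^n.\<close>

lemma norm_quotT_step:
  assumes "Re z > 0"
  shows "norm (quotT (z + 1)) \<le> 1 / 5 * norm (quotT z)"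
proof -
  have z: "Re z > -1/6" "z \<noteq> 0" using assms by auto
  have Re: "Re z \<ge> 0" using assms by simp
  define x c1 c5 a b d where "x = norm z" "c1 = norm (6*z+1)" "c5 = norm (6*z+5)"
    "a = norm (3*z+1)" "b = norm (3*z+2)" "d = norm (2*z+1)"
  note defs = this
  have pos: "a > 0" "b > 0" "d > 0" using assms by (auto simp: defs complex_eq_iff)
  have xa: "3 * x \<le> a" using norm_lin_mono[OF Re, of 3 3 0 1] by (simp add: defs norm_mult)
  have xb: "3 * x \<le> b" using norm_lin_mono[OF Re, of 3 3 0 2] by (simp add: defs norm_mult)
  have xd: "2 * x \<le> d" using norm_lin_mono[OF Re, of 2 2 0 1] by (simp add: defs norm_mult)
  have c1a: "c1 \<le> 2 * a"
  proof -
    have "norm (6 * z + 1) \<le> norm (6 * z + 2)" using norm_lin_mono[OF Re, of 6 6 1 2] by simp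
    also have "6 * z + 2 = 2 * (3 * z + 1)" by simp
    finally show ?thesis by (simp only: defs norm_mult) simp
  qed
  \<comment> \<open>The coefficient of z is enlarged from 6 to 15/2 so that the right side becomes
    proportional to 3z + 2.\<close>
  have c5b: "c5 \<le> 5/2 * b"
  proof -
    have "norm (6 * z + 5) \<le> norm (of_real (15/2) * z + of_real 5)" using norm_lin_mono[OF Re, of 6 "15/2" 5 5] by simp
    also have "of_real (15/2) * z + of_real 5 = of_real (5/2) * (3 * z + 2)" by (simp add: algebra_simps)
    finally show ?thesis by (simp only: defs norm_mult) simp
  qed
  have "x * x * x * c1 * c5 \<le> (a/3) * (b/3) * (d/2) * (2 * a) * (5/2 * b)"
    using xa xb xd c1a c5b pos by (intro mult_mono mult_nonneg_nonneg) (auto simp: defs)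
  also have "\<dots> = 5/18 * (a^2 * b^2 * d)" by (simp add: power2_eq_square)
  finally have "x * x * x * c1 * c5 \<le> 5/18 * (a^2 * b^2 * d)" .
  moreover have "a^2 * b^2 * d > 0" using pos by simp
  ultimately have "2/3 * (x * x * x * c1 * c5) \<le> 1/5 * (a^2 * b^2 * d)" by linarith
  hence le: "2/3 * x^3 * c1 * c5 / (a^2 * b^2 * d) \<le> 1/5"
    using pos by (simp add: divide_le_eq power3_eq_cube mult_ac)
  have "norm (quotT (z + 1)) = 2/3 * x^3 * c1 * c5 / (a^2 * b^2 * d) * norm (quotT z)"
    unfolding quotT_step[OF z] defs by (simp add: norm_mult norm_divide norm_power)
  also have "\<dots> \<le> 1/5 * norm (quotT z)" using le by (intro mult_right_mono) auto
  finally show ?thesis .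
qed

lemma norm_quotT_shift:
  assumes "Re z > 0"
  shows "norm (quotT (z + of_nat n)) \<le> (1/5) ^ n * norm (quotT z)"
proof (induction n)
  case (Suc n)
  have "norm (quotT (z + of_nat n + 1)) \<le> 1/5 * norm (quotT (z + of_nat n))"
    using assms by (intro norm_quotT_step) auto
  also have "\<dots> \<le> 1/5 * ((1/5) ^ n * norm (quotT z))" using Suc by simp
  finally show ?case by (simp add: add_ac)
qed auto

lemma norm_f14c_le:
  assumes "Re w \<ge> 5/6"
  shows "norm (f14c w) \<le> (1 + norm w) ^ 2 * norm (quotT w)"
proof -
  have "norm (69 * w ^ 2 - 40 * w + 6) \<le> 69 * norm w ^ 2 + 40 * norm w + 6"
    by (rule order.trans[OF norm_triangle_ineq] add_right_mono order.trans[OF norm_triangle_ineq4] |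
        simp add: norm_mult norm_power)+
  also have "\<dots> \<le> 72 * (1 + norm w) ^ 2" by (simp add: power2_eq_square algebra_simps)
  finally have num: "norm (69 * w ^ 2 - 40 * w + 6) \<le> 72 * (1 + norm w) ^ 2" .
  have "4 \<le> Re (6 * w - 1)" using assms by simp
  also have "\<dots> \<le> norm (6 * w - 1)" by (rule complex_Re_le_cmod)
  finally have den: "18 * norm (6 * w - 1) \<ge> 72" by simp
  have "norm (f14c w) = norm (69 * w ^ 2 - 40 * w + 6) * norm (quotT w) / (18 * norm (6 * w - 1))"
    by (simp only: f14c_def norm_mult norm_divide norm_numeral)
  also have "\<dots> \<le> 72 * (1 + norm w) ^ 2 * norm (quotT w) / 72"
    using num den by (intro frac_le mult_right_mono) auto
  finally show ?thesis by simp
qed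

lemma Suc_square_le_pow2: "(real n + 1) ^ 2 \<le> 4 * 2 ^ n"
proof (induction n rule: less_induct)
  case (less n)
  show ?case
  proof (cases "n \<ge> 3")
    case True
    then obtain m where m: "n = Suc m" "m \<ge> 2" by (cases n) auto
    have "(real n + 1) ^ 2 \<le> 2 * (real m + 1) ^ 2"
    proof -
      have "real m * real m \<ge> 2 * 2" using m by (intro mult_mono) auto
      thus ?thesis using m by (simp add: power2_eq_square algebra_simps)
    qed
    also have "\<dots> \<le> 2 * (4 * 2 ^ m)" using less[of m] m by simp
    finally show ?thesis using m by simp
  next
    case False
    hence "n = 0 \<or> n = 1 \<or> n = 2" by auto
    thus ?thesis by auto
  qed
qed

text \<open>The decay is started at z + 1, because Re z itself may be negative here and the step
  estimate asks for a positive real part. The rate 2/5 is (1/5) times 2.\<close>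

lemma norm_f14c_shift:
  assumes "Re z > -1/6"
  shows "norm (f14c (z + of_nat (Suc n))) \<le> 4 * (2 + norm z) ^ 2 * norm (quotT (z + 1)) * (2/5) ^ n"
proof -
  have "norm (f14c (z + of_nat (Suc n))) \<le> (1 + norm (z + of_nat (Suc n))) ^ 2 * norm (quotT (z + of_nat (Suc n)))"
    using assms by (intro norm_f14c_le) auto
  also have "\<dots> \<le> ((2 + norm z) * (real n + 1)) ^ 2 * ((1/5) ^ n * norm (quotT (z + 1)))"
  proof (intro mult_mono power_mono)
    have "norm (z + of_nat (Suc n)) \<le> norm z + real (Suc n)"
      using norm_triangle_ineq[of z "of_nat (Suc n)"] by (simp only: norm_of_nat)
    moreover have "1 + (norm z + real (Suc n)) \<le> (2 + norm z) * (real n + 1)"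
      by (simp add: algebra_simps)
    ultimately show "1 + norm (z + of_nat (Suc n)) \<le> (2 + norm z) * (real n + 1)"
      by linarith
    have "norm (quotT (z + 1 + of_nat n)) \<le> (1/5) ^ n * norm (quotT (z + 1))"
      using assms by (intro norm_quotT_shift) auto
    thus "norm (quotT (z + of_nat (Suc n))) \<le> (1/5) ^ n * norm (quotT (z + 1))"
      by (simp add: add_ac)
  qed auto
  also have "\<dots> = (2 + norm z) ^ 2 * norm (quotT (z + 1)) * ((real n + 1) ^ 2 * (1/5) ^ n)"
    by (simp only: power_mult_distrib mult_ac)
  also have "\<dots> \<le> (2 + norm z) ^ 2 * norm (quotT (z + 1)) * (4 * 2 ^ n * (1/5) ^ n)"
    by (intro mult_left_mono mult_right_mono Suc_square_le_pow2) auto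
  also have "\<dots> = 4 * (2 + norm z) ^ 2 * norm (quotT (z + 1)) * (2/5) ^ n"
    by (simp add: power_divide)
  finally show ?thesis .
qed

section \<open>The sum over integer shifts\<close>

definition f14_sum :: "complex \<Rightarrow> complex" where
  "f14_sum z = (\<Sum>n. f14c (z + of_nat (Suc n)))"

lemma summable_f14c:
  assumes "Re z > -1/6"
  shows "summable (\<lambda>n. norm (f14c (z + of_nat (Suc n))))"
  by (rule summable_comparison_test'[of "\<lambda>n. 4 * (2 + norm z) ^ 2 * norm (quotT (z + 1)) * (2/5) ^ n" 0])
     (use norm_f14c_shift[OF assms] in \<open>auto intro!: summable_mult summable_geometric\<close>)

lemma norm_f14_sum:
  assumes "Re z > -1/6"
  shows "norm (f14_sum z) \<le> 7 * (2 + norm z) ^ 2 * norm (quotT (z + 1))"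
proof -
  have "norm (f14_sum z) \<le> (\<Sum>n. norm (f14c (z + of_nat (Suc n))))"
    unfolding f14_sum_def by (rule summable_norm[OF summable_f14c[OF assms]])
  also have "\<dots> \<le> (\<Sum>n. 4 * (2 + norm z) ^ 2 * norm (quotT (z + 1)) * (2/5) ^ n)"
    by (intro suminf_le norm_f14c_shift assms summable_f14c summable_mult summable_geometric) auto
  also have "\<dots> = 4 * (2 + norm z) ^ 2 * norm (quotT (z + 1)) * (5/3)"
    by (subst suminf_mult) (auto simp: suminf_geometric summable_geometric)
  also have "\<dots> \<le> 7 * (2 + norm z) ^ 2 * norm (quotT (z + 1))"
  proof -
    have "(2 + norm z) ^ 2 * norm (quotT (z + 1)) \<ge> 0" by simp
    thus ?thesis by simp
  qed
  finally show ?thesis .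
qed

lemma f14_sum_step:
  assumes "Re z > -1/6"
  shows "f14_sum z = f14c (z + 1) + f14_sum (z + 1)"
proof -
  have s: "summable (\<lambda>n. f14c (z + of_nat (Suc n)))"
    using summable_f14c[OF assms] by (rule summable_norm_cancel)
  show ?thesis unfolding f14_sum_def
    using suminf_split_head[OF s] by (simp add: add_ac)
qed

section \<open>The corrected sum and its period\<close>

definition wz_sum :: "complex \<Rightarrow> complex" where
  "wz_sum z = (\<Sum>n. wz_term z (Suc n))"

definition wz_total :: "complex \<Rightarrow> complex" where
  "wz_total z = sin (of_real pi * z) ^ 2 * (f14_sum z - z * quotT z / 9)
     + 8 * of_real pi * z * wz_pre z * wz_sum z"

lemma wz_total_regroup:
  fixes A :: complex
  assumes "C - D = - M" "A * (f - z * T0 / 9 + y * T1 / 9) = M" "S0 = f + S1"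
  shows "A * (S1 - y * T1 / 9) + D = A * (S0 - z * T0 / 9) + C"
proof -
  have "A * (S0 - z * T0 / 9) + C - (A * (S1 - y * T1 / 9) + D)
    = A * (f - z * T0 / 9 + y * T1 / 9) + (C - D)" unfolding assms(3) by (simp add: algebra_simps)
  also have "\<dots> = 0" unfolding assms(1,2) by simp
  finally show ?thesis by simp
qed

text \<open>Summing the WZ equation over k >= 1 telescopes to minus the mate at 1, because the mate
  tends to 0. By \<open>wz_boundary\<close> this is the opposite of the change in the sine part
  under z -> z + 1.\<close>

lemma wz_total_periodic:
  assumes z: "Re z > -1/6" "z \<noteq> 0"
  shows "wz_total (z + 1) = wz_total z"
proof -
  let ?c = "8 * of_real pi * z * wz_pre z" and ?d = "8 * of_real pi * (z + 1) * wz_pre (z + 1)"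
  have "(\<lambda>n. ?c * wz_term z (Suc n)) sums (?c * wz_sum z)"
    unfolding wz_sum_def using z by (intro sums_mult summable_sums summable_wz_term) auto
  moreover have "(\<lambda>n. ?d * wz_term (z + 1) (Suc n)) sums (?d * wz_sum (z + 1))"
    unfolding wz_sum_def using z by (intro sums_mult summable_sums summable_wz_term) auto
  ultimately have "(\<lambda>n. ?c * wz_term z (Suc n) - ?d * wz_term (z + 1) (Suc n)) sums
      (?c * wz_sum z - ?d * wz_sum (z + 1))"
    by (rule sums_diff)
  hence "(\<lambda>n. wz_mate z (Suc (Suc n)) - wz_mate z (Suc n)) sums (?c * wz_sum z - ?d * wz_sum (z + 1))"
    using wz_pair[OF z(1)] by simp
  moreover have "(\<lambda>n. wz_mate z (Suc n)) \<longlonglongrightarrow> 0"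
    by (rule LIMSEQ_Suc) (use z wz_mate_tendsto in auto)
  from telescope_sums[OF this] have "(\<lambda>n. wz_mate z (Suc (Suc n)) - wz_mate z (Suc n)) sums (0 - wz_mate z 1)"
    by simp
  ultimately have "?c * wz_sum z - ?d * wz_sum (z + 1) = - wz_mate z 1"
    using sums_unique2 by fastforce
  moreover have "sin (of_real pi * (z + 1)) ^ 2 = sin (of_real pi * z) ^ 2"
    by (simp add: ring_distribs sin_add flip: cos_of_real sin_of_real)
  moreover note wz_boundary[OF z] f14_sum_step[OF z(1)]
  ultimately show ?thesis
    unfolding wz_total_def by (metis wz_total_regroup)
qed

text \<open>Transfers information from the strip around Re z = 5, where growth and holomorphy are
  established, to the neighbourhood of 0, where the expansion takes place.\<close>

lemma wz_total_periodic5: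
  assumes z: "Re z > -1/6" "z \<noteq> 0"
  shows "wz_total (z + of_nat n) = wz_total z"
proof (induction n)
  case (Suc n)
  have "wz_total (z + of_nat n + 1) = wz_total (z + of_nat n)"
  proof (rule wz_total_periodic)
    show "Re (z + of_nat n) > -1/6" using z by simp
    show "z + of_nat n \<noteq> 0"
    proof (cases "n = 0")
      case False
      hence "Re (z + of_nat n) > 0" using z by simp
      thus ?thesis by (metis less_irrefl zero_complex.sel(1))
    qed (use z in auto)
  qed
  thus ?case using Suc by (simp add: add_ac)
qed auto

section \<open>Growth in a vertical strip\<close>

text \<open>Pairing a Gamma value with a reciprocal one of the same |Im| cancels the exponential
  behaviour in the imaginary direction and leaves a quotient of real Gamma values.\<close>

lemma norm_Gamma_rGamma_le:
  assumes "0 < Re p" "Re p \<le> Re q" "\<bar>Im p\<bar> = \<bar>Im q\<bar>"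
  shows "norm (Gamma p) * norm (rGamma q) \<le> Gamma (Re p) / Gamma (Re q)"
proof -
  have le: "norm (Gamma p) \<le> Gamma (Re p) / Gamma (Re q) * norm (Gamma (Complex (Re q) (Im p)))"
    using norm_Gamma_ratio_le[of "Re p" "Re q" "Im p"] assms by simp
  have "norm (Gamma (Complex (Re q) (Im p))) = norm (Gamma q)"
  proof (cases "Im p = Im q")
    case False
    hence "Complex (Re q) (Im p) = cnj q" using assms(3) by (simp add: complex_eq_iff)
    thus ?thesis by (simp flip: cnj_Gamma)
  qed simp
  moreover have "Gamma q \<noteq> 0" using assms by (intro Gamma_nonzero_Re) auto
  ultimately have q: "norm (Gamma (Complex (Re q) (Im p))) = norm (Gamma q)" "norm (Gamma q) > 0" by auto
  have "norm (Gamma p) * norm (rGamma q) \<le> Gamma (Re p) / Gamma (Re q) * norm (Gamma q) * norm (rGamma q)"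
    using le unfolding q(1) by (rule mult_right_mono) auto
  also have "\<dots> = Gamma (Re p) / Gamma (Re q)"
    using q(2) by (simp add: rGamma_inverse_Gamma norm_inverse)
  finally show ?thesis .
qed

lemma norm_sin_pi_le: "norm (sin (of_real pi * w)) \<le> exp (pi * \<bar>Im w\<bar>)"
  using cmod_sin_le_exp[of 1 "of_real pi * w"] by (simp add: abs_mult)

lemma Gamma_real_mono': "3/2 \<le> x \<Longrightarrow> x \<le> y \<Longrightarrow> Gamma x \<le> Gamma (y::real)"
  using Gamma_real_strict_mono[of x y] by (cases "x = y") auto

text \<open>The exponential comes only from sin(3 pi z) in the reflected form. The Gamma factors are
  paired; where the real parts are in the wrong order, the argument is first shifted by 19 or 12
  unit steps. The powers of k add up to 1 + 22 - 25 = -2.\<close>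

lemma norm_wz_term_le:
  assumes z: "4 \<le> Re z" "Re z \<le> 6" and k: "k > 0" and cond: "1 \<le> \<bar>Im z\<bar> \<or> 36 \<le> k"
  shows "norm (wz_term z k) \<le> exp (3 * pi * \<bar>Im z\<bar>) * 12 ^ 19 * (19 + \<bar>Im z\<bar>) ^ 24 * (1 / real k ^ 2)"
proof -
  define K where "K = real k"
  define y where "y = \<bar>Im z\<bar>"
  have K: "K \<ge> 1" using k by (simp add: K_def)
  have y: "y \<ge> 0" by (simp add: y_def)
  define w where "w = of_nat k - 3 * z"
  \<comment> \<open>Keeps k - 3z away from the poles of Gamma: for k >= 36 through the real part,
    since k - 18 >= k/12, and otherwise through 3 |Im z| >= 3 > k/12.\<close>
  have w_bound: "norm (w + of_nat j) \<ge> K / 12" for j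
  proof (cases "36 \<le> k")
    case True
    have "K / 12 \<le> K - 18" using True by (simp add: K_def)
    also have "\<dots> \<le> Re (w + of_nat j)" using z by (simp add: w_def K_def)
    also have "\<dots> \<le> norm (w + of_nat j)" by (rule complex_Re_le_cmod)
    finally show ?thesis .
  next
    case False
    hence "K / 12 \<le> 3" by (simp add: K_def)
    also have "\<dots> \<le> \<bar>Im (w + of_nat j)\<bar>" using cond False by (simp add: w_def abs_mult)
    also have "\<dots> \<le> norm (w + of_nat j)" by (rule abs_Im_le_cmod)
    finally show ?thesis .
  qed
  have w_ni: "w \<notin> \<int>\<^sub>\<le>\<^sub>0"
  proof
    assume "w \<in> \<int>\<^sub>\<le>\<^sub>0"
    then obtain n where "w = - of_nat n" by (auto elim!: nonpos_Ints_cases')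
    hence "w + of_nat n = 0" by simp
    thus False using w_bound[of n] K by simp
  qed
  have Gw: "Gamma w \<noteq> 0" using w_ni by (simp add: Gamma_eq_zero_iff)
  \<comment> \<open>Nineteen steps suffice because Re w >= k - 18; they cost (k/12)^19. Afterwards
    Re (w + 19) <= k + 7, while the reciprocal Gamma has real part at least k + 13, which gains six
    more powers of k.\<close>
  have Gamma_w: "norm (Gamma w) * norm (rGamma (1 + of_nat k + 3 * z)) \<le> 12 ^ 19 / K ^ 25"
  proof -
    have "(K / 12) ^ 19 = (\<Prod>j<19::nat. K / 12)" by simp
    also have "\<dots> \<le> (\<Prod>j<19. norm (w + of_nat j))" using w_bound K by (intro prod_mono) auto
    also have "\<dots> = norm (pochhammer w 19)" by (simp add: pochhammer_prod prod_norm atLeast0LessThan)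
    finally have poch: "(K / 12) ^ 19 \<le> norm (pochhammer w 19)" .
    have pos: "(K / 12) ^ 19 > 0" using K by simp
    have "pochhammer w 19 = Gamma (w + of_nat 19) / Gamma w" by (rule pochhammer_Gamma[OF w_ni])
    hence "Gamma w * pochhammer w 19 = Gamma (w + 19)" using Gw by simp
    hence eq: "norm (Gamma w) * norm (pochhammer w 19) = norm (Gamma (w + 19))" by (metis norm_mult)
    have "norm (Gamma w) * (K / 12) ^ 19 \<le> norm (Gamma (w + 19))"
      unfolding eq[symmetric] using poch by (intro mult_left_mono) auto
    hence 1: "norm (Gamma w) \<le> norm (Gamma (w + 19)) / (K / 12) ^ 19"
      using pos by (simp add: le_divide_eq)
    have "norm (Gamma (w + 19)) * norm (rGamma (1 + of_nat k + 3 * z)) \<le>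
        Gamma (Re (w + 19)) / Gamma (Re (1 + of_nat k + 3 * z))"
      using z by (intro norm_Gamma_rGamma_le) (auto simp: w_def)
    also have "\<dots> \<le> Gamma (K + 7) / Gamma (K + 13)"
      using z K by (intro frac_le Gamma_real_mono') (auto simp: w_def K_def)
    also have "\<dots> \<le> 1 / K ^ 6"
    proof -
      have "K + 7 \<notin> \<int>\<^sub>\<le>\<^sub>0" using K by (auto elim!: nonpos_Ints_cases)
      have g7: "Gamma (K + 7) > 0" using K by auto
      from pochhammer_Gamma[OF \<open>K + 7 \<notin> _\<close>, of 6]
      have p: "Gamma (K + 13) = pochhammer (K + 7) 6 * Gamma (K + 7)"
        using g7 by (simp add: add_ac)
      have "K ^ 6 = (\<Prod>j<6::nat. K)" by simp
      also have "\<dots> \<le> (\<Prod>j<6. K + 7 + real j)" using K by (intro prod_mono) auto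
      also have "\<dots> = pochhammer (K + 7) 6" by (simp add: pochhammer_prod atLeast0LessThan)
      finally have "K ^ 6 \<le> pochhammer (K + 7) 6" .
      moreover have "K ^ 6 > 0" using K by simp
      ultimately have "1 / pochhammer (K + 7) 6 \<le> 1 / K ^ 6" by (intro frac_le) simp_all
      moreover have "Gamma (K + 7) / Gamma (K + 13) = 1 / pochhammer (K + 7) 6"
        unfolding p using g7 by simp
      ultimately show ?thesis by simp
    qed
    finally have 2: "norm (Gamma (w + 19)) * norm (rGamma (1 + of_nat k + 3 * z)) \<le> 1 / K ^ 6" .
    have "norm (Gamma w) * norm (rGamma (1 + of_nat k + 3 * z)) \<le>
        norm (Gamma (w + 19)) / (K / 12) ^ 19 * norm (rGamma (1 + of_nat k + 3 * z))"
      using 1 by (intro mult_right_mono) auto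
    also have "\<dots> = (norm (Gamma (w + 19)) * norm (rGamma (1 + of_nat k + 3 * z))) / (K / 12) ^ 19" by simp
    also have "\<dots> \<le> 1 / K ^ 6 / (K / 12) ^ 19" using 2 pos by (intro divide_right_mono) auto
    also have "\<dots> = 12 ^ 19 / K ^ 25" using K by (simp add: power_divide flip: power_add)
    finally show ?thesis .
  qed
  \<comment> \<open>Twelve steps bring the real part of 1 + k - z to at least k + 7, above that of k
    + z, which is at most k + 6; the gap yields the factor 1/k.\<close>
  have mid: "norm (Gamma (of_nat k + z)) * norm (rGamma (1 + of_nat k - z)) \<le> K ^ 11 * (19 + y) ^ 12"
  proof -
    define u where "u = 1 + of_nat k - z"
    have "norm (pochhammer u 12) = (\<Prod>j<12. norm (u + of_nat j))"
      by (simp add: pochhammer_prod prod_norm atLeast0LessThan)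
    also have "\<dots> \<le> (\<Prod>j<12::nat. K * (19 + y))"
    proof (intro prod_mono conjI)
      fix j assume j: "j \<in> {..<12::nat}"
      have "norm (u + of_nat j) \<le> \<bar>Re (u + of_nat j)\<bar> + \<bar>Im (u + of_nat j)\<bar>" by (rule cmod_le)
      also have "\<dots> \<le> (K + 8) + y" using j z K by (auto simp: u_def y_def K_def)
      also have "\<dots> \<le> K * (19 + y)"
      proof -
        have "1 * y \<le> K * y" "K * 19 \<ge> K + 8" using K y mult_right_mono[of 1 K y] by simp_all
        thus ?thesis by (simp add: algebra_simps)
      qed
      finally show "norm (u + of_nat j) \<le> K * (19 + y)" .
    qed auto
    also have "\<dots> = (K * (19 + y)) ^ 12" by simp
    finally have poch: "norm (pochhammer u 12) \<le> (K * (19 + y)) ^ 12" .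
    have "norm (Gamma (of_nat k + z)) * norm (rGamma (u + 12)) \<le> Gamma (Re (of_nat k + z)) / Gamma (Re (u + 12))"
      using z K by (intro norm_Gamma_rGamma_le) (auto simp: u_def)
    also have "\<dots> \<le> Gamma (K + 6) / Gamma (K + 7)"
      using z K by (intro frac_le Gamma_real_mono') (auto simp: u_def K_def)
    also have "\<dots> \<le> 1 / K"
    proof -
      have "K + 6 \<notin> \<int>\<^sub>\<le>\<^sub>0" using K by (auto elim!: nonpos_Ints_cases)
      from Gamma_plus1[OF this] have p: "Gamma (K + 7) = (K + 6) * Gamma (K + 6)" by (simp add: add_ac)
      have "Gamma (K + 6) > 0" using K by auto
      thus ?thesis unfolding p using K by (simp add: divide_simps)
    qed
    finally have 2: "norm (Gamma (of_nat k + z)) * norm (rGamma (u + 12)) \<le> 1 / K" .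
    have "norm (Gamma (of_nat k + z)) * norm (rGamma u) =
        norm (pochhammer u 12) * (norm (Gamma (of_nat k + z)) * norm (rGamma (u + 12)))"
      by (subst pochhammer_rGamma[of u 12]) (simp add: norm_mult)
    also have "\<dots> \<le> (K * (19 + y)) ^ 12 * (1 / K)"
      using poch 2 by (intro mult_mono) auto
    also have "\<dots> = K ^ 11 * (19 + y) ^ 12" using K by (simp add: power_mult_distrib eval_nat_numeral)
    finally show ?thesis unfolding u_def .
  qed
  have "norm (wz_term z k) = norm (sin (of_real pi * (3 * z))) * K *
      ((norm (Gamma w) * norm (rGamma (1 + of_nat k + 3 * z))) *
       (norm (Gamma (of_nat k + z)) * norm (rGamma (1 + of_nat k - z))) ^ 2)"
    unfolding wz_term_reflect[OF Gw[unfolded w_def]]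
    by (simp only: norm_mult norm_of_nat norm_power K_def w_def power_mult_distrib mult_ac)
  also have "\<dots> \<le> exp (pi * \<bar>Im (3 * z)\<bar>) * K * ((12 ^ 19 / K ^ 25) * (K ^ 11 * (19 + y) ^ 12) ^ 2)"
    using K y by (intro mult_mono power_mono Gamma_w mid norm_sin_pi_le mult_nonneg_nonneg) auto
  also have "\<dots> = exp (3 * pi * y) * 12 ^ 19 * (19 + y) ^ 24 * (K * K ^ 22 / K ^ 25)"
    by (simp add: y_def abs_mult power_mult_distrib flip: power_mult)
  also have "K * K ^ 22 / K ^ 25 = 1 / K ^ 2"
    using K by (simp add: divide_simps flip: power_Suc power_add)
  finally show ?thesis unfolding y_def K_def .
qed

lemma summable_inverse_squares_Suc: "summable (\<lambda>n. 1 / real (Suc n) ^ 2)"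
  using inverse_squares_sums by (simp add: sums_iff add.commute)

lemma norm_wz_sum_le:
  assumes z: "4 \<le> Re z" "Re z \<le> 6" "1 \<le> \<bar>Im z\<bar>"
  shows "norm (wz_sum z) \<le> exp (3 * pi * \<bar>Im z\<bar>) * 12 ^ 19 * (19 + \<bar>Im z\<bar>) ^ 24 * (\<Sum>n. 1 / real (Suc n) ^ 2)"
proof -
  let ?C = "exp (3 * pi * \<bar>Im z\<bar>) * 12 ^ 19 * (19 + \<bar>Im z\<bar>) ^ 24"
  have le: "norm (wz_term z (Suc n)) \<le> ?C * (1 / real (Suc n) ^ 2)" for n
    using z by (intro norm_wz_term_le) auto
  have sm: "summable (\<lambda>n. ?C * (1 / real (Suc n) ^ 2))"
    by (intro summable_mult summable_inverse_squares_Suc)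
  have "norm (wz_sum z) \<le> (\<Sum>n. ?C * (1 / real (Suc n) ^ 2))"
    unfolding wz_sum_def using le sm by (rule norm_suminf_le)
  also have "\<dots> = ?C * (\<Sum>n. 1 / real (Suc n) ^ 2)"
    by (rule suminf_mult[OF summable_inverse_squares_Suc])
  finally show ?thesis .
qed

text \<open>On the line Re w = 1/2 the number 1 - w is the conjugate of w, so reflection gives
  |Gamma(w)|^2 = pi / cosh(pi t) exactly.\<close>

lemma norm_Gamma_half:
  shows "norm (Gamma (Complex (1/2) t)) \<le> 3 * exp (- pi / 2 * \<bar>t\<bar>)"
    and "sqrt pi * exp (- pi / 2 * \<bar>t\<bar>) \<le> norm (Gamma (Complex (1/2) t))"
proof -
  let ?w = "Complex (1/2) t"
  have "1 - ?w = cnj ?w" by (simp add: complex_eq_iff)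
  hence "Gamma ?w * cnj (Gamma ?w) = of_real pi / sin (of_real pi * ?w)"
    using Gamma_reflection_complex[of ?w] by (simp add: cnj_Gamma)
  hence 1: "norm (Gamma ?w) ^ 2 = pi / norm (sin (of_real pi * ?w))"
    by (metis complex_mod_cnj norm_divide norm_mult norm_of_real power2_eq_square abs_of_pos pi_gt_zero)
  have e: "of_real pi * ?w = of_real (pi/2) + \<i> * of_real (pi * t)" by (simp add: complex_eq_iff)
  have "sin (of_real pi * ?w) = cos (\<i> * of_real (pi * t))"
    unfolding e by (simp only: sin_add sin_of_real cos_of_real sin_pi_half cos_pi_half) simp
  also have "\<dots> = cosh (of_real (pi * t))" by (rule cosh_conv_cos[symmetric])
  also have "\<dots> = of_real (cosh (pi * t))"
    by (simp add: cosh_field_def flip: exp_of_real)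
  finally have "sin (of_real pi * ?w) = of_real (cosh (pi * t))" .
  hence sq: "norm (Gamma ?w) ^ 2 = pi / cosh (pi * t)" using 1 by simp
  have ch: "cosh (pi * t) = (exp (pi * \<bar>t\<bar>) + exp (- (pi * \<bar>t\<bar>))) / 2"
    by (cases "t \<ge> 0") (auto simp: cosh_def)
  have ex: "exp (- pi / 2 * \<bar>t\<bar>) ^ 2 = 1 / exp (pi * \<bar>t\<bar>)"
    by (simp add: power2_eq_square exp_minus inverse_eq_divide flip: exp_add)
  have c1: "cosh (pi * t) \<le> exp (pi * \<bar>t\<bar>)"
  proof -
    have "exp (- (pi * \<bar>t\<bar>)) \<le> exp (pi * \<bar>t\<bar>)" by simp
    thus ?thesis unfolding ch by simp
  qed
  have c2: "cosh (pi * t) \<ge> exp (pi * \<bar>t\<bar>) / 2" unfolding ch by simp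
  show "norm (Gamma ?w) \<le> 3 * exp (- pi / 2 * \<bar>t\<bar>)"
  proof (rule power2_le_imp_le)
    have "pi / cosh (pi * t) \<le> pi / (exp (pi * \<bar>t\<bar>) / 2)" using c2 by (intro divide_left_mono mult_pos_pos) (auto simp: add_pos_pos)
    also have "\<dots> \<le> 9 * (1 / exp (pi * \<bar>t\<bar>))" using pi_less_4 by (simp add: divide_right_mono)
    finally show "norm (Gamma ?w) ^ 2 \<le> (3 * exp (- pi / 2 * \<bar>t\<bar>)) ^ 2"
      unfolding sq power_mult_distrib ex by simp
  qed auto
  show "sqrt pi * exp (- pi / 2 * \<bar>t\<bar>) \<le> norm (Gamma ?w)"
  proof (rule power2_le_imp_le)
    have "pi * (1 / exp (pi * \<bar>t\<bar>)) \<le> pi / cosh (pi * t)" using c1 by (simp add: divide_left_mono)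
    thus "(sqrt pi * exp (- pi / 2 * \<bar>t\<bar>)) ^ 2 \<le> norm (Gamma ?w) ^ 2"
      unfolding sq power_mult_distrib ex by simp
  qed auto
qed

text \<open>Comparison with the line Re w = 1/2. The real quotient Gamma(1/2)/Gamma(Re w) is at most
  sqrt pi and cancels the constant in the lower bound on that line.\<close>

lemma norm_rGamma_strip:
  assumes "2 \<le> Re w"
  shows "norm (rGamma w) \<le> exp (pi / 2 * \<bar>Im w\<bar>)"
proof -
  have G2: "Gamma (2::real) = 1" using Gamma_fact[of 1, where 'a = real] by simp
  have "Gamma (Re w) \<ge> 1" using Gamma_real_mono'[of 2 "Re w"] assms G2 by simp
  have "norm (Gamma (Complex (1/2) (Im w))) \<le> Gamma (1/2) / Gamma (Re w) * norm (Gamma w)"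
    using norm_Gamma_ratio_le[of "1/2" "Re w" "Im w"] assms by simp
  also have "\<dots> \<le> sqrt pi * norm (Gamma w)"
    using \<open>Gamma (Re w) \<ge> 1\<close> by (intro mult_right_mono) (auto simp: Gamma_one_half_real divide_le_eq)
  finally have "sqrt pi * exp (- pi / 2 * \<bar>Im w\<bar>) \<le> sqrt pi * norm (Gamma w)"
    using norm_Gamma_half(2)[of "Im w"] by linarith
  hence "exp (- pi / 2 * \<bar>Im w\<bar>) \<le> norm (Gamma w)" by simp
  hence "inverse (norm (Gamma w)) \<le> inverse (exp (- pi / 2 * \<bar>Im w\<bar>))" by (intro le_imp_inverse_le) auto
  thus ?thesis by (simp add: rGamma_inverse_Gamma norm_inverse exp_minus[symmetric])
qed

text \<open>The point is moved right to real part 43 + 1/2, where the monotone ratio applies, then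
  back to 1/2 by 43 functional equations with a polynomial cost. The range up to 42 accommodates 6w
  for Re w <= 7.\<close>

lemma norm_Gamma_strip:
  assumes "2 \<le> Re w" "Re w \<le> 42" "\<bar>Im w\<bar> \<le> 6 * y"
  shows "norm (Gamma w) \<le> 3 * (43 + 6 * y) ^ 43 * exp (- pi / 2 * \<bar>Im w\<bar>)"
proof -
  let ?h = "Complex (1/2) (Im w)"
  have "norm (Gamma w) \<le> Gamma (Re w) / Gamma (43 + 1/2) * norm (Gamma (Complex (43 + 1/2) (Im w)))"
    using norm_Gamma_ratio_le[of "Re w" "43 + 1/2" "Im w"] assms by simp
  also have "\<dots> \<le> 1 * norm (Gamma (Complex (43 + 1/2) (Im w)))"
    using Gamma_real_mono'[of "Re w" "43 + 1/2"] assms by (intro mult_right_mono) (auto simp: divide_le_eq_1)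
  also have "Complex (43 + 1/2) (Im w) = ?h + of_nat 43" by (simp add: complex_eq_iff)
  also have "Gamma (?h + of_nat 43) = pochhammer ?h 43 * Gamma ?h"
  proof -
    have "?h \<notin> \<int>\<^sub>\<le>\<^sub>0" by (auto elim!: nonpos_Ints_cases simp: complex_eq_iff)
    from pochhammer_Gamma[OF this, of 43] this show ?thesis by (simp add: Gamma_eq_zero_iff)
  qed
  also have "1 * norm (pochhammer ?h 43 * Gamma ?h) \<le> (43 + 6 * y) ^ 43 * (3 * exp (- pi / 2 * \<bar>Im w\<bar>))"
    unfolding mult_1 norm_mult
  proof (intro mult_mono norm_Gamma_half)
    have "norm (pochhammer ?h 43) = (\<Prod>j<43. norm (?h + of_nat j))"
      by (simp add: pochhammer_prod prod_norm atLeast0LessThan)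
    also have "\<dots> \<le> (\<Prod>j<43::nat. 43 + 6 * y)"
    proof (intro prod_mono conjI)
      fix j assume j: "j \<in> {..<43::nat}"
      have "norm (?h + of_nat j) \<le> \<bar>Re (?h + of_nat j)\<bar> + \<bar>Im (?h + of_nat j)\<bar>" by (rule cmod_le)
      also have "\<dots> \<le> 43 + 6 * y" using j assms(3) by auto
      finally show "norm (?h + of_nat j) \<le> 43 + 6 * y" .
    qed auto
    finally show "norm (pochhammer ?h 43) \<le> (43 + 6 * y) ^ 43" by simp
  qed (use assms(3) in auto)
  finally show ?thesis by (simp add: mult_ac)
qed

text \<open>In units of pi |Im w| / 2 the exponents are -6 - 7 + 3 * 3 + 2 * 2 = 0, so only
  polynomial growth is left: eight Gamma factors of degree 43 give 344.\<close>

lemma norm_quotT_strip: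
  assumes w: "2 \<le> Re w" "Re w \<le> 7"
  shows "norm (quotT w) \<le> 3 ^ 8 * (43 + 6 * \<bar>Im w\<bar>) ^ 344"
proof -
  define y where "y = \<bar>Im w\<bar>"
  define P where "P = (43 + 6 * y) ^ 43"
  define e where "e = (\<lambda>c. exp (c * (pi / 2 * y)))"
  have P: "P \<ge> 0" by (simp add: P_def y_def)
  have e_add: "e a * e b = e (a + b)" for a b by (simp add: e_def ring_distribs flip: exp_add)
  have e_pow: "e a ^ n = e (real n * a)" for a n by (simp add: e_def mult_ac flip: exp_of_nat_mult)
  have e0: "e a \<ge> 0" for a by (simp add: e_def)
  have 6: "norm (Gamma (6 * w)) \<le> 3 * P * e (- 6)"
    using norm_Gamma_strip[of "6 * w" y] w by (simp add: P_def e_def y_def abs_mult mult_ac)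
  have 1: "norm (Gamma w) \<le> 3 * P * e (- 1)"
    using norm_Gamma_strip[of w y] w by (simp add: P_def e_def y_def abs_mult mult_ac)
  have 3: "norm (rGamma (3 * w)) \<le> e 3"
    using norm_rGamma_strip[of "3 * w"] w by (simp add: e_def y_def abs_mult mult_ac)
  have 2: "norm (rGamma (2 * w)) \<le> e 2"
    using norm_rGamma_strip[of "2 * w"] w by (simp add: e_def y_def abs_mult mult_ac)
  have "norm (quotT w) = norm (Gamma (6 * w)) * norm (Gamma w) ^ 7 * (norm (rGamma (3 * w)) ^ 3 * norm (rGamma (2 * w)) ^ 2)"
    unfolding quotT_def rGamma_inverse_Gamma
    by (simp add: norm_mult norm_divide norm_power norm_inverse field_simps)
  also have "\<dots> \<le> (3 * P * e (- 6)) * (3 * P * e (- 1)) ^ 7 * (e 3 ^ 3 * e 2 ^ 2)"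
    using P e0 by (intro mult_mono power_mono 6 1 3 2 mult_nonneg_nonneg zero_le_power) auto
  also have "\<dots> = 3 ^ 8 * P ^ 8 * (e (- 6) * e (- 1) ^ 7 * (e 3 ^ 3 * e 2 ^ 2))"
    by (simp add: power_mult_distrib eval_nat_numeral)
  also have "e (- 6) * e (- 1) ^ 7 * (e 3 ^ 3 * e 2 ^ 2) = 1"
    by (simp add: e_pow e_add) (simp add: e_def)
  also have "P ^ 8 = (43 + 6 * y) ^ 344" by (simp add: P_def flip: power_mult)
  finally show ?thesis by (simp add: y_def)
qed

text \<open>The same count gives -6 - 3 + 3 + 2 * 2 = -2 units, that is exp(-pi |Im w|), with four
  Gamma factors of degree 43.\<close>

lemma norm_wz_pre_strip:
  assumes w: "4 \<le> Re w" "Re w \<le> 6"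
  shows "norm (wz_pre w) \<le> 3 ^ 4 * (43 + 6 * \<bar>Im w\<bar>) ^ 172 * exp (- pi * \<bar>Im w\<bar>)"
proof -
  define y where "y = \<bar>Im w\<bar>"
  define P where "P = (43 + 6 * y) ^ 43"
  define e where "e = (\<lambda>c. exp (c * (pi / 2 * y)))"
  have P: "P \<ge> 0" by (simp add: P_def y_def)
  have e_add: "e a * e b = e (a + b)" for a b by (simp add: e_def ring_distribs flip: exp_add)
  have e_pow: "e a ^ n = e (real n * a)" for a n by (simp add: e_def mult_ac flip: exp_of_nat_mult)
  have e0: "e a \<ge> 0" for a by (simp add: e_def)
  have 6: "norm (Gamma (1 + 6 * w)) \<le> 3 * P * e (- 6)"
    using norm_Gamma_strip[of "1 + 6 * w" y] w by (simp add: P_def e_def y_def abs_mult mult_ac)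
  have 1: "norm (Gamma (1 + w)) \<le> 3 * P * e (- 1)"
    using norm_Gamma_strip[of "1 + w" y] w by (simp add: P_def e_def y_def abs_mult mult_ac)
  have 3: "norm (rGamma (1 + 3 * w)) \<le> e 3"
    using norm_rGamma_strip[of "1 + 3 * w"] w by (simp add: e_def y_def abs_mult mult_ac)
  have 2: "norm (rGamma (1 + 2 * w)) \<le> e 2"
    using norm_rGamma_strip[of "1 + 2 * w"] w by (simp add: e_def y_def abs_mult mult_ac)
  have "norm (wz_pre w) = norm (Gamma (1 + 6 * w)) * norm (Gamma (1 + w)) ^ 3 * (norm (rGamma (1 + 3 * w)) * norm (rGamma (1 + 2 * w)) ^ 2)"
    unfolding wz_pre_def by (simp add: norm_mult norm_power)
  also have "\<dots> \<le> (3 * P * e (- 6)) * (3 * P * e (- 1)) ^ 3 * (e 3 * e 2 ^ 2)"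
    using P e0 by (intro mult_mono power_mono 6 1 3 2 mult_nonneg_nonneg zero_le_power) auto
  also have "\<dots> = 3 ^ 4 * P ^ 4 * (e (- 6) * e (- 1) ^ 3 * (e 3 * e 2 ^ 2))"
    by (simp add: power_mult_distrib eval_nat_numeral)
  also have "e (- 6) * e (- 1) ^ 3 * (e 3 * e 2 ^ 2) = exp (- pi * y)"
    by (simp add: e_pow e_add) (simp add: e_def)
  also have "P ^ 4 = (43 + 6 * y) ^ 172" by (simp add: P_def flip: power_mult)
  finally show ?thesis by (simp add: y_def)
qed

lemma power_le_fact_exp: "x \<ge> 0 \<Longrightarrow> x ^ n \<le> fact n * exp (x::real)"
proof -
  assume x: "x \<ge> 0"
  have "(\<Sum>k\<in>{n}. x ^ k /\<^sub>R fact k) \<le> (\<Sum>k. x ^ k /\<^sub>R fact k)"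
    using x by (intro sum_le_suminf summable_exp_generic) auto
  hence "x ^ n / fact n \<le> exp x" by (simp add: exp_def divide_inverse mult.commute)
  thus ?thesis by (simp add: divide_le_eq mult.commute)
qed

text \<open>The decay exp(-pi |Im z|) of \<open>wz_pre\<close> reduces the rate 3 pi of
  \<open>wz_sum\<close> to 2 pi, the rate of the squared sine. The polynomial factor, of degree at
  most 344 + 2, is then absorbed by a further exp(pi |Im z|).\<close>

lemma wz_total_growth:
  "\<exists>C\<ge>0. \<forall>z. 4 \<le> Re z \<and> Re z \<le> 6 \<and> 1 \<le> \<bar>Im z\<bar> \<longrightarrow> norm (wz_total z) \<le> C * exp (3 * pi * \<bar>Im z\<bar>)"
proof -
  define K where "K = (\<Sum>n. 1 / real (Suc n) ^ 2)"
  have K: "K \<ge> 0" unfolding K_def by (intro suminf_nonneg summable_inverse_squares_Suc) auto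
  define C1 where "C1 = (7 * 3 ^ 8 + 3 ^ 8 + 8 * pi * 3 ^ 4 * 12 ^ 19 * K :: real)"
  have C1: "C1 \<ge> 0" using K by (simp add: C1_def)
  define N :: nat where "N = 346"
  define Q :: real where "Q = 2 ^ N * fact N * exp 22"
  have Q: "Q \<ge> 0" unfolding Q_def by (intro mult_nonneg_nonneg zero_le_power fact_ge_zero exp_ge_zero) simp
  define C where "C = C1 * Q"
  have "norm (wz_total z) \<le> C * exp (3 * pi * \<bar>Im z\<bar>)" if z: "4 \<le> Re z" "Re z \<le> 6" "1 \<le> \<bar>Im z\<bar>" for z
  proof -
    define y where "y = \<bar>Im z\<bar>"
    define P where "P = 43 + 6 * y"
    have y: "y \<ge> 1" using z by (simp add: y_def)
    have P: "P \<ge> 1" "y \<le> P" "2 + norm z \<le> P" "norm z \<le> P" "19 + y \<le> P"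
      using y z cmod_le[of z] by (auto simp: P_def y_def)
    have sin2: "norm (sin (of_real pi * z) ^ 2) \<le> exp (2 * pi * y)"
    proof -
      have "norm (sin (of_real pi * z) ^ 2) \<le> exp (pi * y) ^ 2"
        unfolding norm_power y_def by (intro power_mono norm_sin_pi_le) auto
      thus ?thesis by (simp add: power2_eq_square mult.assoc flip: exp_add)
    qed
    have S: "norm (f14_sum z) \<le> 7 * 3 ^ 8 * P ^ 346"
    proof -
      have "norm (f14_sum z) \<le> 7 * (2 + norm z) ^ 2 * norm (quotT (z + 1))" using z by (intro norm_f14_sum) auto
      also have "\<dots> \<le> 7 * P ^ 2 * (3 ^ 8 * P ^ 344)"
        using P norm_quotT_strip[of "z + 1"] z
        by (intro mult_mono power_mono) (auto simp: P_def y_def)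
      also have "\<dots> = 7 * 3 ^ 8 * P ^ 346" by (simp flip: power_add)
      finally show ?thesis .
    qed
    have T: "norm (z * quotT z / 9) \<le> 3 ^ 8 * P ^ 346"
    proof -
      have "norm (z * quotT z / 9) \<le> norm z * norm (quotT z)" by (simp add: norm_mult norm_divide)
      also have "\<dots> \<le> P * (3 ^ 8 * P ^ 344)"
        using P norm_quotT_strip[of z] z by (intro mult_mono) (auto simp: P_def y_def)
      also have "\<dots> = 3 ^ 8 * P ^ 345" by (simp flip: power_Suc)
      also have "\<dots> \<le> 3 ^ 8 * P ^ 346" using P by (intro mult_left_mono power_increasing) auto
      finally show ?thesis .
    qed
    have V: "norm (8 * of_real pi * z * wz_pre z * wz_sum z) \<le> 8 * pi * 3 ^ 4 * 12 ^ 19 * K * P ^ 346 * exp (2 * pi * y)"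
    proof -
      have "norm (8 * of_real pi * z * wz_pre z * wz_sum z) = 8 * pi * norm z * norm (wz_pre z) * norm (wz_sum z)"
        by (simp add: norm_mult)
      also have "\<dots> \<le> 8 * pi * P * (3 ^ 4 * P ^ 172 * exp (- pi * y)) * (exp (3 * pi * y) * 12 ^ 19 * P ^ 24 * K)"
      proof (intro mult_mono mult_nonneg_nonneg)
        show "norm (wz_pre z) \<le> 3 ^ 4 * P ^ 172 * exp (- pi * y)"
          using norm_wz_pre_strip[of z] z by (simp add: P_def y_def)
        have "norm (wz_sum z) \<le> exp (3 * pi * y) * 12 ^ 19 * (19 + y) ^ 24 * K"
          using norm_wz_sum_le[of z] z by (simp only: y_def K_def)
        also have "\<dots> \<le> exp (3 * pi * y) * 12 ^ 19 * P ^ 24 * K"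
          using P K y by (intro mult_mono power_mono) auto
        finally show "norm (wz_sum z) \<le> exp (3 * pi * y) * 12 ^ 19 * P ^ 24 * K" .
      qed (use P K in auto)
      also have "\<dots> = 8 * pi * 3 ^ 4 * 12 ^ 19 * K * (P * P ^ 172 * P ^ 24) * (exp (- pi * y) * exp (3 * pi * y))"
        by (simp only: mult_ac)
      also have "exp (- pi * y) * exp (3 * pi * y) = exp (2 * pi * y)"
        by (simp add: algebra_simps flip: exp_add)
      also have "P * P ^ 172 * P ^ 24 = P ^ 197" by (simp flip: power_Suc power_add)
      also have "8 * pi * 3 ^ 4 * 12 ^ 19 * K * P ^ 197 * exp (2 * pi * y) \<le>
          8 * pi * 3 ^ 4 * 12 ^ 19 * K * P ^ 346 * exp (2 * pi * y)"
        using P K by (intro mult_right_mono mult_left_mono power_increasing) auto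
      finally show ?thesis .
    qed
    have t: "norm (f14_sum z - z * quotT z / 9) \<le> norm (f14_sum z) + norm (z * quotT z / 9)"
      by (rule norm_triangle_ineq4)
    have "norm (wz_total z) \<le> norm (sin (of_real pi * z) ^ 2 * (f14_sum z - z * quotT z / 9))
        + norm (8 * of_real pi * z * wz_pre z * wz_sum z)"
      unfolding wz_total_def by (rule norm_triangle_ineq)
    also have "\<dots> \<le> norm (sin (of_real pi * z) ^ 2) * (norm (f14_sum z) + norm (z * quotT z / 9))
        + norm (8 * of_real pi * z * wz_pre z * wz_sum z)"
      unfolding norm_mult[of "sin _ ^ 2"] using t by (intro add_right_mono mult_left_mono) auto
    also have "\<dots> \<le> exp (2 * pi * y) * (7 * 3 ^ 8 * P ^ 346 + 3 ^ 8 * P ^ 346)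
        + 8 * pi * 3 ^ 4 * 12 ^ 19 * K * P ^ 346 * exp (2 * pi * y)"
      using P by (intro add_mono mult_mono sin2 S T V) auto
    also have "\<dots> = C1 * P ^ N * exp (2 * pi * y)" by (simp only: C1_def N_def ring_distribs mult_ac)
    also have "\<dots> \<le> C1 * (Q * exp (pi * y)) * exp (2 * pi * y)"
    proof (intro mult_right_mono mult_left_mono)
      \<comment> \<open>P/2 = 43/2 + 3y is at most 22 + pi y because pi > 3, which explains the
        constants in \<open>Q\<close>.\<close>
      have "(P / 2) ^ N \<le> fact N * exp (P / 2)" using P by (intro power_le_fact_exp) auto
      also have "exp (P / 2) \<le> exp (22 + pi * y)"
      proof -
        have "3 * y \<le> pi * y" using y pi_gt3 by (intro mult_right_mono) auto
        thus ?thesis by (simp add: P_def)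
      qed
      finally have "(P / 2) ^ N \<le> fact N * (exp 22 * exp (pi * y))" by (simp add: exp_add)
      hence "2 ^ N * (P / 2) ^ N \<le> 2 ^ N * (fact N * (exp 22 * exp (pi * y)))" by (intro mult_left_mono) auto
      moreover have "2 ^ N * (P / 2) ^ N = P ^ N" by (simp add: power_divide)
      ultimately show "P ^ N \<le> Q * exp (pi * y)" by (simp only: mult.assoc Q_def)
    qed (use C1 in auto)
    also have "\<dots> = C * (exp (pi * y) * exp (2 * pi * y))" by (simp only: C_def mult_ac)
    also have "exp (pi * y) * exp (2 * pi * y) = exp (3 * pi * y)" by (simp add: algebra_simps flip: exp_add)
    finally show ?thesis by (simp add: y_def)
  qed
  moreover have "C \<ge> 0" unfolding C_def using C1 Q by (rule mult_nonneg_nonneg)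
  ultimately show ?thesis by blast
qed

section \<open>Determination of the periodic function\<close>

text \<open>Weierstrass's test with a bound that may grow with z through the continuous
  \<open>B\<close>, made uniform on compact discs. The bound is asked only eventually in n, since
  the first WZ terms escape the estimate near the real axis.\<close>

lemma holomorphic_series:
  fixes f :: "nat \<Rightarrow> complex \<Rightarrow> complex"
  assumes "open S" "\<And>n. f n holomorphic_on S"
    and bound: "\<And>z. z \<in> S \<Longrightarrow> continuous_on S B \<and> summable M \<and>
      (\<forall>\<^sub>F n in sequentially. \<forall>z\<in>S. norm (f n z) \<le> B z * M n)" and M: "\<And>n. M n \<ge> (0 :: real)"
  shows "(\<lambda>z. \<Sum>n. f n z) holomorphic_on S"
proof (rule holomorphic_uniform_sequence[where f = "\<lambda>N z. \<Sum>n<N. f n z"])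
  fix z assume z: "z \<in> S"
  obtain d where d: "d > 0" "cball z d \<subseteq> S" using assms(1) z open_contains_cball by blast
  note B = bound[OF z, THEN conjunct1] and sm = bound[OF z, THEN conjunct2, THEN conjunct1]
    and ev = bound[OF z, THEN conjunct2, THEN conjunct2]
  have "compact (B ` cball z d)"
    by (rule compact_continuous_image[OF continuous_on_subset[OF B d(2)] compact_cball])
  hence "bdd_above (B ` cball z d)" by (intro bounded_imp_bdd_above compact_imp_bounded)
  then obtain C where "\<forall>x\<in>B ` cball z d. x \<le> C" unfolding bdd_above_def by (elim exE)
  hence C: "B w \<le> C" if "w \<in> cball z d" for w using that by simp
  have "uniform_limit (cball z d) (\<lambda>N z. \<Sum>n<N. f n z) (\<lambda>z. \<Sum>n. f n z) sequentially"
  proof (rule Weierstrass_m_test_ev)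
    show "\<forall>\<^sub>F n in sequentially. \<forall>w\<in>cball z d. norm (f n w) \<le> C * M n"
      using ev
    proof eventually_elim
      case (elim n)
      show ?case
      proof
        fix w assume w: "w \<in> cball z d"
        have "norm (f n w) \<le> B w * M n" using elim w d(2) by blast
        also have "\<dots> \<le> C * M n" using C[OF w] M by (rule mult_right_mono)
        finally show "norm (f n w) \<le> C * M n" .
      qed
    qed
    show "summable (\<lambda>n. C * M n)" using sm by (rule summable_mult)
  qed
  thus "\<exists>d>0. cball z d \<subseteq> S \<and> uniform_limit (cball z d) (\<lambda>N z. \<Sum>n<N. f n z) (\<lambda>z. \<Sum>n. f n z) sequentially"
    using d by blast
next
  show "open S" by (rule assms(1))
  show "(\<lambda>z. \<Sum>n<N. f n z) holomorphic_on S" for N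
    by (rule holomorphic_on_sum) (rule assms(2))
qed

section \<open>Holomorphy of the constituents\<close>

lemma not_nonpos_Ints_Re: "Re w > 0 \<Longrightarrow> w \<notin> \<int>\<^sub>\<le>\<^sub>0"
  by (auto elim!: nonpos_Ints_cases)

lemma open_Re_gt: "open {z. Re z > a}"
  by (rule open_halfspace_Re_gt)

lemma holomorphic_quotT: "S \<subseteq> {z. Re z > 0} \<Longrightarrow> quotT holomorphic_on S"
proof -
  assume S: "S \<subseteq> {z. Re z > 0}"
  hence p: "Re z > 0" if "z \<in> S" for z using that by auto
  show ?thesis unfolding quotT_def[abs_def]
    by (intro holomorphic_intros not_nonpos_Ints_Re) (auto simp: Gamma_nonzero_Re p)
qed

lemma holomorphic_f14c: "S \<subseteq> {z. Re z > 1/6} \<Longrightarrow> f14c holomorphic_on S"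
proof -
  assume S: "S \<subseteq> {z. Re z > 1/6}"
  have "6 * z - 1 \<noteq> 0" if "z \<in> S" for z
  proof
    assume "6 * z - 1 = 0"
    from arg_cong[OF this, of Re] S that show False by auto
  qed
  thus ?thesis using S unfolding f14c_def[abs_def]
    by (intro holomorphic_intros holomorphic_quotT) auto
qed

lemma holomorphic_f14_sum: "f14_sum holomorphic_on {z. Re z > -1/6}"
  unfolding f14_sum_def[abs_def]
proof (rule holomorphic_series[where M = "\<lambda>n. (2/5) ^ n" and B = "\<lambda>z. 4 * (2 + norm z) ^ 2 * norm (quotT (z + 1))"])
  show "open {z. Re z > -1/6}" by (rule open_Re_gt)
  show "(\<lambda>z. f14c (z + of_nat (Suc n))) holomorphic_on {z. Re z > -1/6}" for n
  proof -
    have "(f14c \<circ> (\<lambda>z. z + of_nat (Suc n))) holomorphic_on {z. Re z > -1/6}"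
      by (intro holomorphic_on_compose holomorphic_intros holomorphic_f14c) auto
    thus ?thesis by (simp add: o_def)
  qed
  have "(quotT \<circ> (\<lambda>z. z + 1)) holomorphic_on {z. Re z > -1/6}"
    by (intro holomorphic_on_compose holomorphic_intros holomorphic_quotT) auto
  hence "continuous_on {z. Re z > -1/6} (\<lambda>z. quotT (z + 1))"
    by (auto dest: holomorphic_on_imp_continuous_on simp: o_def)
  hence "continuous_on {z. Re z > -1/6} (\<lambda>z. 4 * (2 + norm z) ^ 2 * norm (quotT (z + 1)))"
    by (intro continuous_intros)
  moreover have "\<forall>n. \<forall>z\<in>{z. Re z > -1/6}. norm (f14c (z + of_nat (Suc n))) \<le> 4 * (2 + norm z) ^ 2 * norm (quotT (z + 1)) * (2/5) ^ n"
    by (intro allI ballI norm_f14c_shift) simp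
  hence "\<forall>\<^sub>F n in sequentially. \<forall>z\<in>{z. Re z > -1/6}. norm (f14c (z + of_nat (Suc n))) \<le> 4 * (2 + norm z) ^ 2 * norm (quotT (z + 1)) * (2/5) ^ n"
    by (rule always_eventually)
  moreover have "summable (\<lambda>n. (2/5::real) ^ n)" by (intro summable_geometric) simp
  ultimately show "continuous_on {z. Re z > -1/6} (\<lambda>z. 4 * (2 + norm z) ^ 2 * norm (quotT (z + 1))) \<and> summable (\<lambda>n. (2/5::real) ^ n) \<and>
    (\<forall>\<^sub>F n in sequentially. \<forall>z\<in>{z. Re z > -1/6}. norm (f14c (z + of_nat (Suc n))) \<le> 4 * (2 + norm z) ^ 2 * norm (quotT (z + 1)) * (2/5) ^ n)"
    by (intro conjI)
qed auto

lemma holomorphic_wz_term: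
  assumes "S \<subseteq> {z. Re z > -1}" "k > 0"
  shows "(\<lambda>z. wz_term z k) holomorphic_on S"
proof -
  have "of_nat k + z \<notin> \<int>\<^sub>\<le>\<^sub>0" if "z \<in> S" for z
    using that assms by (intro not_nonpos_Ints_Re) auto
  thus ?thesis unfolding wz_term_def by (intro holomorphic_intros) auto
qed

lemma holomorphic_wz_sum: "wz_sum holomorphic_on {z. 4 < Re z \<and> Re z < 6}"
  unfolding wz_sum_def[abs_def]
proof (rule holomorphic_series[where M = "\<lambda>n. 1 / real (Suc n) ^ 2" and
    B = "\<lambda>z. exp (3 * pi * \<bar>Im z\<bar>) * 12 ^ 19 * (19 + \<bar>Im z\<bar>) ^ 24"])
  show "open {z. 4 < Re z \<and> Re z < 6}"
    by (intro open_Collect_conj open_halfspace_Re_gt open_halfspace_Re_lt)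
  show "(\<lambda>z. wz_term z (Suc n)) holomorphic_on {z. 4 < Re z \<and> Re z < 6}" for n
    by (intro holomorphic_wz_term) auto
  have "\<forall>\<^sub>F n in sequentially. \<forall>z\<in>{z. 4 < Re z \<and> Re z < 6}. norm (wz_term z (Suc n)) \<le>
      exp (3 * pi * \<bar>Im z\<bar>) * 12 ^ 19 * (19 + \<bar>Im z\<bar>) ^ 24 * (1 / real (Suc n) ^ 2)"
    using eventually_ge_at_top[of 36] by eventually_elim (intro ballI norm_wz_term_le, auto)
  thus "continuous_on {z. 4 < Re z \<and> Re z < 6} (\<lambda>z. exp (3 * pi * \<bar>Im z\<bar>) * 12 ^ 19 * (19 + \<bar>Im z\<bar>) ^ 24) \<and>
      summable (\<lambda>n. 1 / real (Suc n) ^ 2) \<and>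
      (\<forall>\<^sub>F n in sequentially. \<forall>z\<in>{z. 4 < Re z \<and> Re z < 6}. norm (wz_term z (Suc n)) \<le>
      exp (3 * pi * \<bar>Im z\<bar>) * 12 ^ 19 * (19 + \<bar>Im z\<bar>) ^ 24 * (1 / real (Suc n) ^ 2))"
    by (intro conjI summable_inverse_squares_Suc continuous_intros)
qed auto

lemma holomorphic_wz_total: "wz_total holomorphic_on {z. 4 < Re z \<and> Re z < 6}"
  unfolding wz_total_def[abs_def] wz_pre_def
  by (intro holomorphic_intros holomorphic_wz_sum holomorphic_quotT not_nonpos_Ints_Re
      holomorphic_on_subset[OF holomorphic_f14_sum]) auto

text \<open>The principal logarithm gives real parts in (-1/2, 1/2]; adding 5 places them inside the
  strip where \<open>wz_total\<close> is holomorphic, and periodicity makes the shift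
  harmless.\<close>

definition q_param :: "complex \<Rightarrow> complex" where
  "q_param q = wz_total (Ln q / (2 * of_real pi * \<i>) + 5)"

lemma Ln_div_2pi:
  assumes "q \<noteq> 0"
  shows "Re (Ln q / (2 * of_real pi * \<i>)) = Im (Ln q) / (2 * pi)"
    "Im (Ln q / (2 * of_real pi * \<i>)) = - ln (norm q) / (2 * pi)"
  using assms by (auto simp: Re_divide Im_divide power2_eq_square)

lemma Re_Ln_div_2pi:
  assumes "q \<noteq> 0"
  shows "- (1/2) < Re (Ln q / (2 * of_real pi * \<i>))" "Re (Ln q / (2 * of_real pi * \<i>)) \<le> 1/2"
  unfolding Ln_div_2pi(1)[OF assms] using Im_Ln_le_pi[OF assms] mpi_less_Im_Ln[OF assms]
  by (simp_all add: divide_simps)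

text \<open>The branch cut is removed by periodicity. A second chart on the left half plane uses
  Ln(-q) shifted by half a period, and the two logarithms differ by a whole period or not at
  all.\<close>

lemma holomorphic_q_param: "q_param holomorphic_on (- {0})"
proof -
  have A: "q_param holomorphic_on (- \<real>\<^sub>\<le>\<^sub>0)"
  proof -
    have "(wz_total \<circ> (\<lambda>q. Ln q / (2 * of_real pi * \<i>) + 5)) holomorphic_on (- \<real>\<^sub>\<le>\<^sub>0)"
    proof (rule holomorphic_on_compose)
      show "(\<lambda>q. Ln q / (2 * of_real pi * \<i>) + 5) holomorphic_on (- \<real>\<^sub>\<le>\<^sub>0)"
        by (intro holomorphic_intros) auto
      show "wz_total holomorphic_on (\<lambda>q. Ln q / (2 * of_real pi * \<i>) + 5) ` (- \<real>\<^sub>\<le>\<^sub>0)"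
      proof (rule holomorphic_on_subset[OF holomorphic_wz_total], safe)
        fix q :: complex assume "q \<notin> \<real>\<^sub>\<le>\<^sub>0"
        hence "q \<noteq> 0" by auto
        from Re_Ln_div_2pi[OF this]
        show "4 < Re (Ln q / (2 * of_real pi * \<i>) + 5)" "Re (Ln q / (2 * of_real pi * \<i>) + 5) < 6" by simp_all
      qed
    qed
    thus ?thesis by (simp add: o_def q_param_def[abs_def])
  qed
  have B: "q_param holomorphic_on {q. Re q < 0}"
  proof -
    have "(wz_total \<circ> (\<lambda>q. Ln (- q) / (2 * of_real pi * \<i>) + 5 - 1/2)) holomorphic_on {q. Re q < 0}"
    proof (rule holomorphic_on_compose)
      show "(\<lambda>q. Ln (- q) / (2 * of_real pi * \<i>) + 5 - 1/2) holomorphic_on {q. Re q < 0}"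
        by (intro holomorphic_intros) (auto simp: complex_nonpos_Reals_iff)
      show "wz_total holomorphic_on (\<lambda>q. Ln (- q) / (2 * of_real pi * \<i>) + 5 - 1/2) ` {q. Re q < 0}"
      proof (rule holomorphic_on_subset[OF holomorphic_wz_total], safe)
        fix q :: complex assume "Re q < 0"
        hence "- q \<noteq> 0" by auto
        from Re_Ln_div_2pi[OF this]
        show "4 < Re (Ln (- q) / (2 * of_real pi * \<i>) + 5 - 1/2)" "Re (Ln (- q) / (2 * of_real pi * \<i>) + 5 - 1/2) < 6"
          by simp_all
      qed
    qed
    moreover have "wz_total (Ln (- q) / (2 * of_real pi * \<i>) + 5 - 1/2) = q_param q" if "Re q < 0" for q
    proof -
      have q: "q \<noteq> 0" "- q \<noteq> 0" using that by auto
      define u where "u = Ln (- q) / (2 * of_real pi * \<i>) + 5 - 1/2"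
      have u: "Re u > 0" using Re_Ln_div_2pi(1)[OF q(2)] by (simp add: u_def)
      \<comment> \<open>The two signs correspond to the two sides of the cut; the offset -1/2 in
        \<open>u\<close> makes the difference of the charts 0 for one sign and 1 for the
        other.\<close>
      have "Ln (- q) = Ln q + \<i> * pi \<or> Ln (- q) = Ln q - \<i> * pi"
        using Ln_minus[OF q(1)] by (auto split: if_splits)
      hence "Ln q / (2 * of_real pi * \<i>) + 5 = u \<or> Ln q / (2 * of_real pi * \<i>) + 5 = u + 1"
      proof
        assume "Ln (- q) = Ln q + \<i> * pi"
        thus ?thesis unfolding u_def by (simp add: divide_simps)
      next
        assume "Ln (- q) = Ln q - \<i> * pi"
        thus ?thesis unfolding u_def by (simp add: divide_simps)
      qed
      moreover have "wz_total (u + 1) = wz_total u" using u by (intro wz_total_periodic) auto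
      ultimately have "wz_total (Ln q / (2 * of_real pi * \<i>) + 5) = wz_total u" by (elim disjE) (simp_all only:)
      thus ?thesis unfolding q_param_def u_def by (rule sym)
    qed
    ultimately show ?thesis by (elim holomorphic_transform) (simp only: o_apply mem_Collect_eq)
  qed
  have "q_param holomorphic_on (- \<real>\<^sub>\<le>\<^sub>0 \<union> {q. Re q < 0})"
    using A B by (intro holomorphic_on_Un open_halfspace_Re_lt open_Compl closed_nonpos_Reals_complex)
  moreover have "- \<real>\<^sub>\<le>\<^sub>0 \<union> {q. Re q < 0} = - {0 :: complex}"
    by (auto simp: complex_nonpos_Reals_iff complex_eq_iff)
  ultimately show ?thesis by simp
qed

text \<open>|Im z| = |ln |q|| / (2 pi), so the rate 3 pi becomes the power 3/2 of |q| or of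
  1/|q|.\<close>

lemma q_param_bound:
  "\<exists>C\<ge>0. \<forall>q. q \<noteq> 0 \<and> 2 * pi \<le> \<bar>ln (norm q)\<bar> \<longrightarrow> norm (q_param q) \<le> C * exp (3/2 * \<bar>ln (norm q)\<bar>)"
proof -
  obtain C where C: "C \<ge> 0" "\<And>z. 4 \<le> Re z \<Longrightarrow> Re z \<le> 6 \<Longrightarrow> 1 \<le> \<bar>Im z\<bar> \<Longrightarrow> norm (wz_total z) \<le> C * exp (3 * pi * \<bar>Im z\<bar>)"
    using wz_total_growth by blast
  have "norm (q_param q) \<le> C * exp (3/2 * \<bar>ln (norm q)\<bar>)" if q: "q \<noteq> 0" "2 * pi \<le> \<bar>ln (norm q)\<bar>" for q
  proof -
    let ?z = "Ln q / (2 * of_real pi * \<i>) + 5"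
    have Im: "\<bar>Im ?z\<bar> = \<bar>ln (norm q)\<bar> / (2 * pi)" using Ln_div_2pi(2)[OF q(1)] by simp
    have "norm (wz_total ?z) \<le> C * exp (3 * pi * \<bar>Im ?z\<bar>)"
    proof (rule C(2))
      show "4 \<le> Re ?z" "Re ?z \<le> 6" using Re_Ln_div_2pi[OF q(1)] by simp_all
      show "1 \<le> \<bar>Im ?z\<bar>" unfolding Im using q(2) by simp
    qed
    also have "3 * pi * \<bar>Im ?z\<bar> = 3/2 * \<bar>ln (norm q)\<bar>" unfolding Im by simp
    finally show ?thesis unfolding q_param_def .
  qed
  thus ?thesis using C(1) by blast
qed

text \<open>Multiplied by q^2 the function is O(|q|^(1/2)) at 0, hence extends there with value 0,
  and O(|q|^(7/2)) at infinity. It is therefore a polynomial with terms of degree 1 to 3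
  only.\<close>

lemma q_param_laurent: "\<exists>a b c. \<forall>q. q \<noteq> 0 \<longrightarrow> q_param q = a / q + b + c * q"
proof -
  obtain C where C: "C \<ge> 0" "\<And>q. q \<noteq> 0 \<Longrightarrow> 2 * pi \<le> \<bar>ln (norm q)\<bar> \<Longrightarrow> norm (q_param q) \<le> C * exp (3/2 * \<bar>ln (norm q)\<bar>)"
    using q_param_bound by blast
  define g where "g = (\<lambda>q. if q = 0 then 0 else q ^ 2 * q_param q)"
  have small: "norm (g q) \<le> C * sqrt (norm q)" if q: "norm q \<le> exp (- (2 * pi))" for q
  proof (cases "q = 0")
    case False
    have "ln (norm q) \<le> ln (exp (- (2 * pi)))" using q False by (subst ln_le_cancel_iff) auto
    hence ln: "ln (norm q) \<le> - (2 * pi)" by simp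
    hence "norm (q_param q) \<le> C * exp (3/2 * (- ln (norm q)))" using C(2)[OF False] pi_gt_zero by auto
    hence "norm (g q) \<le> norm q ^ 2 * (C * exp (3/2 * (- ln (norm q))))"
      using False by (simp add: g_def norm_mult norm_power mult_left_mono)
    also have "norm q ^ 2 = exp (2 * ln (norm q))" using False by (simp add: exp_double)
    also have "exp (2 * ln (norm q)) * (C * exp (3/2 * (- ln (norm q)))) = C * (exp (2 * ln (norm q)) * exp (3/2 * (- ln (norm q))))"
      by simp
    also have "exp (2 * ln (norm q)) * exp (3/2 * (- ln (norm q))) = exp (1/2 * ln (norm q))"
      by (simp flip: exp_add)
    also have "\<dots> = norm q powr (1/2)" using False by (simp add: powr_def)
    also have "\<dots> = sqrt (norm q)" by (simp add: powr_half_sqrt)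
    finally show ?thesis .
  qed (auto simp: g_def)
  have large: "norm (g q) \<le> C * norm q powr (7/2)" if q: "norm q \<ge> exp (2 * pi)" for q
  proof -
    have q0: "q \<noteq> 0" using q by (metis exp_gt_zero norm_zero not_less)
    have ln: "ln (norm q) \<ge> 2 * pi" using q q0 by (simp add: ln_ge_iff)
    hence "norm (q_param q) \<le> C * exp (3/2 * ln (norm q))" using C(2)[OF q0] pi_gt_zero by auto
    hence "norm (g q) \<le> norm q ^ 2 * (C * exp (3/2 * ln (norm q)))"
      using q0 by (simp add: g_def norm_mult norm_power mult_left_mono)
    also have "exp (3/2 * ln (norm q)) = norm q powr (3/2)" using q0 by (simp add: powr_def)
    also have "norm q ^ 2 = norm q powr 2" using q0 by simp
    also have "norm q powr 2 * (C * norm q powr (3/2)) = C * (norm q powr 2 * norm q powr (3/2))" by simp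
    also have "norm q powr 2 * norm q powr (3/2) = norm q powr (7/2)"
      by (simp only: powr_add[symmetric]) simp
    finally show ?thesis .
  qed
  have hol: "g holomorphic_on UNIV"
  proof (rule no_isolated_singularity[where K = "{0}"])
    have "(\<lambda>q. q ^ 2 * q_param q) holomorphic_on (UNIV - {0})"
      using holomorphic_q_param by (intro holomorphic_intros) (simp add: Compl_eq_Diff_UNIV)
    thus g': "g holomorphic_on (UNIV - {0})"
      by (rule holomorphic_transform) (auto simp: g_def)
    have "isCont g q" for q
    proof (cases "q = 0")
      case False
      have "continuous_on (UNIV - {0}) g" using g' by (rule holomorphic_on_imp_continuous_on)
      thus ?thesis using False by (simp add: continuous_on_eq_continuous_at open_Diff)
    next
      case True
      have "(g \<longlongrightarrow> 0) (at 0)"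
      proof (rule Lim_null_comparison)
        have "\<forall>\<^sub>F q in at 0. q \<in> ball (0::complex) (exp (- (2 * pi)))"
          by (intro eventually_at_in_open') auto
        thus "\<forall>\<^sub>F q in at 0. norm (g q) \<le> C * sqrt (norm q)"
          by eventually_elim (intro small, auto)
        have "((\<lambda>q::complex. C * sqrt (norm q)) \<longlongrightarrow> C * sqrt (norm (0::complex))) (at 0)"
          by (intro tendsto_intros)
        thus "((\<lambda>q::complex. C * sqrt (norm q)) \<longlongrightarrow> 0) (at 0)" by simp
      qed
      thus ?thesis using True by (simp add: isCont_def g_def)
    qed
    thus "continuous_on UNIV g" by (simp add: continuous_on_eq_continuous_at)
  qed auto
  define d where "d = (\<lambda>k. (deriv ^^ k) g 0 / fact k)"
  have poly: "g q = (\<Sum>k\<le>4. d k * q ^ k)" for q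
    unfolding d_def
  proof (rule Liouville_polynomial[OF hol])
    fix z :: complex assume z: "exp (2 * pi) \<le> norm z"
    have z1: "norm z \<ge> 1" using z by (rule order.trans[rotated]) simp
    have "norm (g z) \<le> C * norm z powr (7/2)" using z by (rule large)
    also have "\<dots> \<le> C * norm z powr 4" using z1 C(1) by (intro mult_left_mono powr_mono) auto
    finally show "norm (g z) \<le> C * norm z ^ 4" using z1 by simp
  qed
  have d0: "d 0 = 0" using poly[of 0] by (simp add: g_def eval_nat_numeral)
  \<comment> \<open>Liouville's theorem is applied with the integer exponent 4; Cauchy's inequality
    on circles of radius r with the sharper exponent 7/2 then removes the top coefficient.\<close>
  have d4: "d 4 = 0"
  proof -
    have "norm ((deriv ^^ 4) g 0) \<le> fact 4 * C * r powr (- (1/2))" if r: "r \<ge> exp (2 * pi)" for r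
    proof -
      have r0: "r > 0" using r by (rule less_le_trans[rotated]) simp
      have "norm ((deriv ^^ 4) g 0) \<le> fact 4 * (C * r powr (7/2)) / r ^ 4"
        using r r0 large by (intro Cauchy_inequality holomorphic_on_subset[OF hol]
            holomorphic_on_imp_continuous_on[OF holomorphic_on_subset[OF hol]]) auto
      also have "\<dots> = fact 4 * C * (r powr (7/2) / r powr 4)" using r0 by simp
      also have "r powr (7/2) / r powr 4 = r powr (- (1/2))" by (simp flip: powr_diff)
      finally show ?thesis .
    qed
    hence "\<forall>\<^sub>F r in at_top. norm ((deriv ^^ 4) g 0) \<le> fact 4 * C * r powr (- (1/2))"
      by (rule eventually_mono[OF eventually_ge_at_top])
    moreover have "((\<lambda>r. fact 4 * C * r powr (- (1/2))) \<longlongrightarrow> fact 4 * C * 0) at_top"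
      by (intro tendsto_intros tendsto_neg_powr filterlim_ident) auto
    ultimately have "norm ((deriv ^^ 4) g 0) \<le> fact 4 * C * 0"
      by (intro tendsto_lowerbound[of _ _ at_top]) auto
    thus ?thesis by (simp add: d_def)
  qed
  have "q_param q = d 1 / q + d 2 + d 3 * q" if "q \<noteq> 0" for q
  proof -
    have "q ^ 2 * q_param q = d 1 * q + d 2 * q ^ 2 + d 3 * q ^ 3"
      using poly[of q] that d0 d4 by (simp add: g_def eval_nat_numeral)
    also have "\<dots> = q ^ 2 * (d 1 / q + d 2 + d 3 * q)"
      using that by (simp add: field_simps eval_nat_numeral)
    finally have "q ^ 2 * q_param q = q ^ 2 * (d 1 / q + d 2 + d 3 * q)" .
    moreover have "q ^ 2 \<noteq> 0" using that by simp
    ultimately show ?thesis using mult_left_cancel by metis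
  qed
  thus ?thesis by (intro exI allI impI)
qed

text \<open>On this disc |Im (2 pi i z)| < pi, so Ln inverts exp there, and Re z > -1/6 permits the
  shift by 5.\<close>

lemma wz_total_trig:
  "\<exists>a b c. \<forall>z. norm z < 1/6 \<and> z \<noteq> 0 \<longrightarrow>
     wz_total z = a * exp (- (2 * of_real pi * \<i> * z)) + b + c * exp (2 * of_real pi * \<i> * z)"
proof -
  obtain a b c where abc: "\<And>q. q \<noteq> 0 \<Longrightarrow> q_param q = a / q + b + c * q" using q_param_laurent by blast
  have "wz_total z = a * exp (- (2 * of_real pi * \<i> * z)) + b + c * exp (2 * of_real pi * \<i> * z)"
    if z: "norm z < 1/6" "z \<noteq> 0" for z
  proof -
    let ?w = "2 * of_real pi * \<i> * z"
    have Re: "\<bar>Re z\<bar> < 1/6" using z(1) abs_Re_le_cmod[of z] by linarith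
    have "\<bar>Im ?w\<bar> = 2 * pi * \<bar>Re z\<bar>" by (simp add: abs_mult)
    also have "\<dots> < 2 * pi * (1/2)" using Re by (intro mult_strict_left_mono) auto
    also have "2 * pi * (1/2) = pi" by simp
    finally have "\<bar>Im ?w\<bar> < pi" .
    hence "- pi < Im ?w" "Im ?w \<le> pi" by linarith+
    hence "Ln (exp ?w) = ?w" by (rule Ln_exp)
    hence "Ln (exp ?w) / (2 * of_real pi * \<i>) = z" by simp
    hence "q_param (exp ?w) = wz_total (z + of_nat 5)" by (simp add: q_param_def)
    also have "\<dots> = wz_total z" using z Re by (intro wz_total_periodic5) auto
    finally have "wz_total z = a / exp ?w + b + c * exp ?w"
      unfolding abc[OF exp_not_eq_zero] by (rule sym)
    thus ?thesis unfolding exp_minus[of ?w] divide_inverse .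
  qed
  hence "\<forall>z. norm z < 1/6 \<and> z \<noteq> 0 \<longrightarrow>
     wz_total z = a * exp (- (2 * of_real pi * \<i> * z)) + b + c * exp (2 * of_real pi * \<i> * z)"
    by simp
  thus ?thesis by (intro exI)
qed

section \<open>Taylor coefficients of the WZ sum as multiple zeta values\<close>

text \<open>Uniform convergence of holomorphic functions passes to all derivatives at 0, so Taylor
  coefficients may be summed term by term.\<close>

lemma fps_series_sums:
  fixes f :: "nat \<Rightarrow> complex \<Rightarrow> complex"
  assumes r: "r > 0" and hol: "\<And>n. f n holomorphic_on ball 0 r"
    and exp: "\<And>n. f n has_fps_expansion F n"
    and bound: "\<And>n z. z \<in> ball 0 r \<Longrightarrow> norm (f n z) \<le> M n" and M: "summable M"
  shows "\<exists>G. (\<lambda>z. \<Sum>n. f n z) has_fps_expansion G \<and> (\<forall>m. (\<lambda>n. fps_nth (F n) m) sums fps_nth G m)"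
proof -
  let ?g = "\<lambda>z. \<Sum>n. f n z"
  have ul: "uniform_limit (ball 0 r) (\<lambda>N z. \<Sum>n<N. f n z) ?g sequentially"
    by (rule Weierstrass_m_test[OF bound M])
  have hs: "(\<lambda>z. \<Sum>n<N. f n z) holomorphic_on ball 0 r" for N
    by (rule holomorphic_on_sum) (rule hol)
  have hg: "?g holomorphic_on ball 0 r"
  proof (rule holomorphic_uniform_sequence[OF open_ball hs])
    fix z :: complex assume "z \<in> ball 0 r"
    then obtain d where d: "d > 0" "cball z d \<subseteq> ball 0 r" using open_ball open_contains_cball by blast
    thus "\<exists>d>0. cball z d \<subseteq> ball 0 r \<and> uniform_limit (cball z d) (\<lambda>N z. \<Sum>n<N. f n z) ?g sequentially"
      using uniform_limit_on_subset[OF ul d(2)] by blast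
  qed
  have G: "?g has_fps_expansion fps_expansion ?g 0"
    by (rule has_fps_expansion_fps_expansion[OF open_ball _ hg]) (use r in simp)
  moreover have "(\<lambda>n. fps_nth (F n) m) sums fps_nth (fps_expansion ?g 0) m" for m
  proof -
    have "(\<lambda>N. (deriv ^^ m) (\<lambda>z. \<Sum>n<N. f n z) 0) \<longlonglongrightarrow> (deriv ^^ m) ?g 0"
      by (rule higher_deriv_complex_uniform_limit[OF ul always_eventually]) (use hs r in auto)
    hence "(\<lambda>N. (deriv ^^ m) (\<lambda>z. \<Sum>n<N. f n z) 0 / fact m) \<longlonglongrightarrow> (deriv ^^ m) ?g 0 / fact m"
      by (intro tendsto_intros) simp_all
    moreover have "(deriv ^^ m) (\<lambda>z. \<Sum>n<N. f n z) 0 / fact m = (\<Sum>n<N. fps_nth (F n) m)" for N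
      using fps_nth_fps_expansion[OF has_fps_expansion_sum[of "{..<N}" f F, OF exp], of m]
      by (simp add: fps_sum_nth)
    ultimately show ?thesis unfolding sums_def using fps_nth_fps_expansion[OF G, of m] by simp
  qed
  ultimately show ?thesis by blast
qed

section \<open>The rational factors of the hypergeometric series\<close>

definition wzQ :: "complex \<Rightarrow> complex" where
  "wzQ y = (1 - 3 * y) * (1 + y) ^ 2 / ((1 + 3 * y) * (1 - y) ^ 2)"

definition wzQ0 :: "complex \<Rightarrow> complex" where
  "wzQ0 y = 1 / ((1 + 3 * y) * (1 - y) ^ 2)"

lemma qcoeff_eq: "2 * qcoeff n = (-3) ^ n + 3 - 4 * int n - (if n = 0 then 2 else 0)"
proof -
  have "even ((-3) ^ n + 3 - 4 * int n)" by simp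
  thus ?thesis by (simp add: qcoeff_def)
qed

lemma q0coeff_eq: "16 * q0coeff n = 9 * (-3) ^ n + 7 + 4 * int n"
proof -
  have "16 dvd 9 * (-3) ^ n + 7 + 4 * int n"
  proof (induction n)
    case (Suc n)
    have "9 * (-3) ^ Suc n + 7 + 4 * int (Suc n) = (-3) * (9 * (-3) ^ n + 7 + 4 * int n) + 16 * (2 + int n)"
      by simp
    thus ?case using Suc by (metis dvd_add dvd_mult dvd_triv_left)
  qed simp
  thus ?thesis by (simp add: q0coeff_def)
qed

text \<open>Partial fractions with poles at -1/3 and 1; the nearer pole -1/3 fixes the
  radius.\<close>

lemma wzQ_sums:
  assumes "norm y < 1/3"
  shows "(\<lambda>n. of_int (qcoeff n) * y ^ n) sums wzQ y" "(\<lambda>n. of_int (q0coeff n) * y ^ n) sums wzQ0 y"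
proof -
  have n1: "norm y < 1" using assms by simp
  have g3: "(\<lambda>n. (-3 * y) ^ n) sums (1 / (1 - (-3 * y)))"
    by (rule geometric_sums) (use assms in \<open>simp add: norm_mult\<close>)
  have g1: "(\<lambda>n. y ^ n) sums (1 / (1 - y))" by (rule geometric_sums[OF n1])
  have "(\<lambda>n. y * (of_nat (Suc n) * y ^ n)) sums (y * (1 / (1 - y) ^ 2))"
    by (intro sums_mult geometric_deriv_sums n1)
  hence "(\<lambda>n. of_nat (Suc n) * y ^ Suc n) sums (y * (1 / (1 - y) ^ 2))" by (simp add: mult_ac)
  from sums_Suc[OF this] have g2: "(\<lambda>n. of_nat n * y ^ n) sums (y * (1 / (1 - y)) ^ 2)"
    by (simp add: power_divide)
  have ne: "1 + 3 * y \<noteq> 0" "1 - y \<noteq> 0"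
  proof -
    show "1 - y \<noteq> 0" using n1 by auto
    show "1 + 3 * y \<noteq> 0"
    proof
      assume "1 + 3 * y = 0"
      hence "y = -1/3" by (simp add: field_simps add_eq_0_iff)
      thus False using assms by (simp add: norm_divide)
    qed
  qed
  define a b where "a = 1 / (1 - (-3 * y))" and "b = 1 / (1 - y)"
  have ab: "a * (1 + 3 * y) = 1" "b * (1 - y) = 1" using ne by (simp_all add: a_def b_def)
  have den: "(1 + 3 * y) * (1 - y) ^ 2 \<noteq> 0" using ne by simp
  \<comment> \<open>Numerator and denominator of \<open>wzQ\<close> both have degree 3, so there is
    a polynomial part, the value -1 at infinity. It explains the exceptional case n = 0 in
    \<open>qcoeff\<close>.\<close>
  have "(\<lambda>n. 1/2 * ((-3 * y) ^ n + 3 * y ^ n - 4 * (of_nat n * y ^ n)) - (if n = 0 then 1 else 0)) sums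
      (1/2 * (a + 3 * b - 4 * (y * b ^ 2)) - 1)"
    unfolding a_def b_def
    by (intro sums_diff sums_mult sums_add g3 g1 g2 sums_single[of 0 "\<lambda>_. 1"])
  moreover have "1/2 * ((-3 * y) ^ n + 3 * y ^ n - 4 * (of_nat n * y ^ n)) - (if n = 0 then 1 else 0) = of_int (qcoeff n) * y ^ n" for n
  proof -
    have "2 * (of_int (qcoeff n) :: complex) = (-3) ^ n + 3 - 4 * of_nat n - (if n = 0 then 2 else 0)"
      using arg_cong[OF qcoeff_eq[of n], of "of_int :: int \<Rightarrow> complex"] by (simp split: if_splits)
    hence "(of_int (qcoeff n) :: complex) = 1/2 * ((-3) ^ n + 3 - 4 * of_nat n) - (if n = 0 then 1 else 0)"
      by (cases "n = 0") (simp_all add: mult.commute)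
    moreover have "(-3 * y) ^ n = (-3) ^ n * y ^ n" by (rule power_mult_distrib)
    ultimately show ?thesis by (cases "n = 0") (simp_all only: if_True if_False ring_distribs, simp_all)
  qed
  moreover have "1/2 * (a + 3 * b - 4 * (y * b ^ 2)) - 1 = wzQ y"
    unfolding wzQ_def nonzero_eq_divide_eq[OF den] using ab by algebra
  ultimately show "(\<lambda>n. of_int (qcoeff n) * y ^ n) sums wzQ y" by simp
  have "(\<lambda>n. 1/16 * (9 * (-3 * y) ^ n + 7 * y ^ n + 4 * (of_nat n * y ^ n))) sums
      (1/16 * (9 * a + 7 * b + 4 * (y * b ^ 2)))"
    unfolding a_def b_def by (intro sums_mult sums_add g3 g1 g2)
  moreover have "1/16 * (9 * (-3 * y) ^ n + 7 * y ^ n + 4 * (of_nat n * y ^ n)) = of_int (q0coeff n) * y ^ n" for n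
  proof -
    have "16 * (of_int (q0coeff n) :: complex) = 9 * (-3) ^ n + 7 + 4 * of_nat n"
      using arg_cong[OF q0coeff_eq[of n], of "of_int :: int \<Rightarrow> complex"] by simp
    hence "(of_int (q0coeff n) :: complex) = 1/16 * (9 * (-3) ^ n + 7 + 4 * of_nat n)" by (simp add: mult.commute)
    moreover have "(-3 * y) ^ n = (-3) ^ n * y ^ n" by (rule power_mult_distrib)
    ultimately show ?thesis by (simp only: ring_distribs) simp
  qed
  moreover have "1/16 * (9 * a + 7 * b + 4 * (y * b ^ 2)) = wzQ0 y"
    unfolding wzQ0_def nonzero_eq_divide_eq[OF den] using ab by algebra
  ultimately show "(\<lambda>n. of_int (q0coeff n) * y ^ n) sums wzQ0 y" by simp
qed

lemma has_fps_expansion_scaled: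
  fixes f :: "complex \<Rightarrow> complex"
  assumes "\<And>y. norm y < 1/3 \<Longrightarrow> (\<lambda>n. a n * y ^ n) sums f y" "m > 0"
  shows "(\<lambda>z. f (z / of_nat m)) has_fps_expansion Abs_fps (\<lambda>n. a n / of_nat m ^ n)"
proof (rule has_fps_expansionI)
  have "\<forall>\<^sub>F z in nhds 0. z \<in> ball (0::complex) (1/3)" by (intro eventually_nhds_in_open) auto
  thus "\<forall>\<^sub>F z in nhds 0. (\<lambda>n. fps_nth (Abs_fps (\<lambda>n. a n / of_nat m ^ n)) n * z ^ n) sums f (z / of_nat m)"
  proof eventually_elim
    case (elim z)
    have "norm (z / of_nat m) \<le> norm z" using assms(2) by (simp add: norm_divide divide_le_eq mult_right_le_one_le mult_le_cancel_left1)
    hence "(\<lambda>n. a n * (z / of_nat m) ^ n) sums f (z / of_nat m)" using elim by (intro assms) simp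
    thus ?case by (simp add: power_divide)
  qed
qed

section \<open>Word recursions and truncated products\<close>

lemma eval_wsum_plus: "eval_wsum (\<lambda>w. f w + g w) t = eval_wsum f t + eval_wsum g t"
  by (induction t arbitrary: f g) (auto simp: algebra_simps)

lemma eval_wsum_zero: "eval_wsum (\<lambda>w. 0) t = 0"
  using eval_wsum_mult[of 0 "\<lambda>_. 0" t] by simp

lemma eval_prod_wsum_0: "eval_wsum f (prod_wsum 0) = f []"
  by (simp add: prod_wsum.simps)

lemma eval_prod_wsum:
  "n > 0 \<Longrightarrow> eval_wsum f (prod_wsum n) =
     (\<Sum>i<n. of_int (qcoeff (Suc i)) * eval_wsum (\<lambda>w. f (letter (Suc i) @ w)) (prod_wsum (n - Suc i)))"
  by (subst prod_wsum.simps)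
     (simp add: eval_wsum_list eval_scale_wsum eval_prefix_letter interv_sum_list_conv_sum_set_nat
        comp_def atLeast0LessThan del: letter.simps prefix_letter.simps)

lemma eval_D_wsum:
  "eval_wsum f (D_wsum n) =
     (\<Sum>i\<le>n. of_int (q0coeff i) * eval_wsum (\<lambda>w. f (letter (i + 2) @ w)) (prod_wsum (n - i)))"
  unfolding D_wsum_def lessThan_Suc_atMost[symmetric]
  by (simp add: eval_wsum_list eval_scale_wsum eval_prefix_letter interv_sum_list_conv_sum_set_nat
        comp_def atLeast0LessThan del: letter.simps prefix_letter.simps upt_Suc add_2_eq_Suc' sum.lessThan_Suc)

lemma words_of_scale: "words_of (scale_wsum a t) \<subseteq> words_of t"
  by (induction t) auto

lemma words_of_wsum_list: "w \<in> words_of (wsum_list ts) \<Longrightarrow> \<exists>t\<in>set ts. w \<in> words_of t"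
  using words_of_add by (induction ts) fastforce+

lemma words_of_prod_wsum: "w \<in> words_of (prod_wsum n) \<Longrightarrow> w = [] \<or> last w"
proof (induction n arbitrary: w rule: less_induct)
  case (less n)
  show ?case
  proof (cases "n = 0")
    case True
    thus ?thesis using less.prems by (auto simp: prod_wsum.simps)
  next
    case False
    have "w \<in> words_of (wsum_list (map (\<lambda>i. scale_wsum (qcoeff (Suc i))
        (prefix_letter (Suc i) (prod_wsum (n - Suc i)))) [0..<n]))"
      using less.prems False by (subst (asm) prod_wsum.simps) simp
    from words_of_wsum_list[OF this] obtain i where i: "i < n"
      and w: "w \<in> words_of (prefix_letter (Suc i) (prod_wsum (n - Suc i)))"
      using words_of_scale by (fastforce simp del: prefix_letter.simps)
    from w obtain w' where w': "w = letter (Suc i) @ w'" "w' \<in> words_of (prod_wsum (n - Suc i))"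
      unfolding words_of_prefix_letter by blast
    have "w' = [] \<or> last w'" using i w'(2) by (intro less.IH) auto
    thus ?thesis unfolding w'(1) using last_letter_append[of "Suc i" w'] by blast
  qed
qed

lemma admissible_D_wsum: "w \<in> words_of (D_wsum n) \<Longrightarrow> admissible w"
proof -
  assume "w \<in> words_of (D_wsum n)"
  from words_of_wsum_list[OF this[unfolded D_wsum_def]] obtain i where
    w: "w \<in> words_of (prefix_letter (i + 2) (prod_wsum (n - i)))"
    using words_of_scale by (fastforce simp del: prefix_letter.simps upt_Suc add_2_eq_Suc')
  then obtain w' where w': "w = letter (i + 2) @ w'" "w' \<in> words_of (prod_wsum (n - i))"
    unfolding words_of_prefix_letter by blast
  show "admissible w" unfolding w'(1)
    using words_of_prod_wsum[OF w'(2)] by (intro admissible_letter_append) auto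
qed

definition prod_trunc :: "nat \<Rightarrow> nat \<Rightarrow> real" where
  "prod_trunc k n = eval_wsum (\<lambda>w. mzv_trunc w k) (prod_wsum n)"

lemma prod_trunc_1: "prod_trunc 1 n = (if n = 0 then 1 else 0)"
proof (cases "n = 0")
  case False
  have "(\<lambda>w. mzv_trunc (letter (Suc i) @ w) 1) = (\<lambda>w. 0)" for i
    using letter_nonempty[of "Suc i"] by (intro ext) (simp add: mzv_trunc_1 del: letter.simps)
  thus ?thesis using False unfolding prod_trunc_def
    by (simp add: eval_prod_wsum eval_wsum_zero del: letter.simps)
qed (simp add: prod_trunc_def eval_prod_wsum_0 mzv_trunc_Nil)

text \<open>Raising the bound adds the factor \<open>wzQ (z / k)\<close>: either k occurs as the
  largest index with exponent j > 0, or it does not occur, which is the term j = 0 with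
  \<open>qcoeff 0 = 1\<close>.\<close>

lemma prod_trunc_Suc:
  assumes "k > 0"
  shows "prod_trunc (Suc k) n = (\<Sum>j\<le>n. prod_trunc k (n - j) * (of_int (qcoeff j) / real k ^ j))"
proof (cases "n = 0")
  case True
  thus ?thesis using assms by (simp add: prod_trunc_def eval_prod_wsum_0 mzv_trunc_Nil qcoeff_def)
next
  case False
  have "(\<lambda>w. mzv_trunc (letter (Suc i) @ w) (Suc k)) =
      (\<lambda>w. mzv_trunc (letter (Suc i) @ w) k + 1 / real k ^ Suc i * mzv_trunc w k)" for i
    by (intro ext) (simp add: mzv_trunc_letter_Suc del: letter.simps)
  hence step: "eval_wsum (\<lambda>w. mzv_trunc (letter (Suc i) @ w) (Suc k)) t =
      eval_wsum (\<lambda>w. mzv_trunc (letter (Suc i) @ w) k) t + 1 / real k ^ Suc i * eval_wsum (\<lambda>w. mzv_trunc w k) t" for i t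
    by (simp only: eval_wsum_plus eval_wsum_mult)
  have "prod_trunc (Suc k) n = prod_trunc k n +
      (\<Sum>i<n. prod_trunc k (n - Suc i) * (of_int (qcoeff (Suc i)) / real k ^ Suc i))"
    using False unfolding prod_trunc_def
    by (simp add: eval_prod_wsum[of n] step sum.distrib ring_distribs mult_ac del: letter.simps power_Suc)
  also have "\<dots> = (\<Sum>j\<le>n. prod_trunc k (n - j) * (of_int (qcoeff j) / real k ^ j))"
    by (subst sum.atMost_shift) (simp add: qcoeff_def[of 0])
  finally show ?thesis .
qed

definition wz_prod :: "nat \<Rightarrow> complex \<Rightarrow> complex" where
  "wz_prod k z = (\<Prod>m=1..<k. wzQ (z / of_nat m))"

lemma wz_prod_Suc: "k > 0 \<Longrightarrow> wz_prod (Suc k) z = wz_prod k z * wzQ (z / of_nat k)"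
  by (simp add: wz_prod_def)

lemma wz_prod_fps: "wz_prod (Suc k) has_fps_expansion Abs_fps (\<lambda>n. of_real (prod_trunc (Suc k) n))"
proof (induction k)
  case 0
  have "Abs_fps (\<lambda>n. complex_of_real (prod_trunc (Suc 0) n)) = 1"
    using prod_trunc_1 by (simp add: fps_eq_iff)
  moreover have "wz_prod (Suc 0) = (\<lambda>_. 1)" by (simp add: wz_prod_def fun_eq_iff)
  ultimately show ?case by simp
next
  case (Suc k)
  let ?Q = "Abs_fps (\<lambda>n. of_int (qcoeff n) / of_nat (Suc k) ^ n :: complex)"
  have "(\<lambda>z. wz_prod (Suc k) z * wzQ (z / of_nat (Suc k))) has_fps_expansion
      Abs_fps (\<lambda>n. of_real (prod_trunc (Suc k) n)) * ?Q"
    by (intro has_fps_expansion_mult Suc has_fps_expansion_scaled wzQ_sums) simp_all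
  also have "Abs_fps (\<lambda>n. of_real (prod_trunc (Suc k) n)) * ?Q = Abs_fps (\<lambda>n. of_real (prod_trunc (Suc (Suc k)) n))"
    unfolding fps_eq_iff
    by (intro allI, subst mult.commute, subst fps_mult_nth, subst fps_nth_Abs_fps, subst prod_trunc_Suc)
       (auto simp: atLeast0AtMost mult_ac intro!: sum.cong)
  also have "(\<lambda>z. wz_prod (Suc k) z * wzQ (z / of_nat (Suc k))) = wz_prod (Suc (Suc k))"
    by (simp add: wz_prod_Suc fun_eq_iff)
  finally show ?case .
qed

text \<open>Term k of the WZ series stripped of its Gamma prefactor. At the last index only the
  denominator of \<open>wzQ\<close> appears, which is \<open>wzQ0\<close>.\<close>

definition D_term :: "nat \<Rightarrow> complex \<Rightarrow> complex" where
  "D_term k z = wz_prod k z * wzQ0 (z / of_nat k) / of_nat k ^ 2"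

definition D_fun :: "complex \<Rightarrow> complex" where
  "D_fun z = (\<Sum>n. D_term (Suc n) z)"

lemma D_term_fps:
  "D_term (Suc k) has_fps_expansion Abs_fps (\<lambda>n. of_real (eval_wsum (\<lambda>w. mzv_coeff w (Suc k)) (D_wsum n)))"
proof -
  let ?Q = "Abs_fps (\<lambda>n. of_int (q0coeff n) / of_nat (Suc k) ^ n :: complex)"
  let ?c = "1 / of_nat (Suc k) ^ 2 :: complex"
  have "(\<lambda>z. ?c * (wz_prod (Suc k) z * wzQ0 (z / of_nat (Suc k)))) has_fps_expansion
      fps_const ?c * (Abs_fps (\<lambda>n. of_real (prod_trunc (Suc k) n)) * ?Q)"
    by (intro has_fps_expansion_cmult_left has_fps_expansion_mult wz_prod_fps has_fps_expansion_scaled wzQ_sums) simp_all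
  also have "(\<lambda>z. ?c * (wz_prod (Suc k) z * wzQ0 (z / of_nat (Suc k)))) = D_term (Suc k)"
    by (simp add: D_term_def fun_eq_iff)
  also have "fps_const ?c * (Abs_fps (\<lambda>n. of_real (prod_trunc (Suc k) n)) * ?Q) =
      Abs_fps (\<lambda>n. of_real (eval_wsum (\<lambda>w. mzv_coeff w (Suc k)) (D_wsum n)))"
  proof (rule fps_ext)
    fix n
    have "eval_wsum (\<lambda>w. mzv_coeff w (Suc k)) (D_wsum n) =
        (\<Sum>i\<le>n. 1 / real (Suc k) ^ 2 * (of_int (q0coeff i) / real (Suc k) ^ i * prod_trunc (Suc k) (n - i)))"
      unfolding eval_D_wsum
    proof (rule sum.cong)
      fix i assume "i \<in> {..n}"
      have "(\<lambda>w. mzv_coeff (letter (i + 2) @ w) (Suc k)) = (\<lambda>w. 1 / real (Suc k) ^ (i + 2) * mzv_trunc w (Suc k))"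
        by (intro ext, subst mzv_coeff_letter) simp_all
      hence "eval_wsum (\<lambda>w. mzv_coeff (letter (i + 2) @ w) (Suc k)) (prod_wsum (n - i)) = 1 / real (Suc k) ^ (i + 2) * prod_trunc (Suc k) (n - i)"
        by (simp only: eval_wsum_mult prod_trunc_def)
      thus "of_int (q0coeff i) * eval_wsum (\<lambda>w. mzv_coeff (letter (i + 2) @ w) (Suc k)) (prod_wsum (n - i)) =
          1 / real (Suc k) ^ 2 * (of_int (q0coeff i) / real (Suc k) ^ i * prod_trunc (Suc k) (n - i))"
        by (simp only: power_add) (simp add: field_simps)
    qed simp
    moreover have "fps_nth (fps_const ?c * (Abs_fps (\<lambda>n. of_real (prod_trunc (Suc k) n)) * ?Q)) n =
        ?c * (\<Sum>i\<le>n. fps_nth ?Q i * fps_nth (Abs_fps (\<lambda>n. of_real (prod_trunc (Suc k) n))) (n - i))"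
      by (subst fps_mult_left_const_nth, subst mult.commute[of "Abs_fps (\<lambda>n. of_real (prod_trunc (Suc k) n))"])
         (simp only: fps_mult_nth atLeast0AtMost)
    ultimately show "fps_nth (fps_const ?c * (Abs_fps (\<lambda>n. of_real (prod_trunc (Suc k) n)) * ?Q)) n =
        fps_nth (Abs_fps (\<lambda>n. complex_of_real (eval_wsum (\<lambda>w. mzv_coeff w (Suc k)) (D_wsum n)))) n"
      by (simp add: sum_distrib_left del: of_nat_Suc)
  qed
  finally show ?thesis .
qed

section \<open>Bounds for the factors near the origin\<close>

lemma wzQ_denominator:
  fixes y :: complex
  assumes "norm y \<le> 1/20"
  shows "norm ((1 + 3 * y) * (1 - y) ^ 2) \<ge> 3/4" "(1 + 3 * y) * (1 - y) ^ 2 \<noteq> 0"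
proof -
  have "norm (1 + 3 * y) \<ge> 17/20" using norm_triangle_ineq4[of "1 + 3 * y" "3 * y"] assms by (simp add: norm_mult)
  moreover have "norm (1 - y) \<ge> 19/20" using norm_triangle_ineq[of "1 - y" y] assms by simp
  hence "norm (1 - y) ^ 2 \<ge> (19/20) ^ 2" by (intro power_mono) auto
  ultimately have "17/20 * (19/20) ^ 2 \<le> norm (1 + 3 * y) * norm (1 - y) ^ 2" by (intro mult_mono) auto
  thus 1: "norm ((1 + 3 * y) * (1 - y) ^ 2) \<ge> 3/4" by (simp add: norm_mult norm_power power2_eq_square)
  thus "(1 + 3 * y) * (1 - y) ^ 2 \<noteq> 0" by auto
qed

text \<open>\<open>wzQ y\<close> - 1 has numerator -2y - 6y^3, so the deviation from 1 is of first
  order in y, and the denominator stays above 3/4 on this disc.\<close>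

lemma norm_wzQ_le:
  assumes "norm y \<le> 1/20"
  shows "norm (wzQ y) \<le> 1 + 4 * norm y" "norm (wzQ0 y) \<le> 2"
proof -
  note d = wzQ_denominator[OF assms]
  have "wzQ y = 1 + (- (2 * y) - 6 * y ^ 3) / ((1 + 3 * y) * (1 - y) ^ 2)"
  proof -
    have "(1 - 3 * y) * (1 + y) ^ 2 = (1 + 3 * y) * (1 - y) ^ 2 + (- (2 * y) - 6 * y ^ 3)" by algebra
    thus ?thesis unfolding wzQ_def by (simp only: add_divide_distrib divide_self[OF d(2)])
  qed
  also have "norm \<dots> \<le> 1 + norm (- (2 * y) - 6 * y ^ 3) / norm ((1 + 3 * y) * (1 - y) ^ 2)"
    by (rule order.trans[OF norm_triangle_ineq]) (simp add: norm_divide)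
  also have "norm (- (2 * y) - 6 * y ^ 3) / norm ((1 + 3 * y) * (1 - y) ^ 2) \<le> (3 * norm y) / (3/4)"
  proof (rule frac_le)
    have "norm (- (2 * y) - 6 * y ^ 3) \<le> 2 * norm y + 6 * norm y ^ 3"
      by (rule order.trans[OF norm_triangle_ineq4]) (simp add: norm_mult norm_power)
    also have "6 * norm y ^ 3 \<le> norm y"
    proof -
      have "norm y ^ 2 \<le> (1/20) ^ 2" using assms by (intro power_mono) auto
      hence "norm y * (6 * norm y ^ 2) \<le> norm y * 1" by (intro mult_left_mono) (auto simp: power2_eq_square)
      thus ?thesis by (simp add: power3_eq_cube power2_eq_square mult_ac)
    qed
    finally show "norm (- (2 * y) - 6 * y ^ 3) \<le> 3 * norm y" by simp
  qed (use d in auto)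
  finally show "norm (wzQ y) \<le> 1 + 4 * norm y" by simp
  have "norm (wzQ0 y) = 1 / norm ((1 + 3 * y) * (1 - y) ^ 2)" by (simp add: wzQ0_def norm_divide)
  also have "\<dots> \<le> 1 / (3/4)" using d(1) by (intro divide_left_mono) auto
  finally show "norm (wzQ0 y) \<le> 2" by simp
qed

lemma norm_div_nat_le: "norm z \<le> 1/20 \<Longrightarrow> m > 0 \<Longrightarrow> norm (z / of_nat m :: complex) \<le> 1 / (20 * real m)"
  by (simp add: norm_divide field_simps)

lemma norm_div_nat_le': "norm z \<le> 1/20 \<Longrightarrow> m > 0 \<Longrightarrow> norm (z / of_nat m :: complex) \<le> 1/20"
proof -
  assume "norm z \<le> 1/20" "m > 0"
  hence "norm (z / of_nat m) \<le> 1 / (20 * real m)" by (rule norm_div_nat_le)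
  also have "\<dots> \<le> 1/20" using \<open>m > 0\<close> by (simp add: field_simps)
  finally show ?thesis .
qed

text \<open>The radius 1/20 makes each factor at most 1 + 1/(4m) <= sqrt(1 + 1/m), and these square
  roots telescope. With the 1/k^2 in \<open>D_term\<close> this leaves the summable power
  k^(-3/2).\<close>

lemma norm_wz_prod_le:
  assumes "norm z \<le> 1/20"
  shows "norm (wz_prod (Suc k) z) \<le> sqrt (real (Suc k))"
proof (induction k)
  case (Suc k)
  define K where "K = real (Suc k)"
  have K: "K \<ge> 1" by (simp add: K_def)
  have "norm (wzQ (z / of_nat (Suc k))) \<le> 1 + 4 * norm (z / of_nat (Suc k))"
    by (rule norm_wzQ_le(1)[OF norm_div_nat_le'[OF assms]]) simp
  also have "\<dots> \<le> 1 + 1 / (4 * K)"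
    using norm_div_nat_le[OF assms, of "Suc k"] K unfolding K_def by (simp add: field_simps)
  also have "\<dots> \<le> sqrt (1 + 1 / K)"
  proof (rule real_le_rsqrt)
    have "(1 + 1 / (4 * K)) ^ 2 = 1 + 1 / K * (1/2 + 1 / (16 * K))"
      using K by (simp add: power2_eq_square field_simps)
    also have "\<dots> \<le> 1 + 1 / K * 1"
    proof -
      have "1/2 + 1 / (16 * K) \<le> 1" using K by (simp add: field_simps)
      thus ?thesis using K by (intro add_left_mono mult_left_mono) simp_all
    qed
    finally show "(1 + 1 / (4 * K)) ^ 2 \<le> 1 + 1 / K" by simp
  qed
  finally have Q: "norm (wzQ (z / of_nat (Suc k))) \<le> sqrt (1 + 1 / K)" .
  have "norm (wz_prod (Suc (Suc k)) z) = norm (wz_prod (Suc k) z) * norm (wzQ (z / of_nat (Suc k)))"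
    by (simp add: wz_prod_Suc[of "Suc k"] norm_mult)
  also have "\<dots> \<le> sqrt K * sqrt (1 + 1 / K)"
    using Suc Q K unfolding K_def[symmetric] by (intro mult_mono) auto
  also have "\<dots> = sqrt (K + 1)" using K by (simp add: real_sqrt_mult[symmetric] ring_distribs)
  finally show ?case by (simp add: K_def add_ac)
qed (simp add: wz_prod_def)

lemma norm_D_term_le:
  assumes "norm z \<le> 1/20"
  shows "norm (D_term (Suc k) z) \<le> 2 * real (Suc k) powr (- (3/2))"
proof -
  define K where "K = real (Suc k)"
  have K: "K > 0" by (simp add: K_def)
  have "norm (D_term (Suc k) z) = norm (wz_prod (Suc k) z) * norm (wzQ0 (z / of_nat (Suc k))) / K ^ 2"
    by (simp add: D_term_def norm_mult norm_divide norm_power K_def del: of_nat_Suc)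
  also have "\<dots> \<le> sqrt K * 2 / K ^ 2"
    unfolding K_def
    by (intro divide_right_mono mult_mono norm_wz_prod_le[OF assms] norm_wzQ_le(2)[OF norm_div_nat_le'[OF assms]]) auto
  also have "\<dots> = 2 * (K powr (1/2) / K powr 2)" using K by (simp add: powr_half_sqrt)
  also have "K powr (1/2) / K powr 2 = K powr (- (3/2))" by (simp flip: powr_diff)
  finally show ?thesis by (simp add: K_def)
qed

text \<open>Coefficient n of term k is the k-th summand of a combination of multiple zeta series of
  weight n + 2; the uniform bound on the disc justifies summing over k.\<close>

lemma D_fun_fps:
  "\<exists>G. D_fun has_fps_expansion G \<and> (\<forall>n. fps_nth G n = of_real (eval_wsum mzv (D_wsum n)))"
proof -
  let ?F = "\<lambda>k. Abs_fps (\<lambda>n. complex_of_real (eval_wsum (\<lambda>w. mzv_coeff w (Suc k)) (D_wsum n)))"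
  have "\<exists>G. (\<lambda>z. \<Sum>k. D_term (Suc k) z) has_fps_expansion G \<and> (\<forall>n. (\<lambda>k. fps_nth (?F k) n) sums fps_nth G n)"
  proof (rule fps_series_sums)
    show "(0::real) < 1/20" by simp
    show "D_term (Suc k) has_fps_expansion ?F k" for k by (rule D_term_fps)
    show "norm (D_term (Suc k) z) \<le> 2 * real (Suc k) powr (- (3/2))" if "z \<in> ball 0 (1/20)" for k z
      using that by (intro norm_D_term_le) simp
    have "summable (\<lambda>k. real k powr (- (3/2)))" by (simp add: summable_real_powr_iff)
    thus "summable (\<lambda>k. 2 * real (Suc k) powr (- (3/2)))" by (intro summable_mult) (subst summable_Suc_iff)
    show "D_term (Suc k) holomorphic_on ball 0 (1/20)" for k
    proof -
      have "(1 + 3 * (z / of_nat m)) * (1 - z / of_nat m) ^ 2 \<noteq> 0" if "z \<in> ball 0 (1/20)" "m > 0" for z :: complex and m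
        using that by (intro wzQ_denominator norm_div_nat_le') auto
      hence nz: "\<And>z m. norm z < 1/20 \<Longrightarrow> m > 0 \<Longrightarrow> (1 + 3 * (z / of_nat m)) * (1 - z / of_nat m) ^ 2 \<noteq> (0::complex)" by simp
      have Q: "(\<lambda>z. wzQ (z / of_nat m)) holomorphic_on ball 0 (1/20)" if "m > 0" for m
        unfolding wzQ_def by (intro holomorphic_intros nz[OF _ that]) (use that in simp_all)
      have Q0: "(\<lambda>z. wzQ0 (z / of_nat (Suc k))) holomorphic_on ball 0 (1/20)"
        unfolding wzQ0_def by (intro holomorphic_intros nz) simp_all
      have "wz_prod (Suc k) holomorphic_on ball 0 (1/20)"
        unfolding wz_prod_def[abs_def] by (rule holomorphic_on_prod) (rule Q, simp)
      thus ?thesis unfolding D_term_def[abs_def] by (intro holomorphic_intros Q0) simp_all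
    qed
  qed
  then obtain G where G: "D_fun has_fps_expansion G" "\<And>n. (\<lambda>k. fps_nth (?F k) n) sums fps_nth G n"
    unfolding D_fun_def[abs_def] by blast
  have "fps_nth G n = of_real (eval_wsum mzv (D_wsum n))" for n
  proof -
    have "(\<lambda>k. eval_wsum (\<lambda>w. mzv_coeff w k) (D_wsum n)) sums eval_wsum mzv (D_wsum n)"
      by (rule eval_coeff_sums) (rule admissible_D_wsum)
    \<comment> \<open>\<open>D_fun\<close> starts at k = 1 while the multiple zeta series start at
      0; the summand at 0 vanishes because admissible words are nonempty.\<close>
    moreover have "eval_wsum (\<lambda>w. mzv_coeff w 0) (D_wsum n) = 0"
    proof -
      have "eval_wsum (\<lambda>w. mzv_coeff w 0) (D_wsum n) = eval_wsum (\<lambda>w. 0 :: real) (D_wsum n)"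
        by (rule eval_wsum_cong) (use admissible_D_wsum in \<open>auto simp: mzv_coeff_0 admissible_def\<close>)
      thus ?thesis by (simp add: eval_wsum_zero)
    qed
    ultimately have "(\<lambda>k. eval_wsum (\<lambda>w. mzv_coeff w (Suc k)) (D_wsum n)) sums eval_wsum mzv (D_wsum n)"
      by (subst sums_Suc_iff) simp
    hence "(\<lambda>k. complex_of_real (eval_wsum (\<lambda>w. mzv_coeff w (Suc k)) (D_wsum n))) sums of_real (eval_wsum mzv (D_wsum n))"
      by (rule sums_of_real)
    thus ?thesis using G(2)[of n] unfolding fps_nth_Abs_fps by (intro sums_unique2)
  qed
  thus ?thesis using G(1) by blast
qed

section \<open>Derivatives of the summand\<close>

lemma f14c_of_real: "x > 1/6 \<Longrightarrow> f14c (of_real x) = of_real (f14 x)"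
proof -
  have g: "Gamma (of_nat k * complex_of_real x) = of_real (Gamma (real k * x))" for k
    using Gamma_complex_of_real[of "real k * x"] by simp
  have "Gamma (6 * complex_of_real x) = of_real (Gamma (6 * x))" "Gamma (3 * complex_of_real x) = of_real (Gamma (3 * x))"
    "Gamma (2 * complex_of_real x) = of_real (Gamma (2 * x))" "Gamma (complex_of_real x) = of_real (Gamma x)"
    using g[of 6] g[of 3] g[of 2] g[of 1] by simp_all
  thus ?thesis unfolding f14c_def quotT_def f14_def by (simp add: mult_ac)
qed

text \<open>Along the real axis the real part of the complex derivative is the real derivative. Its
  imaginary part is 0, since by induction the imaginary part of the function vanishes on an interval
  around x.\<close>

lemma higher_deriv_f14:
  "x > 1/6 \<Longrightarrow> (deriv ^^ m) f14c (of_real x) = of_real ((deriv ^^ m) f14 x)"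
proof (induction m arbitrary: x)
  case 0
  thus ?case by (simp add: f14c_of_real)
next
  case (Suc m)
  let ?g = "(deriv ^^ m) f14c"
  have op: "open {z. Re z > 1/6}" by (rule open_halfspace_Re_gt)
  have "?g holomorphic_on {z. Re z > 1/6}"
    by (intro holomorphic_higher_deriv holomorphic_f14c op) auto
  hence "(?g has_field_derivative deriv ?g (of_real x)) (at (of_real x))"
    using Suc.prems by (intro holomorphic_derivI[OF _ op]) auto
  moreover have "(complex_of_real has_vector_derivative 1) (at x)"
    by (rule has_vector_derivative_of_real[OF DERIV_ident, unfolded of_real_1])
  ultimately have "(?g \<circ> of_real has_vector_derivative 1 * deriv ?g (of_real x)) (at x)"
    by (intro field_vector_diff_chain_at)
  hence D: "((\<lambda>t. ?g (of_real t)) has_vector_derivative deriv ?g (of_real x)) (at x)" by (simp add: o_def)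
  have ev: "\<forall>\<^sub>F t in nhds x. t \<in> {1/6<..}" using Suc.prems by (intro eventually_nhds_in_open) auto
  have "((\<lambda>t. Re (?g (of_real t))) has_field_derivative Re (deriv ?g (of_real x))) (at x)"
    using D by (rule has_field_derivative_Re)
  moreover have "\<forall>\<^sub>F t in nhds x. Re (?g (of_real t)) = (deriv ^^ m) f14 t"
    using ev by eventually_elim (simp add: Suc.IH)
  ultimately have "((deriv ^^ m) f14 has_field_derivative Re (deriv ?g (of_real x))) (at x)"
    by (subst (asm) DERIV_cong_ev[OF refl _ refl])
  hence re: "deriv ((deriv ^^ m) f14) x = Re (deriv ?g (of_real x))" by (rule DERIV_imp_deriv)
  have "((\<lambda>t. Im (?g (of_real t))) has_field_derivative Im (deriv ?g (of_real x))) (at x)"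
    using D by (rule has_field_derivative_Im)
  moreover have "\<forall>\<^sub>F t in nhds x. Im (?g (of_real t)) = 0"
    using ev by eventually_elim (simp add: Suc.IH)
  ultimately have "((\<lambda>t. 0) has_field_derivative Im (deriv ?g (of_real x))) (at x)"
    by (subst (asm) DERIV_cong_ev[OF refl _ refl])
  hence "Im (deriv ?g (of_real x)) = 0" by (rule DERIV_unique[OF _ DERIV_const])
  thus ?case using re by (simp add: complex_eq_iff)
qed

text \<open>Convergence of the differentiated series comes from here: termwise expansion of a
  uniformly convergent sum gives summability of every order at once.\<close>

lemma f14_sum_fps:
  "\<exists>G. f14_sum has_fps_expansion G \<and>
     (\<forall>m. (\<lambda>n. of_real ((deriv ^^ m) f14 (real (Suc n)) / fact m)) sums fps_nth G m)"
proof -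
  let ?f = "\<lambda>n z. f14c (z + of_nat (Suc n))"
  have op: "open {z. Re z > -1/6}" by (rule open_halfspace_Re_gt)
  have hol: "?f n holomorphic_on {z. Re z > -1/6}" for n
  proof -
    have "(f14c \<circ> (\<lambda>z. z + of_nat (Suc n))) holomorphic_on {z. Re z > -1/6}"
      by (intro holomorphic_on_compose holomorphic_intros holomorphic_f14c) auto
    thus ?thesis by (simp add: o_def)
  qed
  have sub: "cball 0 (1/20) \<subseteq> {z::complex. Re z > -1/6}"
  proof
    fix z :: complex assume "z \<in> cball 0 (1/20)"
    thus "z \<in> {z. Re z > -1/6}" using abs_Re_le_cmod[of z] by simp
  qed
  have "(quotT \<circ> (\<lambda>z. z + 1)) holomorphic_on {z. Re z > -1/6}"
    by (intro holomorphic_on_compose holomorphic_intros holomorphic_quotT) auto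
  hence "continuous_on (cball 0 (1/20)) (\<lambda>z. quotT (z + 1))"
    using sub by (auto dest!: holomorphic_on_imp_continuous_on intro: continuous_on_subset simp: o_def)
  hence "compact ((\<lambda>z. quotT (z + 1)) ` cball 0 (1/20))" by (rule compact_continuous_image) simp
  hence "bounded ((\<lambda>z. quotT (z + 1)) ` cball 0 (1/20))" by (rule compact_imp_bounded)
  then obtain C where bd: "\<forall>w\<in>(\<lambda>z. quotT (z + 1)) ` cball 0 (1/20). norm w \<le> C" unfolding bounded_iff by (elim exE)
  have C: "norm (quotT (z + 1)) \<le> C" if "z \<in> cball 0 (1/20)" for z using bspec[OF bd imageI[OF that]] .
  have "\<exists>G. (\<lambda>z. \<Sum>n. ?f n z) has_fps_expansion G \<and> (\<forall>m. (\<lambda>n. fps_nth (fps_expansion (?f n) 0) m) sums fps_nth G m)"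
  proof (rule fps_series_sums)
    show "(0::real) < 1/20" by simp
    show "?f n holomorphic_on ball 0 (1/20)" for n
      by (rule holomorphic_on_subset[OF hol order.trans[OF ball_subset_cball sub]])
    show "?f n has_fps_expansion fps_expansion (?f n) 0" for n
      by (rule has_fps_expansion_fps_expansion[OF op _ hol]) simp
    show "norm (?f n z) \<le> 4 * 3 ^ 2 * C * (2/5) ^ n" if z: "z \<in> ball 0 (1/20)" for n z
    proof -
      have z': "z \<in> cball 0 (1/20)" using z by simp
      have "norm (?f n z) \<le> 4 * (2 + norm z) ^ 2 * norm (quotT (z + 1)) * (2/5) ^ n"
        by (rule norm_f14c_shift) (use subsetD[OF sub z'] in simp)
      also have "\<dots> \<le> 4 * 3 ^ 2 * C * (2/5) ^ n"
        using C[OF z'] z by (intro mult_right_mono mult_mono power_mono) auto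
      finally show ?thesis .
    qed
    show "summable (\<lambda>n. 4 * 3 ^ 2 * C * (2/5) ^ n)" by (intro summable_mult summable_geometric) simp
  qed
  then obtain G where G: "f14_sum has_fps_expansion G" "\<And>m. (\<lambda>n. fps_nth (fps_expansion (?f n) 0) m) sums fps_nth G m"
    unfolding f14_sum_def[abs_def] by blast
  have "fps_nth (fps_expansion (?f n) 0) m = of_real ((deriv ^^ m) f14 (real (Suc n)) / fact m)" for n m
  proof -
    have "(deriv ^^ m) (?f n) 0 = (deriv ^^ m) f14c (of_nat (Suc n))"
      unfolding higher_deriv_shift_0[of m f14c "of_nat (Suc n)"] by (simp add: o_def add.commute)
    also have "\<dots> = of_real ((deriv ^^ m) f14 (real (Suc n)))"
      using higher_deriv_f14[of "real (Suc n)" m] by simp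
    finally show ?thesis by (simp add: fps_expansion_def)
  qed
  hence "(\<lambda>n. of_real ((deriv ^^ m) f14 (real (Suc n)) / fact m)) sums fps_nth G m" for m
    using G(2)[of m] by (simp only:)
  thus ?thesis using G(1) by (intro exI[of _ G] conjI allI)
qed

section \<open>Power series identity\<close>

text \<open>\<open>l\<close> is the logarithmic derivative of a series with constant term 1.
  Products of Gamma factors thus become sums of digamma series, and F is determined by
  \<open>l\<close> recursively.\<close>

definition exp_fps :: "complex fps \<Rightarrow> complex fps \<Rightarrow> bool" where
  "exp_fps F l \<longleftrightarrow> fps_nth F 0 = 1 \<and> fps_deriv F = F * l"

lemma exp_fps_mult: "exp_fps F l \<Longrightarrow> exp_fps G k \<Longrightarrow> exp_fps (F * G) (l + k)"
  unfolding exp_fps_def by (simp add: algebra_simps)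

lemma exp_fps_power: "exp_fps F l \<Longrightarrow> exp_fps (F ^ n) (of_nat n * l)"
proof (induction n)
  case 0
  show ?case by (simp add: exp_fps_def)
next
  case (Suc n)
  from exp_fps_mult[OF Suc.prems Suc.IH[OF Suc.prems]] show ?case by (simp add: algebra_simps)
qed

lemma exp_fps_inverse:
  assumes "exp_fps F l"
  shows "exp_fps (inverse F) (- l)"
proof -
  have F0: "fps_nth F 0 = 1" and d: "fps_deriv F = F * l" using assms by (auto simp: exp_fps_def)
  have i: "F * inverse F = 1" using F0 by (subst mult.commute) (simp add: inverse_mult_eq_1)
  have "fps_deriv (inverse F) = - fps_deriv F * inverse F ^ 2" using F0 by (intro fps_inverse_deriv) simp
  also have "\<dots> = (F * inverse F) * (inverse F * - l)" unfolding d power2_eq_square by (simp add: mult_ac)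
  finally show ?thesis unfolding i using F0 by (simp add: exp_fps_def)
qed

lemma exp_fps_nth:
  assumes "exp_fps F l"
  shows "of_nat (Suc n) * fps_nth F (Suc n) = (\<Sum>i\<le>n. fps_nth F i * fps_nth l (n - i))"
proof -
  have "fps_nth (fps_deriv F) n = fps_nth (F * l) n" using assms by (simp add: exp_fps_def)
  thus ?thesis by (simp add: fps_mult_nth atLeast0AtMost)
qed

lemma exp_fps_nth_1: "exp_fps F l \<Longrightarrow> fps_nth F 1 = fps_nth l 0"
  using exp_fps_nth[of F l 0] by (simp add: exp_fps_def)

text \<open>The recursion keeps the coefficients real when those of \<open>l\<close> are real, which
  hands the last stage over to real arithmetic.\<close>

lemma exp_fps_real:
  assumes F: "exp_fps F l" and l: "\<And>n. fps_nth l n = of_real (r n)"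
  shows "\<exists>g. (\<forall>n. fps_nth F n = of_real (g n)) \<and> g 0 = 1 \<and>
    (\<forall>n. real (Suc n) * g (Suc n) = (\<Sum>i\<le>n. g i * r (n - i)))"
proof -
  have "fps_nth F n \<in> \<real>" for n
  proof (induction n rule: less_induct)
    case (less n)
    show ?case
    proof (cases n)
      case 0
      thus ?thesis using F by (simp add: exp_fps_def)
    next
      case (Suc m)
      have "fps_nth F (Suc m) = (\<Sum>i\<le>m. fps_nth F i * fps_nth l (m - i)) / of_nat (Suc m)"
        using exp_fps_nth[OF F, of m] by (simp add: field_simps del: of_nat_Suc)
      also have "\<dots> \<in> \<real>" using less Suc l by (intro Reals_divide sum_in_Reals Reals_mult) auto
      finally show ?thesis using Suc by simp
    qed
  qed
  hence g: "fps_nth F n = of_real (Re (fps_nth F n))" for n by (simp add: of_real_Re)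
  have step: "real (Suc n) * Re (fps_nth F (Suc n)) = (\<Sum>i\<le>n. Re (fps_nth F i) * r (n - i))" for n
  proof -
    have "complex_of_real (real (Suc n) * Re (fps_nth F (Suc n))) = of_nat (Suc n) * fps_nth F (Suc n)"
      by (subst (2) g) (simp only: of_real_mult of_real_of_nat_eq)
    also have "\<dots> = (\<Sum>i\<le>n. fps_nth F i * fps_nth l (n - i))" by (rule exp_fps_nth[OF F])
    also have "\<dots> = complex_of_real (\<Sum>i\<le>n. Re (fps_nth F i) * r (n - i))"
      unfolding of_real_sum l of_real_mult by (intro sum.cong refl arg_cong2[where f = "(*)"] g)
    finally show ?thesis by (simp only: of_real_eq_iff)
  qed
  have "Re (fps_nth F 0) = 1" using F by (simp add: exp_fps_def)
  thus ?thesis by (intro exI[of _ "\<lambda>n. Re (fps_nth F n)"] conjI allI g step)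
qed

definition digamma_fps :: "complex \<Rightarrow> complex fps" where
  "digamma_fps c = Abs_fps (\<lambda>n. c ^ Suc n * (Polygamma n 1 / fact n))"

lemma Re_one_plus_pos: "w \<in> ball 0 (1 / (norm c + 1)) \<Longrightarrow> Re (1 + c * w :: complex) > 0"
proof -
  assume "w \<in> ball 0 (1 / (norm c + 1))"
  hence "norm w * (norm c + 1) < 1" by (simp add: field_simps add_pos_nonneg)
  moreover have "norm w * norm c \<le> norm w * (norm c + 1)" by (intro mult_left_mono) auto
  moreover have "\<bar>Re (c * w)\<bar> \<le> norm c * norm w" using abs_Re_le_cmod[of "c * w"] by (simp add: norm_mult)
  ultimately show ?thesis by (simp add: mult.commute abs_le_iff)
qed

lemma ball_inverse_pos: "0 \<in> ball (0::complex) (1 / (norm (c::complex) + 1))"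
  by (simp add: add_nonneg_pos)

lemma Digamma_has_fps:
  "(\<lambda>z. c * Digamma (1 + c * z)) has_fps_expansion digamma_fps c"
proof -
  let ?S = "ball (0::complex) (1 / (norm c + 1))" and ?f = "\<lambda>w. Digamma (c * w + 1 :: complex)"
  have pos: "Re (c * w + 1) > 0" if "w \<in> ?S" for w using Re_one_plus_pos[OF that] by (simp add: add.commute)
  have hT: "Digamma holomorphic_on {z::complex. Re z > 0}"
    by (intro holomorphic_on_Polygamma) (auto elim!: nonpos_Ints_cases)
  have hS: "?f holomorphic_on ?S"
  proof -
    have "(Digamma \<circ> (\<lambda>w. c * w + 1)) holomorphic_on ?S"
      by (intro holomorphic_on_compose holomorphic_intros holomorphic_on_subset[OF hT]) (use pos in auto)
    thus ?thesis by (simp add: o_def)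
  qed
  have e: "?f has_fps_expansion fps_expansion ?f 0"
    by (rule has_fps_expansion_fps_expansion[OF open_ball ball_inverse_pos hS])
  have "(deriv ^^ n) ?f 0 = c ^ n * Polygamma n 1" for n
  proof -
    have "(deriv ^^ n) ?f 0 = c ^ n * (deriv ^^ n) Digamma (c * 0 + 1)"
      by (rule higher_deriv_compose_linear'[OF hT open_ball open_halfspace_Re_gt ball_inverse_pos]) (use pos in auto)
    thus ?thesis using higher_deriv_Polygamma[of "1::complex" n 0] by simp
  qed
  hence "fps_const c * fps_expansion ?f 0 = digamma_fps c"
    by (simp add: digamma_fps_def fps_eq_iff fps_expansion_def)
  thus ?thesis using has_fps_expansion_cmult_left[OF e, of c] by (simp add: add.commute)
qed

lemma Gamma_has_fps:
  "\<exists>G. (\<lambda>z. Gamma (1 + c * z)) has_fps_expansion G \<and> exp_fps G (digamma_fps c)"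
proof -
  let ?S = "ball (0::complex) (1 / (norm c + 1))" and ?f = "\<lambda>z. Gamma (1 + c * z)"
  have ni: "1 + c * w \<notin> \<int>\<^sub>\<le>\<^sub>0" if "w \<in> ?S" for w
    using Re_one_plus_pos[OF that] by (rule not_nonpos_Ints_Re)
  have d: "(?f has_field_derivative ?f w * (c * Digamma (1 + c * w))) (at w)" if "w \<in> ?S" for w
    using ni[OF that] by (auto intro!: derivative_eq_intros)
  have "?f holomorphic_on ?S"
    by (rule holomorphic_onI, rule field_differentiable_at_within) (use d in \<open>auto simp: field_differentiable_def\<close>)
  hence G: "?f has_fps_expansion fps_expansion ?f 0"
    by (rule has_fps_expansion_fps_expansion[OF open_ball ball_inverse_pos])
  have "\<forall>\<^sub>F w in nhds 0. w \<in> ?S" by (rule eventually_nhds_in_open[OF open_ball ball_inverse_pos])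
  hence ev: "\<forall>\<^sub>F w in nhds 0. deriv ?f w = ?f w * (c * Digamma (1 + c * w))"
    by eventually_elim (rule DERIV_imp_deriv[OF d])
  have "deriv ?f has_fps_expansion fps_expansion ?f 0 * digamma_fps c"
    by (subst has_fps_expansion_cong[OF ev refl]) (intro has_fps_expansion_mult G Digamma_has_fps)
  hence "fps_deriv (fps_expansion ?f 0) = fps_expansion ?f 0 * digamma_fps c"
    by (rule fps_expansion_unique_complex[OF has_fps_expansion_deriv[OF G]])
  moreover have "fps_nth (fps_expansion ?f 0) 0 = 1" by (simp add: fps_expansion_def)
  ultimately show ?thesis using G unfolding exp_fps_def by blast
qed

lemma rGamma_has_fps:
  assumes "(\<lambda>z. Gamma (1 + c * z)) has_fps_expansion G" "exp_fps G l"
  shows "(\<lambda>z. rGamma (1 + c * z :: complex)) has_fps_expansion inverse G"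
  unfolding rGamma_inverse_Gamma
  by (rule has_fps_expansion_inverse[OF assms(1)]) (use assms(2) in \<open>simp add: exp_fps_def\<close>)

section \<open>Gamma factors at the origin\<close>

definition wz_Phi :: "complex \<Rightarrow> complex" where
  "wz_Phi z = Gamma (1 + 6 * z) * Gamma (1 + z) ^ 7 * rGamma (1 + 3 * z) ^ 3 * rGamma (1 + 2 * z) ^ 2"

text \<open>The entire function sin(pi z)/(pi z), with value 1 at 0. Written with
  \<open>rGamma\<close>, its expansion is the inverse of that of Gamma(1+z) Gamma(1-z).\<close>

definition recip_sin :: "complex \<Rightarrow> complex" where
  "recip_sin z = rGamma (1 + z) * rGamma (1 - z)"

lemma sin_recip_sin: "sin (of_real pi * z) = of_real pi * z * recip_sin z"
proof -
  have "sin (of_real pi * z) / of_real pi = rGamma z * rGamma (1 - z)" by (rule rGamma_reflection_complex[symmetric])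
  also have "rGamma z = z * rGamma (1 + z)" using rGamma_plus1[of z] by (simp add: add.commute)
  finally show ?thesis by (simp add: recip_sin_def field_simps)
qed

text \<open>The functional equation at each argument contributes constants that combine to 3^3 * 2^2
  / 6 = 18 and powers that combine to a triple pole.\<close>

lemma quotT_Phi:
  assumes "Re z > -1/6" "z \<noteq> 0"
  shows "z ^ 3 * quotT z = 18 * wz_Phi z"
proof -
  have s: "Gamma (1 + 6 * z) = 6 * z * Gamma (6 * z)" "Gamma (1 + z) = z * Gamma z"
    "Gamma (1 + 3 * z) = 3 * z * Gamma (3 * z)" "Gamma (1 + 2 * z) = 2 * z * Gamma (2 * z)"
    using assms by (intro Gamma_shift1(1); simp)+
  have nz: "Gamma (2 * z) \<noteq> 0" "Gamma (3 * z) \<noteq> 0" using assms by (intro Gamma_shift1(2); simp)+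
  show ?thesis unfolding wz_Phi_def quotT_def rGamma_inverse_Gamma s
    using nz assms(2) by (simp add: field_simps eval_nat_numeral)
qed

text \<open>Both sides satisfy the same first-order recurrence in the index, so it suffices to
  compare the first terms. The factor 3z comes from \<open>rGamma (3 * z)\<close> there.\<close>

lemma wz_term_D_term:
  assumes z: "norm z < 1/20"
  shows "wz_term z (Suc n) =
    3 * of_real pi * z * Gamma (1 + z) ^ 2 * rGamma (1 + 3 * z) ^ 2 * rGamma (1 - z) ^ 2 * D_term (Suc n) z"
proof (induction n)
  case 0
  have d: "1 + 3 * z \<noteq> 0" "1 - z \<noteq> 0" using wzQ_denominator(2)[of z] z by auto
  have e: "3 * z + 1 - of_nat (Suc 0) = 3 * z" "of_nat (Suc 0) + z = 1 + z"
    "1 + of_nat (Suc 0) + 3 * z = (1 + 3 * z) + 1" "1 + of_nat (Suc 0) - z = (1 - z) + 1" by simp_all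
  have r: "rGamma (3 * z) = 3 * z * rGamma (1 + 3 * z)" using rGamma_plus1[of "3 * z"] by (simp add: add.commute)
  have r2: "rGamma (1 + 3 * z + 1) = rGamma (1 + 3 * z) / (1 + 3 * z)" "rGamma (1 - z + 1) = rGamma (1 - z) / (1 - z)"
    using rGamma_plus1[of "1 + 3 * z"] rGamma_plus1[of "1 - z"] d by (simp_all add: field_simps)
  have "D_term (Suc 0) z = 1 / ((1 + 3 * z) * (1 - z) ^ 2)" by (simp add: D_term_def wz_prod_def wzQ0_def)
  thus ?case unfolding wz_term_def e r r2 by (simp add: power_divide power2_eq_square)
next
  case (Suc n)
  define k :: complex where "k = of_nat (Suc n)"
  have k: "k \<noteq> 0" "k + 1 \<noteq> 0" unfolding k_def by (metis of_nat_neq_0, metis of_nat_Suc add.commute of_nat_neq_0)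
  have kn: "of_nat (Suc (Suc n)) = k + 1" by (simp add: k_def)
  have d: "(1 + 3 * (z / of_nat m)) * (1 - z / of_nat m) ^ 2 \<noteq> 0" if "m > 0" for m
    using z that by (intro wzQ_denominator norm_div_nat_le') auto
  have "k + 1 + 3 * z = (k + 1) * (1 + 3 * (z / (k + 1)))" "k + 1 - z = (k + 1) * (1 - z / (k + 1))"
    using k(2) by (simp_all add: field_simps)
  hence d2: "k + 1 + 3 * z \<noteq> 0" "k + 1 - z \<noteq> 0"
    using d[of "Suc (Suc n)"] k(2) unfolding kn by auto
  have e: "3 * z + 1 - (k + 1) = 3 * z - k" "k + 1 + z = 1 + (k + z)"
    "1 + (k + 1) + 3 * z = (k + 1 + 3 * z) + 1" "1 + (k + 1) - z = (k + 1 - z) + 1" by simp_all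
  have r1: "rGamma (3 * z - k) = (3 * z - k) * rGamma (3 * z + 1 - k)"
    using rGamma_plus1[of "3 * z - k"] by (simp add: algebra_simps)
  have "Re (k + z) > 0" using z abs_Re_le_cmod[of z] by (simp add: k_def)
  hence g: "Gamma (1 + (k + z)) = (k + z) * Gamma (k + z)" by (rule Gamma_Suc)
  have r2: "rGamma (k + 1 + 3 * z + 1) = rGamma (1 + k + 3 * z) / (k + 1 + 3 * z)"
    "rGamma (k + 1 - z + 1) = rGamma (1 + k - z) / (k + 1 - z)"
    using rGamma_plus1[of "k + 1 + 3 * z"] rGamma_plus1[of "k + 1 - z"] d2 by (simp_all add: field_simps)
  have step: "wz_term z (Suc (Suc n)) = ((k + 1) * (k - 3 * z) * (k + z) ^ 2 / (k * (k + 1 + 3 * z) * (k + 1 - z) ^ 2)) * wz_term z (Suc n)"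
    unfolding wz_term_def kn k_def[symmetric] e r1 g r2 using k d2
    by (simp add: divide_simps) (simp add: algebra_simps power2_eq_square)
  have dstep: "D_term (Suc (Suc n)) z = ((k + 1) * (k - 3 * z) * (k + z) ^ 2 / (k * (k + 1 + 3 * z) * (k + 1 - z) ^ 2)) * D_term (Suc n) z"
  proof -
    have q0: "wzQ0 (z / (k + 1)) = (k + 1) ^ 3 / ((k + 1 + 3 * z) * (k + 1 - z) ^ 2)"
      "wzQ0 (z / k) = k ^ 3 / ((k + 3 * z) * (k - z) ^ 2)"
    proof -
      have aux: "wzQ0 (z / x) = x ^ 3 / ((x + 3 * z) * (x - z) ^ 2)" if "x \<noteq> 0" for x
      proof -
        have "(1 + 3 * (z / x)) * (1 - z / x) ^ 2 = ((x + 3 * z) * (x - z) ^ 2) / x ^ 3"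
          using that by (simp add: field_simps eval_nat_numeral)
        thus ?thesis by (simp add: wzQ0_def)
      qed
      show "wzQ0 (z / (k + 1)) = (k + 1) ^ 3 / ((k + 1 + 3 * z) * (k + 1 - z) ^ 2)"
        "wzQ0 (z / k) = k ^ 3 / ((k + 3 * z) * (k - z) ^ 2)" by (rule aux[OF k(2)], rule aux[OF k(1)])
    qed
    have q: "wzQ (z / k) = (k - 3 * z) * (k + z) ^ 2 / k ^ 3 * wzQ0 (z / k)"
    proof -
      have "(1 - 3 * (z / k)) * (1 + z / k) ^ 2 = (k - 3 * z) * (k + z) ^ 2 / k ^ 3"
        using k by (simp add: field_simps eval_nat_numeral)
      thus ?thesis by (simp add: wzQ_def wzQ0_def)
    qed
    have "D_term (Suc (Suc n)) z = wz_prod (Suc n) z * wzQ (z / k) * wzQ0 (z / (k + 1)) / (k + 1) ^ 2"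
      by (simp only: D_term_def wz_prod_Suc[of "Suc n"] kn k_def zero_less_Suc)
    also have "\<dots> = (k - 3 * z) * (k + z) ^ 2 / k ^ 3 * (wz_prod (Suc n) z * wzQ0 (z / k)) * ((k + 1) ^ 3 / (k + 1) ^ 2 / ((k + 1 + 3 * z) * (k + 1 - z) ^ 2))"
      unfolding q q0(1) by (simp add: mult_ac)
    also have "(k + 1) ^ 3 / (k + 1) ^ 2 = k + 1" using k by (simp add: eval_nat_numeral)
    also have "wz_prod (Suc n) z * wzQ0 (z / k) = k ^ 2 * D_term (Suc n) z"
    proof -
      have "D_term (Suc n) z = wz_prod (Suc n) z * wzQ0 (z / k) / k ^ 2" by (simp only: D_term_def k_def)
      thus ?thesis using k by simp
    qed
    also have "(k - 3 * z) * (k + z) ^ 2 / k ^ 3 * (k ^ 2 * D_term (Suc n) z) * ((k + 1) / ((k + 1 + 3 * z) * (k + 1 - z) ^ 2)) =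
       ((k + 1) * (k - 3 * z) * (k + z) ^ 2 / (k * (k + 1 + 3 * z) * (k + 1 - z) ^ 2)) * D_term (Suc n) z"
      using k by (simp add: eval_nat_numeral mult_ac)
    finally show ?thesis .
  qed
  show ?case unfolding step dstep Suc.IH by (simp only: mult_ac)
qed

lemma wz_sum_D_fun:
  assumes z: "norm z < 1/20"
  shows "wz_sum z = 3 * of_real pi * z * Gamma (1 + z) ^ 2 * rGamma (1 + 3 * z) ^ 2 * rGamma (1 - z) ^ 2 * D_fun z"
proof -
  have "summable (\<lambda>k. real k powr (- (3/2)))" by (simp add: summable_real_powr_iff)
  hence "summable (\<lambda>k. 2 * real (Suc k) powr (- (3/2)))" by (intro summable_mult) (subst summable_Suc_iff)
  hence "summable (\<lambda>n. D_term (Suc n) z)"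
    by (rule summable_comparison_test[rotated]) (use z in \<open>auto intro!: exI[of _ 0] norm_D_term_le simp del: of_nat_Suc\<close>)
  thus ?thesis unfolding wz_sum_def wz_term_D_term[OF z] D_fun_def by (rule suminf_mult)
qed

lemma wz_pre_regroup:
  fixes G :: complex
  assumes "G ^ 5 = G ^ 7 * r ^ 2"
  shows "A * G ^ 3 * R3 * R2 ^ 2 * (G ^ 2 * R3 ^ 2 * q ^ 2) = A * G ^ 7 * R3 ^ 3 * R2 ^ 2 * (r * q) ^ 2"
proof -
  have "A * G ^ 3 * R3 * R2 ^ 2 * (G ^ 2 * R3 ^ 2 * q ^ 2) = A * G ^ 5 * R3 ^ 3 * R2 ^ 2 * q ^ 2"
    by (simp add: eval_nat_numeral)
  thus ?thesis unfolding assms by (simp only: power_mult_distrib mult_ac)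
qed

text \<open>The squared sine puts z^2 before the sum and z^3 before \<open>quotT\<close>, which
  becomes 18/9 = 2 times Phi. The series part carries 8 * 3 = 24 = 2 * 12, and its Gamma factors
  combine with \<open>wz_pre\<close> to Phi times \<open>recip_sin z ^ 2\<close>.\<close>

lemma wz_total_near_0:
  assumes z: "norm z < 1/20" "z \<noteq> 0"
  shows "wz_total z = of_real pi ^ 2 * recip_sin z ^ 2 * (z ^ 2 * f14_sum z - 2 * wz_Phi z * (1 - 12 * z ^ 2 * D_fun z))"
proof -
  have Re: "Re z > -1/6" using z(1) abs_Re_le_cmod[of z] by simp
  have T: "z ^ 3 * quotT z = 18 * wz_Phi z" using Re z(2) by (rule quotT_Phi)
  have x: "Gamma (1 + z) * rGamma (1 + z) = 1"
    using Gamma_nonzero_Re[of "1 + z"] Re by (simp add: rGamma_inverse_Gamma)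
  define P R S D p G r where "P = wz_Phi z" and "R = recip_sin z" and "S = f14_sum z" and "D = D_fun z"
    and "p = (of_real pi :: complex)" and "G = Gamma (1 + z)" and "r = rGamma (1 + z)"
  have "G ^ 5 = G ^ 7 * r ^ 2"
  proof -
    have "G ^ 7 * r ^ 2 = G ^ 5 * (G * r) ^ 2" by (simp add: power_mult_distrib flip: power_add)
    thus ?thesis using x by (simp add: G_def r_def)
  qed
  hence PR: "wz_pre z * (G ^ 2 * rGamma (1 + 3 * z) ^ 2 * rGamma (1 - z) ^ 2) = P * R ^ 2"
    unfolding wz_pre_def P_def wz_Phi_def R_def recip_sin_def G_def[symmetric] r_def[symmetric]
    by (rule wz_pre_regroup)
  have "wz_total z = (p * z * R) ^ 2 * (S - z * quotT z / 9) +
      24 * p ^ 2 * z ^ 2 * (wz_pre z * (G ^ 2 * rGamma (1 + 3 * z) ^ 2 * rGamma (1 - z) ^ 2)) * D"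
    unfolding wz_total_def sin_recip_sin wz_sum_D_fun[OF z(1)] S_def D_def p_def R_def G_def
    by (simp add: power2_eq_square mult_ac)
  also have "\<dots> = p ^ 2 * R ^ 2 * (z ^ 2 * S - z ^ 3 * quotT z / 9) + 24 * p ^ 2 * z ^ 2 * (P * R ^ 2) * D"
    unfolding PR by (simp add: power2_eq_square power3_eq_cube algebra_simps)
  also have "\<dots> = p ^ 2 * R ^ 2 * (z ^ 2 * S - 2 * P * (1 - 12 * z ^ 2 * D))"
    unfolding T P_def[symmetric] by (simp add: algebra_simps)
  finally show ?thesis by (simp only: P_def R_def S_def D_def p_def)
qed

lemma trig_form:
  fixes z :: complex
  shows "a * exp (- (2 * of_real pi * \<i> * z)) + b + a * exp (2 * of_real pi * \<i> * z)
    = (a + b + a) - 4 * a * sin (of_real pi * z) ^ 2"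
proof -
  have "exp (2 * of_real pi * \<i> * z) + exp (- (2 * of_real pi * \<i> * z)) = 2 * cos (2 * (of_real pi * z))"
    by (simp add: cos_exp_eq mult_ac)
  hence "exp (2 * of_real pi * \<i> * z) + exp (- (2 * of_real pi * \<i> * z)) = 2 * (1 - 2 * sin (of_real pi * z) ^ 2)"
    by (simp only: cos_double_sin)
  moreover have "a * e' + b + a * e = (a + b + a) - 4 * a * s ^ 2" if "e + e' = 2 * (1 - 2 * s ^ 2)" for e e' s :: complex
    using that by algebra
  ultimately show ?thesis by blast
qed

lemma f14_sum_identity:
  obtains S FPhi FPsi D :: "complex fps" where
    "f14_sum has_fps_expansion S" "D_fun has_fps_expansion D"
    "exp_fps FPhi (digamma_fps 6 + of_nat 7 * digamma_fps 1 + of_nat 3 * (- digamma_fps 3) + of_nat 2 * (- digamma_fps 2))"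
    "exp_fps FPsi (of_nat 2 * (digamma_fps 1 + digamma_fps (-1)))"
    "\<And>m. m > 0 \<Longrightarrow> fps_nth S m = 2 * (fps_nth FPhi (m + 2) - 12 * (\<Sum>i\<le>m. fps_nth FPhi i * fps_nth D (m - i)) - fps_nth FPsi (m + 2))"
proof -
  obtain S where S: "f14_sum has_fps_expansion S" using f14_sum_fps by blast
  obtain D where D: "D_fun has_fps_expansion D" using D_fun_fps by blast
  obtain G where G: "\<And>c. (\<lambda>z. Gamma (1 + c * z)) has_fps_expansion G c" "\<And>c. exp_fps (G c) (digamma_fps c)"
    using Gamma_has_fps by metis
  define FPhi where "FPhi = G 6 * G 1 ^ 7 * inverse (G 3) ^ 3 * inverse (G 2) ^ 2"
  define FPsi where "FPsi = (G 1 * G (-1)) ^ 2"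
  define FR where "FR = inverse (G 1) * inverse (G (-1))"
  note rG = rGamma_has_fps[OF G]
  have Phi: "exp_fps FPhi (digamma_fps 6 + of_nat 7 * digamma_fps 1 + of_nat 3 * (- digamma_fps 3) + of_nat 2 * (- digamma_fps 2))"
    unfolding FPhi_def by (intro exp_fps_mult exp_fps_power exp_fps_inverse G)
  have Psi: "exp_fps FPsi (of_nat 2 * (digamma_fps 1 + digamma_fps (-1)))"
    unfolding FPsi_def by (intro exp_fps_mult exp_fps_power G)
  have R: "exp_fps FR (- digamma_fps 1 + - digamma_fps (-1))"
    unfolding FR_def by (intro exp_fps_mult exp_fps_inverse G)
  have Phi': "wz_Phi has_fps_expansion FPhi"
    unfolding wz_Phi_def[abs_def] FPhi_def using G(1)[of 1] G(1)[of 6] rG[of 3] rG[of 2]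
    by (intro has_fps_expansion_mult has_fps_expansion_power) simp_all
  have R': "recip_sin has_fps_expansion FR"
    unfolding recip_sin_def[abs_def] FR_def using rG[of 1] rG[of "-1"]
    by (intro has_fps_expansion_mult) simp_all
  have i1: "inverse (G c) * G c = 1" for c
    using G(2)[of c] by (intro inverse_mult_eq_1) (simp add: exp_fps_def)
  have RPsi: "FPsi * FR ^ 2 = 1"
  proof -
    have "FPsi * FR ^ 2 = ((inverse (G 1) * G 1) * (inverse (G (-1)) * G (-1))) ^ 2"
      unfolding FPsi_def FR_def by (simp only: power_mult_distrib mult_ac)
    thus ?thesis unfolding i1 by simp
  qed
  define K where "K = fps_X ^ 2 * S - 2 * FPhi * (1 - 12 * fps_X ^ 2 * D)"
  define p where "p = (of_real pi :: complex)"
  have p0: "p \<noteq> 0" by (simp add: p_def)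
  obtain a b c where abc: "\<And>z. norm z < 1/6 \<Longrightarrow> z \<noteq> 0 \<Longrightarrow>
     wz_total z = a * exp (- (2 * p * \<i> * z)) + b + c * exp (2 * p * \<i> * z)"
    using wz_total_trig unfolding p_def by blast
  define T where "T = fps_const a * fps_exp (- (2 * p * \<i>)) + fps_const b + fps_const c * fps_exp (2 * p * \<i>)"
  have K': "(\<lambda>z. z ^ 2 * f14_sum z - 2 * wz_Phi z * (1 - 12 * z ^ 2 * D_fun z)) has_fps_expansion K"
    unfolding K_def by (intro fps_expansion_intros S D Phi')
  \<comment> \<open>The formula for \<open>wz_total\<close> holds only for nonzero z. An additional
    factor z makes the two expressions agree at 0 as well and is cancelled again on the level of
    power series.\<close>
  have lhs: "(\<lambda>z. z * (p ^ 2 * (recip_sin z ^ 2 * (z ^ 2 * f14_sum z - 2 * wz_Phi z * (1 - 12 * z ^ 2 * D_fun z))))) has_fps_expansion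
      fps_X * (fps_const (p ^ 2) * (FR ^ 2 * K))"
    by (intro has_fps_expansion_mult has_fps_expansion_cmult_left has_fps_expansion_power has_fps_expansion_fps_X K' R')
  have "(\<lambda>z. a * exp (- (2 * p * \<i>) * z) + b + c * exp (2 * p * \<i> * z)) has_fps_expansion T"
    unfolding T_def by (intro has_fps_expansion_add has_fps_expansion_cmult_left has_fps_expansion_exp has_fps_expansion_const)
  hence T': "(\<lambda>z. a * exp (- (2 * p * \<i> * z)) + b + c * exp (2 * p * \<i> * z)) has_fps_expansion T" by simp
  have "\<forall>\<^sub>F z in nhds 0. z \<in> ball (0::complex) (1/20)" by (intro eventually_nhds_in_open) auto
  hence ev: "\<forall>\<^sub>F z in nhds 0. z * (a * exp (- (2 * p * \<i> * z)) + b + c * exp (2 * p * \<i> * z)) =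
      z * (p ^ 2 * (recip_sin z ^ 2 * (z ^ 2 * f14_sum z - 2 * wz_Phi z * (1 - 12 * z ^ 2 * D_fun z))))"
  proof eventually_elim
    case (elim z)
    show ?case
    proof (cases "z = 0")
      case False
      show ?thesis using abc[of z] wz_total_near_0[of z] elim False unfolding p_def by (simp add: mult.assoc)
    qed simp
  qed
  have rhs: "(\<lambda>z. z * (a * exp (- (2 * p * \<i> * z)) + b + c * exp (2 * p * \<i> * z))) has_fps_expansion fps_X * T"
    by (intro has_fps_expansion_mult has_fps_expansion_fps_X T')
  have "fps_X * T = fps_X * (fps_const (p ^ 2) * (FR ^ 2 * K))"
    by (rule fps_expansion_unique_complex[OF rhs]) (subst has_fps_expansion_cong[OF ev refl], rule lhs)
  hence TK: "T = fps_const (p ^ 2) * (FR ^ 2 * K)" using mult_left_cancel[OF fps_X_neq_zero] by blast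
  have R0: "fps_nth FR 0 = 1" and P0: "fps_nth FPhi 0 = 1" using R Phi by (auto simp: exp_fps_def)
  \<comment> \<open>The linear coefficients vanish because Euler's constant enters with the weights
    -1 + 1 and 6 + 7 - 3 * 3 - 2 * 2.\<close>
  have R1: "fps_nth FR (Suc 0) = 0" and P1: "fps_nth FPhi (Suc 0) = 0"
    using exp_fps_nth_1[OF R] exp_fps_nth_1[OF Phi] by (simp_all add: digamma_fps_def)
  have X2: "fps_nth (fps_X ^ 2 * H) 0 = 0" "fps_nth (fps_X ^ 2 * H) (Suc 0) = 0" for H :: "complex fps"
    by (simp_all add: fps_X_power_mult_nth)
  have K0: "fps_nth K 0 = -2" and K1: "fps_nth K (Suc 0) = 0"
    unfolding K_def by (simp_all add: P0 P1 X2 mult.assoc fps_mult_nth_1 numeral_fps_const)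
  have "fps_nth T 0 = p ^ 2 * -2" unfolding TK by (simp add: R0 K0 power2_eq_square)
  \<comment> \<open>\<open>FR ^ 2 * K\<close> begins with -2 and has no linear term. The constant
    term fixes the sum of the three unknowns, the linear term makes the outer two equal.\<close>
  hence T0: "a + b + c = - 2 * p ^ 2" by (simp add: T_def)
  have "fps_nth T (Suc 0) = 0" unfolding TK by (simp add: R0 K0 R1 K1 power2_eq_square fps_mult_nth_1)
  hence "p * (c - a) = 0" by (simp add: T_def algebra_simps)
  hence c: "c = a" using p0 by simp
  \<comment> \<open>With equal outer coefficients the trigonometric polynomial is a constant minus 4
    a sin^2(pi z), and the sine is pi z times \<open>recip_sin z\<close>. Multiplication by
    \<open>FPsi\<close> will then turn the second part into a pure multiple of z^2.\<close>
  have "(\<lambda>z. - 2 * p ^ 2 - 4 * a * p ^ 2 * (z ^ 2 * recip_sin z ^ 2)) has_fps_expansion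
      fps_const (- 2 * p ^ 2) - fps_const (4 * a * p ^ 2) * (fps_X ^ 2 * FR ^ 2)"
    by (intro has_fps_expansion_diff has_fps_expansion_mult has_fps_expansion_cmult_left has_fps_expansion_power
        has_fps_expansion_fps_X R' has_fps_expansion_const)
  moreover have "(\<lambda>z. - 2 * p ^ 2 - 4 * a * p ^ 2 * (z ^ 2 * recip_sin z ^ 2)) =
      (\<lambda>z. a * exp (- (2 * p * \<i> * z)) + b + c * exp (2 * p * \<i> * z))"
    unfolding c using T0 trig_form[of a _ b] sin_recip_sin
    by (simp add: fun_eq_iff c p_def power_mult_distrib mult_ac)
  ultimately have "T = fps_const (- 2 * p ^ 2) - fps_const (4 * a * p ^ 2) * (fps_X ^ 2 * FR ^ 2)"
    using fps_expansion_unique_complex[OF T'] by simp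
  also have "\<dots> = fps_const (p ^ 2) * (- 2 - fps_const (4 * a) * (fps_X ^ 2 * FR ^ 2))"
    by (simp add: algebra_simps numeral_fps_const flip: fps_const_mult)
  finally have "fps_const (p ^ 2) * (FR ^ 2 * K) = fps_const (p ^ 2) * (- 2 - fps_const (4 * a) * (fps_X ^ 2 * FR ^ 2))"
    unfolding TK .
  hence RK: "FR ^ 2 * K = - 2 - fps_const (4 * a) * (fps_X ^ 2 * FR ^ 2)"
    using p0 mult_left_cancel[of "fps_const (p ^ 2)"] by simp
  have "K = (FPsi * FR ^ 2) * K" unfolding RPsi by simp
  also have "\<dots> = FPsi * (FR ^ 2 * K)" by (simp only: mult.assoc)
  also have "\<dots> = - 2 * FPsi - fps_const (4 * a) * fps_X ^ 2 * (FPsi * FR ^ 2)"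
    unfolding RK by (simp add: algebra_simps)
  finally have KPsi: "K = fps_const (- 2) * FPsi - fps_const (4 * a) * fps_X ^ 2" unfolding RPsi by (simp add: numeral_fps_const)
  \<comment> \<open>The unknown \<open>a\<close> occurs only in the coefficient of z^2 of K, that is
    for m = 0, so m > 0 avoids it.\<close>
  have "fps_nth S m = 2 * (fps_nth FPhi (m + 2) - 12 * (\<Sum>i\<le>m. fps_nth FPhi i * fps_nth D (m - i)) - fps_nth FPsi (m + 2))"
    if m: "m > 0" for m
  proof -
    have "K = fps_X ^ 2 * S - fps_const 2 * FPhi + fps_const 24 * (fps_X ^ 2 * (FPhi * D))"
      unfolding K_def by (simp add: algebra_simps numeral_fps_const flip: fps_const_mult)
    hence "fps_nth K (m + 2) = fps_nth S m - 2 * fps_nth FPhi (m + 2) + 24 * fps_nth (FPhi * D) m"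
      by (simp add: fps_X_power_mult_nth)
    moreover have "fps_nth K (m + 2) = - 2 * fps_nth FPsi (m + 2)"
      unfolding KPsi using m by (simp add: fps_X_power_nth)
    ultimately have "fps_nth S m = 2 * (fps_nth FPhi (m + 2) - 12 * fps_nth (FPhi * D) m - fps_nth FPsi (m + 2))"
      by algebra
    thus ?thesis by (simp only: fps_mult_nth atLeast0AtMost)
  qed
  with S D Phi Psi show ?thesis by (rule that)
qed

section \<open>Evaluation\<close>

definition Z :: "nat \<Rightarrow> real" where
  "Z s = mzv (word [s])"

definition W :: real where
  "W = mzv (word [5, 3])"

lemma mzv_coeff_single: "s > 0 \<Longrightarrow> mzv_coeff (word [s]) n = (if n = 0 then 0 else 1 / real n ^ s)"
  using mzv_coeff_letter[of s "[]" n] by (simp add: mzv_trunc_Nil del: letter.simps)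

lemma Z_sums:
  assumes "s \<ge> 2"
  shows "(\<lambda>n. 1 / real (Suc n) ^ s) sums Z s"
proof -
  have "admissible (word [s])" using assms by (intro admissible_word) (simp add: index_ok_def)
  hence "mzv_coeff (word [s]) sums Z s"
    unfolding Z_def mzv_def by (intro summable_sums summable_mzv_coeff)
  moreover have "mzv_coeff (word [s]) 0 = 0" using assms mzv_coeff_single[of s 0] by simp
  ultimately have "(\<lambda>n. mzv_coeff (word [s]) (Suc n)) sums Z s" by (subst sums_Suc_iff) simp
  moreover have "mzv_coeff (word [s]) (Suc n) = 1 / real (Suc n) ^ s" for n
    using assms by (subst mzv_coeff_single) simp_all
  ultimately show ?thesis by (simp only:)
qed

lemma zeta_eq_Z: "s \<ge> 2 \<Longrightarrow> zeta (real s) = Z s"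
proof -
  assume "s \<ge> 2"
  moreover have "real (Suc n) powr - real s = 1 / real (Suc n) ^ s" for n
    by (simp add: powr_minus_divide powr_realpow del: of_nat_Suc)
  ultimately show ?thesis using sums_unique[OF Z_sums] unfolding zeta_def by (simp only:)
qed

text \<open>All terms are nonnegative, so the unordered double sum may be taken as an iterated one;
  for fixed outer index the inner finite sum is the truncated value that defines
  \<open>mzv_coeff\<close>.\<close>

lemma double_zeta_eq_mzv:
  assumes "a \<ge> 2" "b > 0"
  shows "double_zeta a b = mzv (word [a, b])"
proof -
  let ?f = "\<lambda>(k\<^sub>1, k\<^sub>2). 1 / (real k\<^sub>1 ^ a * real k\<^sub>2 ^ b)"
  let ?g = "mzv_coeff (word [a, b])"
  have "admissible (word [a, b])" using assms by (intro admissible_word) (simp add: index_ok_def)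
  hence "?g sums mzv (word [a, b])" unfolding mzv_def by (intro summable_sums summable_mzv_coeff)
  hence g: "(?g has_sum mzv (word [a, b])) UNIV" by (rule sums_nonneg_imp_has_sum) (rule mzv_coeff_nonneg)
  have S: "{(k\<^sub>1 :: nat, k\<^sub>2). k\<^sub>1 > k\<^sub>2 \<and> k\<^sub>2 > 0} = Sigma UNIV (\<lambda>k. {1..<k})" by auto
  have f: "((\<lambda>y. ?f (k, y)) has_sum ?g k) {1..<k}" for k
  proof (rule has_sum_finiteI)
    have "?g k = mzv_trunc (word [b]) k / real k ^ a"
      using mzv_coeff_letter[of a "word [b]" k] assms by simp
    also have "mzv_trunc (word [b]) k = (\<Sum>m<k. if m = 0 then 0 else 1 / real m ^ b)"
      unfolding mzv_trunc_def by (intro sum.cong refl mzv_coeff_single assms)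
    also have "\<dots> = (\<Sum>m\<in>{1..<k}. 1 / real m ^ b)"
      by (rule sum.mono_neutral_cong_right) auto
    finally show "?g k = (\<Sum>y\<in>{1..<k}. ?f (k, y))"
      by (simp add: sum_divide_distrib mult.commute)
  qed simp
  have "?f summable_on Sigma UNIV (\<lambda>k. {1..<k})"
    by (rule summable_on_SigmaI[OF f has_sum_imp_summable[OF g]]) simp
  from has_sum_SigmaI[OF f g this] show ?thesis
    unfolding double_zeta_def S by (rule infsumI)
qed

lemma Polygamma_1: "n > 0 \<Longrightarrow> Polygamma n (1 :: complex) / fact n = of_real ((-1) ^ Suc n * Z (Suc n))"
proof -
  assume n: "n > 0"
  have "(\<lambda>k. complex_of_real (1 / real (Suc k) ^ Suc n)) sums of_real (Z (Suc n))"
    using n by (intro sums_of_real Z_sums) simp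
  moreover have "complex_of_real (1 / real (Suc k) ^ Suc n) = inverse ((1 + of_nat k) ^ Suc n)" for k
    by (simp add: inverse_eq_divide)
  ultimately have "(\<Sum>k. inverse ((1 + of_nat k) ^ Suc n :: complex)) = of_real (Z (Suc n))"
    using sums_unique by (metis (no_types, lifting) ext)
  thus ?thesis using n by (simp add: Polygamma_def)
qed

text \<open>The value 0 at n = 0 is the cancellation of Euler's constant, the bracket being 6 + 7 -
  9 - 4; \<open>Z 1\<close> would not be meaningful there.\<close>

definition Phi_log :: "nat \<Rightarrow> real" where
  "Phi_log n = (if n = 0 then 0 else (6 ^ Suc n + 7 - 3 * 3 ^ Suc n - 2 * 2 ^ Suc n) * (-1) ^ Suc n * Z (Suc n))"

definition Psi_log :: "nat \<Rightarrow> real" where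
  "Psi_log n = (if n = 0 then 0 else 2 * (1 + (-1) ^ Suc n) * (-1) ^ Suc n * Z (Suc n))"

lemma nth_Phi_log: "fps_nth (digamma_fps 6 + of_nat 7 * digamma_fps 1 + of_nat 3 * (- digamma_fps 3)
    + of_nat 2 * (- digamma_fps 2)) n = of_real (Phi_log n)"
proof -
  have "fps_nth (digamma_fps 6 + of_nat 7 * digamma_fps 1 + of_nat 3 * (- digamma_fps 3)
      + of_nat 2 * (- digamma_fps 2)) n = (6 ^ Suc n + 7 - 3 * 3 ^ Suc n - 2 * 2 ^ Suc n) * (Polygamma n 1 / fact n)"
    unfolding fps_of_nat[symmetric] fps_add_nth fps_mult_left_const_nth fps_neg_nth digamma_fps_def fps_nth_Abs_fps
    by (simp add: algebra_simps diff_divide_distrib add_divide_distrib)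
  thus ?thesis by (cases "n = 0") (simp_all only: Polygamma_1 Phi_log_def, simp_all)
qed

lemma nth_Psi_log: "fps_nth (of_nat 2 * (digamma_fps 1 + digamma_fps (-1))) n = of_real (Psi_log n)"
proof -
  have "fps_nth (of_nat 2 * (digamma_fps 1 + digamma_fps (-1))) n = 2 * (1 + (-1) ^ Suc n) * (Polygamma n 1 / fact n)"
    unfolding fps_of_nat[symmetric] fps_add_nth fps_mult_left_const_nth digamma_fps_def fps_nth_Abs_fps
    by (simp add: algebra_simps)
  thus ?thesis by (cases "n = 0") (simp_all only: Polygamma_1 Psi_log_def, simp_all)
qed

definition D_coeff :: "nat \<Rightarrow> real" where
  "D_coeff n = eval_wsum mzv (D_wsum n)"

definition f14_coeff :: "(nat \<Rightarrow> real) \<Rightarrow> (nat \<Rightarrow> real) \<Rightarrow> nat \<Rightarrow> real" where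
  "f14_coeff phi psi m = 2 * (phi (m + 2) - 12 * (\<Sum>i\<le>m. phi i * D_coeff (m - i)) - psi (m + 2))"

lemma f14_deriv_sums:
  "\<exists>phi psi. phi 0 = 1 \<and> (\<forall>n. real (Suc n) * phi (Suc n) = (\<Sum>i\<le>n. phi i * Phi_log (n - i))) \<and>
     psi 0 = 1 \<and> (\<forall>n. real (Suc n) * psi (Suc n) = (\<Sum>i\<le>n. psi i * Psi_log (n - i))) \<and>
     (\<forall>m>0. (\<lambda>n. (deriv ^^ m) f14 (real (Suc n))) sums (fact m * f14_coeff phi psi m))"
proof -
  obtain S FPhi FPsi D where fps: "f14_sum has_fps_expansion S" "D_fun has_fps_expansion D"
    and Phi: "exp_fps FPhi (digamma_fps 6 + of_nat 7 * digamma_fps 1 + of_nat 3 * (- digamma_fps 3) + of_nat 2 * (- digamma_fps 2))"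
    and Psi: "exp_fps FPsi (of_nat 2 * (digamma_fps 1 + digamma_fps (-1)))"
    and S: "\<And>m. m > 0 \<Longrightarrow> fps_nth S m = 2 * (fps_nth FPhi (m + 2) - 12 * (\<Sum>i\<le>m. fps_nth FPhi i * fps_nth D (m - i)) - fps_nth FPsi (m + 2))"
    by (rule f14_sum_identity) blast
  obtain phi where phi: "\<And>n. fps_nth FPhi n = of_real (phi n)" "phi 0 = 1"
    "\<And>n. real (Suc n) * phi (Suc n) = (\<Sum>i\<le>n. phi i * Phi_log (n - i))"
    using exp_fps_real[OF Phi nth_Phi_log] by blast
  obtain psi where psi: "\<And>n. fps_nth FPsi n = of_real (psi n)" "psi 0 = 1"
    "\<And>n. real (Suc n) * psi (Suc n) = (\<Sum>i\<le>n. psi i * Psi_log (n - i))"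
    using exp_fps_real[OF Psi nth_Psi_log] by blast
  have D: "fps_nth D n = of_real (D_coeff n)" for n
    using D_fun_fps fps_expansion_unique_complex[OF fps(2)] unfolding D_coeff_def by metis
  have "(\<lambda>n. (deriv ^^ m) f14 (real (Suc n))) sums (fact m * f14_coeff phi psi m)" if m: "m > 0" for m
  proof -
    obtain G where G: "f14_sum has_fps_expansion G"
      "(\<lambda>n. of_real ((deriv ^^ m) f14 (real (Suc n)) / fact m)) sums fps_nth G m"
      using f14_sum_fps by blast
    have "fps_nth G m = of_real (f14_coeff phi psi m)"
      unfolding fps_expansion_unique_complex[OF G(1) fps(1)] S[OF m] phi(1) psi(1) D f14_coeff_def by simp
    hence "(\<lambda>n. (deriv ^^ m) f14 (real (Suc n)) / fact m) sums f14_coeff phi psi m"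
      using G(2) by (simp only: sums_of_real_iff)
    hence "(\<lambda>n. fact m * ((deriv ^^ m) f14 (real (Suc n)) / fact m)) sums (fact m * f14_coeff phi psi m)"
      by (rule sums_mult)
    thus ?thesis by simp
  qed
  with phi(2,3) psi(2,3) show ?thesis by blast
qed

section \<open>Explicit coefficients\<close>

lemma cert_2: "cert_ok (D_wsum 0) [(- 1, [], [2])] []"
  by code_simp

text \<open>The stuffle square of zeta(3) alone: expanding the first product cancels the other two
  word by word, so the list of relations is empty.\<close>

lemma cert_33: "cert_ok Zero [(1, [3], [3]), (- 2, [], [3, 3]), (- 1, [], [6])] []"
  by code_simp

lemma Z_fold: "mzv (word [s]) = Z s" "mzv (word [5, 3]) = W"
  by (simp_all only: Z_def W_def)

lemma Z_even: "Z 4 = 2 / 5 * Z 2 ^ 2" "Z 6 = 8 / 35 * Z 2 ^ 3" "Z 8 = 24 / 175 * Z 2 ^ 4"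
proof -
  have 4: "2 * (Z 2 * Z 2) - 5 * Z 4 = 0" and 6: "4 * (Z 2 * Z 4) - 7 * Z 6 = 0" and 8: "6 * (Z 2 * Z 6) - 10 * Z 8 = 0"
    using cert_sound[OF cert_even_4] cert_sound[OF cert_even_6] cert_sound[OF cert_even_8]
    by (simp_all add: Z_fold del: word.simps)
  show z4: "Z 4 = 2 / 5 * Z 2 ^ 2" using 4 by (simp add: power2_eq_square)
  show z6: "Z 6 = 8 / 35 * Z 2 ^ 3" using 6 unfolding z4 by (simp add: eval_nat_numeral)
  show "Z 8 = 24 / 175 * Z 2 ^ 4" using 8 unfolding z6 by (simp add: eval_nat_numeral)
qed

lemma mzv_33: "mzv (word [3, 3]) = (Z 3 ^ 2 - Z 6) / 2"
  using cert_sound[OF cert_33] by (simp add: Z_fold power2_eq_square del: word.simps)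

lemma D_coeff_values:
  "D_coeff 0 = 1 * Z 2"
  "D_coeff 1 = - (3 * Z 3)"
  "D_coeff 2 = 24 / 5 * Z 2 ^ 2"
  "D_coeff 3 = 42 * Z 2 * Z 3 - 120 * Z 5"
  "D_coeff 4 = 246 / 5 * Z 2 ^ 3 - 63 * Z 3 ^ 2"
  "D_coeff 5 = 1008 / 5 * Z 2 ^ 2 * Z 3 + 1398 * Z 2 * Z 5 - 13629 / 4 * Z 7"
  "D_coeff 6 = 644948 / 875 * Z 2 ^ 4 + 882 * Z 2 * Z 3 ^ 2 - 5040 * Z 3 * Z 5 - 846 / 5 * W"
  "D_coeff 7 = 10332 / 5 * Z 2 ^ 3 * Z 3 + 33552 / 5 * Z 2 ^ 2 * Z 5 + 39018 * Z 2 * Z 7 - 882 * Z 3 ^ 3 - 96532 *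
    Z 9"
proof -
  note simps = D_coeff_def[symmetric] Z_fold mzv_33 Z_even eval_scale_wsum
  show "D_coeff 0 = 1 * Z 2"
    using cert_sound[OF cert_2] by (simp add: simps field_simps power_numeral_reduce del: word.simps)
  show "D_coeff 1 = - (3 * Z 3)"
    using cert_sound[OF cert_3] by (simp add: simps field_simps power_numeral_reduce del: word.simps)
  show "D_coeff 2 = 24 / 5 * Z 2 ^ 2"
    using cert_sound[OF cert_4] by (simp add: simps field_simps power_numeral_reduce del: word.simps)
  show "D_coeff 3 = 42 * Z 2 * Z 3 - 120 * Z 5"
    using cert_sound[OF cert_5] by (simp add: simps field_simps power_numeral_reduce del: word.simps)
  show "D_coeff 4 = 246 / 5 * Z 2 ^ 3 - 63 * Z 3 ^ 2"
    using cert_sound[OF cert_6] by (simp add: simps field_simps power_numeral_reduce del: word.simps)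
  show "D_coeff 5 = 1008 / 5 * Z 2 ^ 2 * Z 3 + 1398 * Z 2 * Z 5 - 13629 / 4 * Z 7"
    using cert_sound[OF cert_7] by (simp add: simps field_simps power_numeral_reduce del: word.simps)
  show "D_coeff 6 = 644948 / 875 * Z 2 ^ 4 + 882 * Z 2 * Z 3 ^ 2 - 5040 * Z 3 * Z 5 - 846 / 5 * W"
    using cert_sound[OF cert_8] by (simp add: simps field_simps power_numeral_reduce del: word.simps)
  show "D_coeff 7 = 10332 / 5 * Z 2 ^ 3 * Z 3 + 33552 / 5 * Z 2 ^ 2 * Z 5 + 39018 * Z 2 * Z 7 - 882 * Z 3 ^ 3 - 96532 *
    Z 9"
    using cert_sound[OF cert_9] by (simp add: simps field_simps power_numeral_reduce del: word.simps)
qed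

text \<open>Both logarithmic derivatives vanish at 0, so g 1 = 0 and every term containing g 1 or r
  0 drops out of the unrolled recursion.\<close>

lemma exp_recursion:
  fixes g r :: "nat \<Rightarrow> real"
  assumes "g 0 = 1" "r 0 = 0" and rec: "\<And>n. real (Suc n) * g (Suc n) = (\<Sum>i\<le>n. g i * r (n - i))"
  shows "g 1 = 0"
  "2 * g 2 = r 1"
  "3 * g 3 = r 2"
  "4 * g 4 = r 3 + g 2 * r 1"
  "5 * g 5 = r 4 + g 2 * r 2 + g 3 * r 1"
  "6 * g 6 = r 5 + g 2 * r 3 + g 3 * r 2 + g 4 * r 1"
  "7 * g 7 = r 6 + g 2 * r 4 + g 3 * r 3 + g 4 * r 2 + g 5 * r 1"
  "8 * g 8 = r 7 + g 2 * r 5 + g 3 * r 4 + g 4 * r 3 + g 5 * r 2 + g 6 * r 1"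
  "9 * g 9 = r 8 + g 2 * r 6 + g 3 * r 5 + g 4 * r 4 + g 5 * r 3 + g 6 * r 2 + g 7 * r 1"
proof -
  show g1: "g 1 = 0" using rec[of 0] assms(1,2) by simp
  show "2 * g 2 = r 1"
    using rec[of 1] assms(1,2) g1 by (simp add: eval_nat_numeral)
  show "3 * g 3 = r 2"
    using rec[of 2] assms(1,2) g1 by (simp add: eval_nat_numeral)
  show "4 * g 4 = r 3 + g 2 * r 1"
    using rec[of 3] assms(1,2) g1 by (simp add: eval_nat_numeral)
  show "5 * g 5 = r 4 + g 2 * r 2 + g 3 * r 1"
    using rec[of 4] assms(1,2) g1 by (simp add: eval_nat_numeral)
  show "6 * g 6 = r 5 + g 2 * r 3 + g 3 * r 2 + g 4 * r 1"
    using rec[of 5] assms(1,2) g1 by (simp add: eval_nat_numeral)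
  show "7 * g 7 = r 6 + g 2 * r 4 + g 3 * r 3 + g 4 * r 2 + g 5 * r 1"
    using rec[of 6] assms(1,2) g1 by (simp add: eval_nat_numeral)
  show "8 * g 8 = r 7 + g 2 * r 5 + g 3 * r 4 + g 4 * r 3 + g 5 * r 2 + g 6 * r 1"
    using rec[of 7] assms(1,2) g1 by (simp add: eval_nat_numeral)
  show "9 * g 9 = r 8 + g 2 * r 6 + g 3 * r 5 + g 4 * r 4 + g 5 * r 3 + g 6 * r 2 + g 7 * r 1"
    using rec[of 8] assms(1,2) g1 by (simp add: eval_nat_numeral)
qed

lemma phi_values:
  fixes g :: "nat \<Rightarrow> real"
  assumes "g 0 = 1" "\<And>n. real (Suc n) * g (Suc n) = (\<Sum>i\<le>n. g i * Phi_log (n - i))"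
  shows "g 1 = 0"
    "g 2 = 4 * Z 2"
    "g 3 = - (42 * Z 3)"
    "g 4 = 554 / 5 * Z 2 ^ 2"
    "g 5 = - (168 * Z 2 * Z 3) - 1398 * Z 5"
    "g 6 = 73896 / 35 * Z 2 ^ 3 + 882 * Z 3 ^ 2"
    "g 7 = - (23268 / 5 * Z 2 ^ 2 * Z 3) - 5592 * Z 2 * Z 5 - 39018 * Z 7"
    "g 8 = 1446274 / 35 * Z 2 ^ 4 + 3528 * Z 2 * Z 3 ^ 2 + 58716 * Z 3 * Z 5"
    "g 9 = - (443376 / 5 * Z 2 ^ 3 * Z 3) - 774492 / 5 * Z 2 ^ 2 * Z 5 - 156072 * Z 2 * Z 7 - 12348 * Z 3 ^ 3 -
    1113070 * Z 9"
proof -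
  have r0: "Phi_log 0 = 0" by (simp add: Phi_log_def)
  note rec = exp_recursion[OF assms(1) r0 assms(2)]
  have r1: "Phi_log 1 = 8 * Z 2" by (simp add: Phi_log_def del: One_nat_def)
  have r2: "Phi_log 2 = -126 * Z 3" by (simp add: Phi_log_def del: One_nat_def)
  have r3: "Phi_log 3 = 1028 * Z 4" by (simp add: Phi_log_def del: One_nat_def)
  have r4: "Phi_log 4 = -6990 * Z 5" by (simp add: Phi_log_def del: One_nat_def)
  have r5: "Phi_log 5 = 44348 * Z 6" by (simp add: Phi_log_def del: One_nat_def)
  have r6: "Phi_log 6 = -273126 * Z 7" by (simp add: Phi_log_def del: One_nat_def)
  have r7: "Phi_log 7 = 1659428 * Z 8" by (simp add: Phi_log_def del: One_nat_def)
  have r8: "Phi_log 8 = -10017630 * Z 9" by (simp add: Phi_log_def del: One_nat_def)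
  note rs = r1 r2 r3 r4 r5 r6 r7 r8 Z_even
  show "g 1 = 0" by (rule rec(1))
  show g2: "g 2 = 4 * Z 2"
    using rec(2) by (simp add: rs field_simps power_numeral_reduce del: One_nat_def)
  show g3: "g 3 = - (42 * Z 3)"
    using rec(3) by (simp add: rs g2 field_simps power_numeral_reduce del: One_nat_def)
  show g4: "g 4 = 554 / 5 * Z 2 ^ 2"
    using rec(4) by (simp add: rs g2 g3 field_simps power_numeral_reduce del: One_nat_def)
  show g5: "g 5 = - (168 * Z 2 * Z 3) - 1398 * Z 5"
    using rec(5) by (simp add: rs g2 g3 g4 field_simps power_numeral_reduce del: One_nat_def)
  show g6: "g 6 = 73896 / 35 * Z 2 ^ 3 + 882 * Z 3 ^ 2"
    using rec(6) by (simp add: rs g2 g3 g4 g5 field_simps power_numeral_reduce del: One_nat_def)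
  show g7: "g 7 = - (23268 / 5 * Z 2 ^ 2 * Z 3) - 5592 * Z 2 * Z 5 - 39018 * Z 7"
    using rec(7) by (simp add: rs g2 g3 g4 g5 g6 field_simps power_numeral_reduce del: One_nat_def)
  show g8: "g 8 = 1446274 / 35 * Z 2 ^ 4 + 3528 * Z 2 * Z 3 ^ 2 + 58716 * Z 3 * Z 5"
    using rec(8) by (simp add: rs g2 g3 g4 g5 g6 g7 field_simps power_numeral_reduce del: One_nat_def)
  show g9: "g 9 = - (443376 / 5 * Z 2 ^ 3 * Z 3) - 774492 / 5 * Z 2 ^ 2 * Z 5 - 156072 * Z 2 * Z 7 - 12348 * Z 3 ^ 3 -
    1113070 * Z 9"
    using rec(9) by (simp add: rs g2 g3 g4 g5 g6 g7 g8 field_simps power_numeral_reduce del: One_nat_def)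
qed

lemma psi_values:
  fixes g :: "nat \<Rightarrow> real"
  assumes "g 0 = 1" "\<And>n. real (Suc n) * g (Suc n) = (\<Sum>i\<le>n. g i * Psi_log (n - i))"
  shows "g 1 = 0"
    "g 2 = 2 * Z 2"
    "g 3 = 0"
    "g 4 = 12 / 5 * Z 2 ^ 2"
    "g 5 = 0"
    "g 6 = 16 / 7 * Z 2 ^ 3"
    "g 7 = 0"
    "g 8 = 48 / 25 * Z 2 ^ 4"
    "g 9 = 0"
proof -
  have r0: "Psi_log 0 = 0" by (simp add: Psi_log_def)
  note rec = exp_recursion[OF assms(1) r0 assms(2)]
  have r1: "Psi_log 1 = 4 * Z 2" by (simp add: Psi_log_def del: One_nat_def)
  have r2: "Psi_log 2 = 0 * Z 3" by (simp add: Psi_log_def del: One_nat_def)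
  have r3: "Psi_log 3 = 4 * Z 4" by (simp add: Psi_log_def del: One_nat_def)
  have r4: "Psi_log 4 = 0 * Z 5" by (simp add: Psi_log_def del: One_nat_def)
  have r5: "Psi_log 5 = 4 * Z 6" by (simp add: Psi_log_def del: One_nat_def)
  have r6: "Psi_log 6 = 0 * Z 7" by (simp add: Psi_log_def del: One_nat_def)
  have r7: "Psi_log 7 = 4 * Z 8" by (simp add: Psi_log_def del: One_nat_def)
  have r8: "Psi_log 8 = 0 * Z 9" by (simp add: Psi_log_def del: One_nat_def)
  note rs = r1 r2 r3 r4 r5 r6 r7 r8 Z_even
  show "g 1 = 0" by (rule rec(1))
  show g2: "g 2 = 2 * Z 2"
    using rec(2) by (simp add: rs field_simps power_numeral_reduce del: One_nat_def)
  show g3: "g 3 = 0"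
    using rec(3) by (simp add: rs g2 field_simps power_numeral_reduce del: One_nat_def)
  show g4: "g 4 = 12 / 5 * Z 2 ^ 2"
    using rec(4) by (simp add: rs g2 g3 field_simps power_numeral_reduce del: One_nat_def)
  show g5: "g 5 = 0"
    using rec(5) by (simp add: rs g2 g3 g4 field_simps power_numeral_reduce del: One_nat_def)
  show g6: "g 6 = 16 / 7 * Z 2 ^ 3"
    using rec(6) by (simp add: rs g2 g3 g4 g5 field_simps power_numeral_reduce del: One_nat_def)
  show g7: "g 7 = 0"
    using rec(7) by (simp add: rs g2 g3 g4 g5 g6 field_simps power_numeral_reduce del: One_nat_def)
  show g8: "g 8 = 48 / 25 * Z 2 ^ 4"
    using rec(8) by (simp add: rs g2 g3 g4 g5 g6 g7 field_simps power_numeral_reduce del: One_nat_def)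
  show g9: "g 9 = 0"
    using rec(9) by (simp add: rs g2 g3 g4 g5 g6 g7 g8 field_simps power_numeral_reduce del: One_nat_def)
qed

lemma f14_coeff_values:
  fixes phi psi :: "nat \<Rightarrow> real"
  assumes "phi 0 = 1" "\<And>n. real (Suc n) * phi (Suc n) = (\<Sum>i\<le>n. phi i * Phi_log (n - i))"
    and "psi 0 = 1" "\<And>n. real (Suc n) * psi (Suc n) = (\<Sum>i\<le>n. psi i * Psi_log (n - i))"
  shows
    "fact 1 * f14_coeff phi psi 1 = - 12 * Z 3"
    "fact 2 * f14_coeff phi psi 2 = 28 * Z 4"
    "fact 3 * f14_coeff phi psi 3 = 72 * (7 * Z 5 - 4 * Z 2 * Z 3)"
    "fact 4 * f14_coeff phi psi 4 = 48 * (126 * Z 3 ^ 2 - 181 * Z 6)"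
    "fact 5 * f14_coeff phi psi 5 = 720 * (623 * Z 7 + 56 * Z 2 * Z 5 - 554 * Z 3 * Z 4)"
    "1 / 24 * (fact 6 * f14_coeff phi psi 6) = 121824 * W + 503280 * Z 3 * Z 5 + 30240 * Z 2 * Z 3 ^ 2 - 701863 * Z 8"
    "1 / 20160 * (fact 7 * f14_coeff phi psi 7) =
      22657 * Z 9 + 3738 * Z 2 * Z 7 + 5817 * Z 4 * Z 5 - 27711 * Z 3 * Z 6 - 882 * Z 3 ^ 3"
proof -
  note phi = phi_values[OF assms(1,2)] and psi = psi_values[OF assms(3,4)]
  \<comment> \<open>In this and the following convolutions the term with index 1 is missing because
    phi 1 = 0. All values are then polynomials in \<open>Z 2\<close>, the odd \<open>Z\<close> and
    \<open>W\<close>.\<close>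
  have "f14_coeff phi psi 1 = 2 * (phi 3 - 12 * (D_coeff 1) - psi 3)"
    using assms(1) phi(1) by (simp add: f14_coeff_def eval_nat_numeral)
  thus "fact 1 * f14_coeff phi psi 1 = - 12 * Z 3"
    by (simp add: phi psi D_coeff_values Z_even fact_numeral field_simps power_numeral_reduce del: One_nat_def)
  have "f14_coeff phi psi 2 = 2 * (phi 4 - 12 * (D_coeff 2 + phi 2 * D_coeff 0) - psi 4)"
    using assms(1) phi(1) by (simp add: f14_coeff_def eval_nat_numeral)
  thus "fact 2 * f14_coeff phi psi 2 = 28 * Z 4"
    by (simp add: phi psi D_coeff_values Z_even fact_numeral field_simps power_numeral_reduce del: One_nat_def)
  have "f14_coeff phi psi 3 = 2 * (phi 5 - 12 * (D_coeff 3 + phi 2 * D_coeff 1 + phi 3 * D_coeff 0) - psi 5)"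
    using assms(1) phi(1) by (simp add: f14_coeff_def eval_nat_numeral)
  thus "fact 3 * f14_coeff phi psi 3 = 72 * (7 * Z 5 - 4 * Z 2 * Z 3)"
    by (simp add: phi psi D_coeff_values Z_even fact_numeral field_simps power_numeral_reduce del: One_nat_def)
  have "f14_coeff phi psi 4 = 2 * (phi 6 - 12 * (D_coeff 4 + phi 2 * D_coeff 2 + phi 3 * D_coeff 1 + phi 4 * D_coeff 0) - psi 6)"
    using assms(1) phi(1) by (simp add: f14_coeff_def eval_nat_numeral)
  thus "fact 4 * f14_coeff phi psi 4 = 48 * (126 * Z 3 ^ 2 - 181 * Z 6)"
    by (simp add: phi psi D_coeff_values Z_even fact_numeral field_simps power_numeral_reduce del: One_nat_def)
  have "f14_coeff phi psi 5 = 2 * (phi 7 - 12 * (D_coeff 5 + phi 2 * D_coeff 3 + phi 3 * D_coeff 2 + phi 4 * D_coeff 1 + phi 5 * D_coeff 0) - psi 7)"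
    using assms(1) phi(1) by (simp add: f14_coeff_def eval_nat_numeral)
  thus "fact 5 * f14_coeff phi psi 5 = 720 * (623 * Z 7 + 56 * Z 2 * Z 5 - 554 * Z 3 * Z 4)"
    by (simp add: phi psi D_coeff_values Z_even fact_numeral field_simps power_numeral_reduce del: One_nat_def)
  have "f14_coeff phi psi 6 = 2 * (phi 8 - 12 * (D_coeff 6 + phi 2 * D_coeff 4 + phi 3 * D_coeff 3 + phi 4 * D_coeff 2 + phi 5 * D_coeff 1 + phi 6 * D_coeff 0) - psi 8)"
    using assms(1) phi(1) by (simp add: f14_coeff_def eval_nat_numeral)
  thus "1 / 24 * (fact 6 * f14_coeff phi psi 6) = 121824 * W + 503280 * Z 3 * Z 5 + 30240 * Z 2 * Z 3 ^ 2 - 701863 * Z 8"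
    by (simp add: phi psi D_coeff_values Z_even fact_numeral field_simps power_numeral_reduce del: One_nat_def)
  have "f14_coeff phi psi 7 = 2 * (phi 9 - 12 * (D_coeff 7 + phi 2 * D_coeff 5 + phi 3 * D_coeff 4 + phi 4 * D_coeff 3 + phi 5 * D_coeff 2 + phi 6 * D_coeff 1 + phi 7 * D_coeff 0) - psi 9)"
    using assms(1) phi(1) by (simp add: f14_coeff_def eval_nat_numeral)
  thus "1 / 20160 * (fact 7 * f14_coeff phi psi 7) =
      22657 * Z 9 + 3738 * Z 2 * Z 7 + 5817 * Z 4 * Z 5 - 27711 * Z 3 * Z 6 - 882 * Z 3 ^ 3"
    by (simp add: phi psi D_coeff_values Z_even fact_numeral field_simps power_numeral_reduce del: One_nat_def)
qed

theorem theorem1p16: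
  shows "(\<forall>m\<in>{1..7}. summable (\<lambda>j. (deriv ^^ m) f14 (real (Suc j)))) \<and>
    (\<Sum>j. (deriv ^^ 1) f14 (real (Suc j))) = - 12 * zeta 3 \<and>
    (\<Sum>j. (deriv ^^ 2) f14 (real (Suc j))) = 28 * zeta 4 \<and>
    (\<Sum>j. (deriv ^^ 3) f14 (real (Suc j))) = 72 * (7 * zeta 5 - 4 * zeta 2 * zeta 3) \<and>
    (\<Sum>j. (deriv ^^ 4) f14 (real (Suc j))) = 48 * (126 * zeta 3 ^ 2 - 181 * zeta 6) \<and>
    (\<Sum>j. (deriv ^^ 5) f14 (real (Suc j))) = 720 * (623 * zeta 7 + 56 * zeta 2 * zeta 5 - 554 * zeta 3 * zeta 4) \<and>
    1 / 24 * (\<Sum>j. (deriv ^^ 6) f14 (real (Suc j))) =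
      121824 * double_zeta 5 3 + 503280 * zeta 3 * zeta 5 + 30240 * zeta 2 * zeta 3 ^ 2
        - 701863 * zeta 8 \<and>
    1 / 20160 * (\<Sum>j. (deriv ^^ 7) f14 (real (Suc j))) =
      22657 * zeta 9 + 3738 * zeta 2 * zeta 7 + 5817 * zeta 4 * zeta 5 - 27711 * zeta 3 * zeta 6
        - 882 * zeta 3 ^ 3"
proof -
  obtain phi psi where rec: "phi 0 = 1" "\<And>n. real (Suc n) * phi (Suc n) = (\<Sum>i\<le>n. phi i * Phi_log (n - i))"
      "psi 0 = 1" "\<And>n. real (Suc n) * psi (Suc n) = (\<Sum>i\<le>n. psi i * Psi_log (n - i))"
    and sums: "\<And>m. m > 0 \<Longrightarrow> (\<lambda>n. (deriv ^^ m) f14 (real (Suc n))) sums (fact m * f14_coeff phi psi m)"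
    using f14_deriv_sums by blast
  have zeta: "zeta 2 = Z 2" "zeta 3 = Z 3" "zeta 4 = Z 4" "zeta 5 = Z 5" "zeta 6 = Z 6" "zeta 7 = Z 7" "zeta 8 = Z 8" "zeta 9 = Z 9"
    using zeta_eq_Z[of 2] zeta_eq_Z[of 3] zeta_eq_Z[of 4] zeta_eq_Z[of 5] zeta_eq_Z[of 6] zeta_eq_Z[of 7] zeta_eq_Z[of 8] zeta_eq_Z[of 9]
    by simp_all
  have W: "double_zeta 5 3 = W" unfolding W_def by (rule double_zeta_eq_mzv) simp_all
  have suminf: "(\<Sum>j. (deriv ^^ m) f14 (real (Suc j))) = fact m * f14_coeff phi psi m" if "m > 0" for m
    using sums_unique[OF sums[OF that]] by (rule sym)
  have "\<forall>m\<in>{1..7}. summable (\<lambda>j. (deriv ^^ m) f14 (real (Suc j)))"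
    using sums_summable[OF sums] by auto
  moreover note f14_coeff_values[OF rec]
  moreover have "(0::nat) < 1" "(0::nat) < 2" "(0::nat) < 3" "(0::nat) < 4" "(0::nat) < 5" "(0::nat) < 6" "(0::nat) < 7" by simp_all
  note suminfs = this[THEN suminf]
  ultimately show ?thesis unfolding zeta W suminfs by (intro conjI)
qed

end
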